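(* Let $\lambda$ be a partition with at most $n$ parts and let $T\in\mathcal{KN}(\lambda,n)$. Consider all KN skew tableaux $S$ on the alphabet $[\pm n]$ that have the same number of columns of each length as $T$ and that rectify to $T$. Replace each column of $T$ by the column of the same length taken from the set of right columns $r(D)$, where $D$ runs over the last (rightmost) columns of all such skew tableaux $S$. Then the resulting tableau is a key tableau in type $C$. (This tableau is denoted $K_+(T)$ and called the right key of $T$.)
   Context: Fix $n\ge 1$ and let $[\pm n]=\{1<\dots<n<\overline n<\dots<\overline 1\}$, where $\overline i=-i$. Columns. A column is a strictly increasing (top to bottom) sequence in $[\pm n]$, identified with its set of letters. A column $C$ is admissible if for every $i\in[n]$ such that $i$ and $\overline i$ both occur in $C$, with $i$ in the $a$-th row from the top and $\overline i$ in the $b$-th row from the bottom, $a+b\le i$. Let $C$ be admissible and let $I=\{z_1>\dots>z_r\}$ be the set of $z\in[n]$ with $z,\overline z\in C$. Then there is $J=\{t_1>\dots>t_r\}\subseteq[n]$ where $t_1$ is the greatest letter of $[n]$ with $t_1<z_1$, $t_1\notin C$, $\overline{t_1}\notin C$, and for $i\ge2$, $t_i$ is the greatest letter of $[n]$ with $t_i<\min(t_{i-1},z_i)$, $t_i\notin C$, $\overline{t_i}\notin C$. The right column $r(C)$ is obtained from $C$ by replacing each $\overline{z_i}$ by $\overline{t_i}$ and reordering; the left column $\ell(C)$ is obtained by replacing each $z_i$ by $t_i$ and reordering. Tableaux. A semistandard skew tableau of shape $\mu/\nu$ on $[\pm n]$ is a filling of the skew diagram (English notation) strictly increasing down columns and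 weakly increasing along rows. It is a KN (Kashiwara-Nakashima) skew tableau if all its columns are admissible and its split form, obtained by replacing each column $C$ by the two columns $\ell(C)\,r(C)$ (in the same rows), is semistandard. $\mathcal{KN}(\lambda,n)$ is the set of KN tableaux of partition shape $\lambda$. The column reading word $cr(S)$ is read down columns, columns from right to left. A key tableau in type $C$ is a KN tableau of partition shape such that the set of letters of each column is contained in that of the previous (left) column and $i,\overline i$ do not both appear as entries, for any $i\in[n]$. Crystal on words. For a word $w$ in $[\pm n]$ and $i\in[n]$: if $i<n$, give sign $+$ to letters $i,\overline{i+1}$ and sign $-$ to letters $i+1,\overline i$; if $i=n$, give sign $+$ to $n$ and $-$ to $\overline n$. Repeatedly delete pairs consisting of a $+$ and a $-$ to its right with no undeleted sign between them, leaving $-^a+^b$. If $b>0$, $f_i(w)$ is obtained by changing the letter of the leftmost remaining $+$ ($i\mapsto i+1$, $\overline{i+1}\mapsto\overline i$, or $n\mapsto\overline n$ when $i=n$); otherwise $f_i(w)=0$. If $a>0$, $e_i(w)$ is obtained by changing the letter of the rightmost remaining $-$ by the inverse substitution; otherwise $e_i(w)=0$. The weight of a word is the vector in $\mathbb Z^n$ whose $i$-th entry is the number of $i$'s minus the number of $\overline i$'s. This gives a crystal graph on all words (edges $w\xrightarrow{i}f_i(w)$). Rectification. For a word $w$, $P(w)$ is the unique KN tableau $T$ (of partition shape with at most $n$ rows) such that there is a weight-preserving isomorphism of crystals from the connected component of $w$ to that of $cr(T)$ sending $w$ to $cr(T)$. The rectification of a KN skew tableau $S$ (by symplectic jeu de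 taquin) is $P(cr(S))$; $S$ rectifies to $T$ if $P(cr(S))=T$. For a given $T$, among the KN skew tableaux $S$ with the same number of (nonempty) columns of each length as $T$ and rectifying to $T$, the last (rightmost) column of $S$ depends only on its length, and every column length of $T$ occurs; hence the set of last columns has exactly one element for each distinct column length of $T$. *)

theory Defs
  imports Main
begin

section \<open>Letters and columns\<close>

text \<open>
  The letter \<open>i\<close> of \<open>[n]\<close> is the integer \<open>i\<close> and the barred letter is the integer \<open>- i\<close>.
  The order \<open>1 < \<dots> < n < -n < \<dots> < -1\<close> is the order of the ranks \<open>1, \<dots>, 2n\<close>.
\<close>

definition letters :: "nat \<Rightarrow> int set" where
  "letters n = {x. x \<noteq> 0 \<and> \<bar>x\<bar> \<le> int n}"

definition rank :: "nat \<Rightarrow> int \<Rightarrow> int" where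
  "rank n x = (if 0 < x then x else 2 * int n + 1 + x)"

text \<open>Columns are listed from top to bottom.\<close>

definition is_column :: "nat \<Rightarrow> int list \<Rightarrow> bool" where
  "is_column n C \<longleftrightarrow> set C \<subseteq> letters n \<and> sorted_wrt (\<lambda>x y. rank n x < rank n y) C"

text \<open>The list indices \<open>a\<close> and \<open>b\<close> start at 0, row numbers start at 1.\<close>

definition admissible :: "nat \<Rightarrow> int list \<Rightarrow> bool" where
  "admissible n C \<longleftrightarrow> is_column n C \<and>
     (\<forall>i\<in>{1..n}. \<forall>a<length C. \<forall>b<length C.
        C ! a = int i \<and> rev C ! b = - int i \<longrightarrow> (a + 1) + (b + 1) \<le> i)"

definition z_list :: "nat \<Rightarrow> int list \<Rightarrow> int list" where
  "z_list n C = rev (filter (\<lambda>z. z \<in> set C \<and> - z \<in> set C) [1..int n])"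

text \<open>
  The argument \<open>b\<close> is the previously chosen letter; it starts at \<open>n + 1\<close>, which imposes no
  constraint on \<open>t\<^sub>1\<close>. The sets below are nonempty if \<open>C\<close> is admissible.
\<close>

fun t_list_from :: "int list \<Rightarrow> int \<Rightarrow> int list \<Rightarrow> int list" where
  "t_list_from C b [] = []"
| "t_list_from C b (z # zs) =
     (let t = Max {t. 1 \<le> t \<and> t < min b z \<and> t \<notin> set C \<and> - t \<notin> set C}
      in t # t_list_from C t zs)"

definition t_list :: "nat \<Rightarrow> int list \<Rightarrow> int list" where
  "t_list n C = t_list_from C (int n + 1) (z_list n C)"

definition right_column :: "nat \<Rightarrow> int list \<Rightarrow> int list" where
  "right_column n C = sort_key (rank n)
     (map (\<lambda>x. case map_of (zip (z_list n C) (t_list n C)) (- x) of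
                  Some t \<Rightarrow> - t | None \<Rightarrow> x) C)"

definition left_column :: "nat \<Rightarrow> int list \<Rightarrow> int list" where
  "left_column n C = sort_key (rank n)
     (map (\<lambda>x. case map_of (zip (z_list n C) (t_list n C)) x of
                  Some t \<Rightarrow> t | None \<Rightarrow> x) C)"

section \<open>Tableaux\<close>

text \<open>A partition is the list of its (positive) parts; columns are numbered from 0.\<close>

definition is_partition :: "nat list \<Rightarrow> bool" where
  "is_partition \<mu> \<longleftrightarrow> sorted_wrt (\<ge>) \<mu> \<and> 0 \<notin> set \<mu>"

definition width :: "nat list \<Rightarrow> nat" where
  "width \<mu> = (if \<mu> = [] then 0 else hd \<mu>)"

definition col_height :: "nat list \<Rightarrow> nat \<Rightarrow> nat" where
  "col_height \<mu> j = length (filter (\<lambda>p. j < p) \<mu>)"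

text \<open>
  A filling of a skew diagram is the list of its columns from left to right, where a column is
  given by the number of rows above its top cell and by its letters. A column of
  \<open>\<mu>/\<nu>\<close> may be empty.
\<close>

type_synonym tableau = "(nat \<times> int list) list"

definition has_shape :: "nat list \<Rightarrow> nat list \<Rightarrow> tableau \<Rightarrow> bool" where
  "has_shape \<mu> \<nu> S \<longleftrightarrow> is_partition \<mu> \<and> is_partition \<nu> \<and>
     length \<nu> \<le> length \<mu> \<and> (\<forall>i<length \<nu>. \<nu> ! i \<le> \<mu> ! i) \<and>
     length S = width \<mu> \<and>
     (\<forall>j<length S. fst (S ! j) = col_height \<nu> j \<and>
        fst (S ! j) + length (snd (S ! j)) = col_height \<mu> j)"

definition cells :: "tableau \<Rightarrow> (nat \<times> nat) set" where
  "cells S = {(i, j). j < length S \<and> fst (S ! j) \<le> i \<and> i < fst (S ! j) + length (snd (S ! j))}"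

definition entry :: "tableau \<Rightarrow> nat \<Rightarrow> nat \<Rightarrow> int" where
  "entry S i j = snd (S ! j) ! (i - fst (S ! j))"

definition semistandard :: "nat \<Rightarrow> tableau \<Rightarrow> bool" where
  "semistandard n S \<longleftrightarrow>
     (\<forall>(i, j)\<in>cells S. entry S i j \<in> letters n) \<and>
     (\<forall>i i' j. (i, j) \<in> cells S \<and> (i', j) \<in> cells S \<and> i < i' \<longrightarrow>
        rank n (entry S i j) < rank n (entry S i' j)) \<and>
     (\<forall>i j j'. (i, j) \<in> cells S \<and> (i, j') \<in> cells S \<and> j < j' \<longrightarrow>
        rank n (entry S i j) \<le> rank n (entry S i j'))"

definition split_form :: "nat \<Rightarrow> tableau \<Rightarrow> tableau" where
  "split_form n S = concat (map (\<lambda>(t, C). [(t, left_column n C), (t, right_column n C)]) S)"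

definition KN_skew :: "nat list \<Rightarrow> nat list \<Rightarrow> nat \<Rightarrow> tableau set" where
  "KN_skew \<mu> \<nu> n = {S. has_shape \<mu> \<nu> S \<and> semistandard n S \<and>
     (\<forall>(t, C)\<in>set S. admissible n C) \<and> semistandard n (split_form n S)}"

definition KN :: "nat list \<Rightarrow> nat \<Rightarrow> tableau set" where
  "KN lam n = KN_skew lam [] n"

definition column_reading :: "tableau \<Rightarrow> int list" where
  "column_reading S = concat (rev (map snd S))"

definition key_tableau :: "nat \<Rightarrow> tableau \<Rightarrow> bool" where
  "key_tableau n K \<longleftrightarrow> (\<exists>lam. K \<in> KN lam n) \<and>
     (\<forall>j. Suc j < length K \<longrightarrow> set (snd (K ! Suc j)) \<subseteq> set (snd (K ! j))) \<and>
     (\<forall>i\<in>{1..n}. \<not> (int i \<in> set (column_reading K) \<and> - int i \<in> set (column_reading K)))"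

section \<open>The crystal on words\<close>

definition letter_sign :: "nat \<Rightarrow> nat \<Rightarrow> int \<Rightarrow> int" where
  "letter_sign n i x =
     (if i < n then
        (if x = int i \<or> x = - int (i + 1) then 1
         else if x = int (i + 1) \<or> x = - int i then - 1 else 0)
      else (if x = int n then 1 else if x = - int n then - 1 else 0))"

text \<open>A signature lists pairs of a position in the word and the nonzero sign at this position.\<close>

definition signature :: "nat \<Rightarrow> nat \<Rightarrow> int list \<Rightarrow> (nat \<times> int) list" where
  "signature n i w =
     filter (\<lambda>(k, s). s \<noteq> 0) (map (\<lambda>k. (k, letter_sign n i (w ! k))) [0..<length w])"

text \<open>
  Adding a sign on the left of a signature without adjacent \<open>+-\<close> can create only one such pair,
  at its left end, and deleting that pair creates no further one. Hence folding from the right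
  deletes all pairs \<open>+-\<close>.
\<close>

fun add_sign :: "nat \<times> int \<Rightarrow> (nat \<times> int) list \<Rightarrow> (nat \<times> int) list" where
  "add_sign p [] = [p]"
| "add_sign p (q # qs) = (if snd p = 1 \<and> snd q = - 1 then qs else p # q # qs)"

definition reduced_signature :: "nat \<Rightarrow> nat \<Rightarrow> int list \<Rightarrow> (nat \<times> int) list" where
  "reduced_signature n i w = foldr add_sign (signature n i w) []"

definition lower_letter :: "nat \<Rightarrow> nat \<Rightarrow> int \<Rightarrow> int" where
  "lower_letter n i x =
     (if i < n then (if x = int i then int (i + 1) else - int i) else - int n)"

definition raise_letter :: "nat \<Rightarrow> nat \<Rightarrow> int \<Rightarrow> int" where
  "raise_letter n i x =
     (if i < n then (if x = int (i + 1) then int i else - int (i + 1)) else int n)"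

text \<open>The value 0 of the crystal operators is \<^const>\<open>None\<close>.\<close>

definition f_op :: "nat \<Rightarrow> nat \<Rightarrow> int list \<Rightarrow> int list option" where
  "f_op n i w = (let ps = filter (\<lambda>(k, s). s = 1) (reduced_signature n i w) in
     if ps = [] then None
     else (let k = fst (hd ps) in Some (w[k := lower_letter n i (w ! k)])))"

definition e_op :: "nat \<Rightarrow> nat \<Rightarrow> int list \<Rightarrow> int list option" where
  "e_op n i w = (let ms = filter (\<lambda>(k, s). s = - 1) (reduced_signature n i w) in
     if ms = [] then None
     else (let k = fst (last ms) in Some (w[k := raise_letter n i (w ! k)])))"

text \<open>The \<open>i\<close>-th entry of the weight, for \<open>i\<close> in \<open>[n]\<close>.\<close>

definition weight :: "int list \<Rightarrow> nat \<Rightarrow> int" where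
  "weight w i = int (count_list w (int i)) - int (count_list w (- int i))"

definition crystal_edges :: "nat \<Rightarrow> (int list \<times> int list) set" where
  "crystal_edges n = {(u, v). \<exists>i\<in>{1..n}. f_op n i u = Some v}"

definition component :: "nat \<Rightarrow> int list \<Rightarrow> int list set" where
  "component n w = {v. (w, v) \<in> (crystal_edges n \<union> (crystal_edges n)\<inverse>)\<^sup>*}"

definition crystal_iso :: "nat \<Rightarrow> int list \<Rightarrow> int list \<Rightarrow> (int list \<Rightarrow> int list) \<Rightarrow> bool" where
  "crystal_iso n w w' \<phi> \<longleftrightarrow> bij_betw \<phi> (component n w) (component n w') \<and>
     (\<forall>u\<in>component n w. \<forall>i\<in>{1..n}.
        f_op n i (\<phi> u) = map_option \<phi> (f_op n i u) \<and>
        e_op n i (\<phi> u) = map_option \<phi> (e_op n i u) \<and>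
        weight (\<phi> u) i = weight u i)"

section \<open>Rectification and the right key\<close>

definition P_tableau :: "nat \<Rightarrow> int list \<Rightarrow> tableau" where
  "P_tableau n w = (THE T. (\<exists>lam. length lam \<le> n \<and> T \<in> KN lam n) \<and>
     (\<exists>\<phi>. crystal_iso n w (column_reading T) \<phi> \<and> \<phi> w = column_reading T))"

definition rectification :: "nat \<Rightarrow> tableau \<Rightarrow> tableau" where
  "rectification n S = P_tableau n (column_reading S)"

definition num_columns :: "tableau \<Rightarrow> nat \<Rightarrow> nat" where
  "num_columns S k = length (filter (\<lambda>(t, C). length C = k) S)"

definition last_column :: "tableau \<Rightarrow> int list" where
  "last_column S = last (filter (\<lambda>C. C \<noteq> []) (map snd S))"

definition right_key_columns :: "nat \<Rightarrow> tableau \<Rightarrow> int list set" where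
  "right_key_columns n T = {right_column n (last_column S) | S.
     (\<exists>\<mu> \<nu>. S \<in> KN_skew \<mu> \<nu> n) \<and>
     (\<forall>k\<ge>1. num_columns S k = num_columns T k) \<and> rectification n S = T}"

text \<open>
  The set \<^term>\<open>right_key_columns n T\<close> has exactly one element of each column length of \<open>T\<close>.
\<close>

definition right_key :: "nat \<Rightarrow> tableau \<Rightarrow> tableau" where
  "right_key n T =
     map (\<lambda>(t, C). (t, THE D. D \<in> right_key_columns n T \<and> length D = length C)) T"

end

theory Submission
  imports Defs
begin

text \<open>
  A column \<open>C\<close> is sent to the pair formed by \<open>r(C)\<close> and the complement of the bar of \<open>\<ell>(C)\<close>, which is
  a pair of type \<open>A\<close> columns on \<open>2n\<close> letters. Under this map the operator of index \<open>i < n\<close> becomes the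
  product of the type \<open>A\<close> operators of index \<open>i\<close> and \<open>2n - i\<close>, and the operator of index \<open>n\<close> becomes
  the square of the type \<open>A\<close> operator of index \<open>n\<close>. In type \<open>A\<close>, moving one letter between two
  adjacent columns according to a bracketing rule commutes with all operators; hence highest weight
  elements with the same weight up to full columns have isomorphic components. This gives existence
  and uniqueness of the rectification, and it shows that a skew tableau rectifying to \<open>T\<close> with the
  column lengths of \<open>T\<close> is obtained from a list of columns \<open>{1, \<dots>, k}\<close> by the same lowering path as
  \<open>T\<close>. Permuting all but its last column does not change \<open>r\<close> of that column, whereas exchanging the
  last two columns, of lengths \<open>k < l\<close>, is a sequence of moves of letters between the first two of the
  type \<open>A\<close> columns, so the right column of length \<open>k\<close> is contained in the one of length \<open>l\<close>.
\<close>

section \<open>Tensor products of crystals\<close>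

text \<open>The pair of columns comes from folding the diagram of type A with
  \<open>2 * n - 1\<close> nodes onto type C: the nodes \<open>i\<close> and
  \<open>2 * n - i\<close> are identified, and the fixed node \<open>n\<close> counts twice. A
  column of length \<open>k\<close> thereby becomes a pair of lengths \<open>k\<close> and
  \<open>2 * n - k\<close>. The obstacle is that exchanging two adjacent type C columns has no
  simple direct description, whereas in type A an exchange consists of moves of single letters, and
  a move only removes letters from the column where it starts. Inclusions of right columns are
  therefore read off in type A, where the right column is itself the first member of the pair.
  Isomorphisms are carried as bi-unique relations closed under all operators, so that a property of
  related lists, such as an inclusion of first columns, holds along a whole component without any
  map being computed. Columns are listed from right to left, in reading order, so the last column of
  a tableau is the head of its list. The absence of opposite letters in the key comes from two
  facts: a right column never contains both \<open>i\<close> and \<open>- i\<close>, and nested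
  columns have all their letters in the largest one.\<close>

fun teps :: "('a \<Rightarrow> nat) \<Rightarrow> ('a \<Rightarrow> nat) \<Rightarrow> 'a list \<Rightarrow> nat" where
  "teps ep ph [] = 0"
| "teps ep ph (x # xs) = ep x + (teps ep ph xs - ph x)"

fun tphi :: "('a \<Rightarrow> nat) \<Rightarrow> ('a \<Rightarrow> nat) \<Rightarrow> 'a list \<Rightarrow> nat" where
  "tphi ep ph [] = 0"
| "tphi ep ph (x # xs) = tphi ep ph xs + (ph x - teps ep ph xs)"

text \<open>The next two functions are only meaningful where \<open>tphi\<close>, respectively \<open>teps\<close>, is positive.\<close>

fun tlow :: "('a \<Rightarrow> nat) \<Rightarrow> ('a \<Rightarrow> nat) \<Rightarrow> ('a \<Rightarrow> 'a) \<Rightarrow> 'a list \<Rightarrow> 'a list" where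
  "tlow ep ph f [] = []"
| "tlow ep ph f (x # xs) = (if teps ep ph xs < ph x then f x # xs else x # tlow ep ph f xs)"

fun trai :: "('a \<Rightarrow> nat) \<Rightarrow> ('a \<Rightarrow> nat) \<Rightarrow> ('a \<Rightarrow> 'a) \<Rightarrow> 'a list \<Rightarrow> 'a list" where
  "trai ep ph e [] = []"
| "trai ep ph e (x # xs) = (if ph x < teps ep ph xs then x # trai ep ph e xs else e x # xs)"

text \<open>The surviving signs of a list form a block of minus signs followed by a block of plus
  signs, and truncated subtraction counts what survives when two such blocks meet. The rule is then
  the associativity of cancellation.\<close>

lemma teps_append:
  "teps ep ph (xs @ ys) = teps ep ph xs + (teps ep ph ys - tphi ep ph xs)"
  by (induction xs) auto

lemma tphi_append:
  "tphi ep ph (xs @ ys) = tphi ep ph ys + (tphi ep ph xs - teps ep ph ys)"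
  by (induction xs) (auto simp: teps_append)

lemma tlow_append:
  "tlow ep ph f (xs @ ys) =
     (if teps ep ph ys < tphi ep ph xs then tlow ep ph f xs @ ys else xs @ tlow ep ph f ys)"
  by (induction xs) (auto simp: teps_append)

text \<open>The disjunct \<open>xs = []\<close> is there because \<open>trai\<close> applies
  \<open>e\<close> to the head by default when no minus sign is left; an empty first factor has to
  pass the operator on to \<open>ys\<close>.\<close>

lemma trai_append:
  "trai ep ph e (xs @ ys) =
     (if tphi ep ph xs < teps ep ph ys \<or> xs = [] then xs @ trai ep ph e ys
      else trai ep ph e xs @ ys)"
  by (induction xs) (auto simp: teps_append)

lemma length_tlow [simp]: "length (tlow ep ph f xs) = length xs"
  by (induction xs) auto

lemma length_trai [simp]: "length (trai ep ph e xs) = length xs"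
  by (induction xs) auto

lemma tlow_map_inv:
  "(\<And>x. x \<in> set xs \<Longrightarrow> 0 < ph x \<Longrightarrow> g (f x) = g x) \<Longrightarrow> map g (tlow ep ph f xs) = map g xs"
  by (induction xs) auto

text \<open>Positivity of \<open>teps\<close> keeps \<open>trai\<close> out of its default branch,
  in which \<open>e\<close> would be applied to an element with \<open>ep\<close> equal to
  0.\<close>

lemma trai_map_inv:
  "(\<And>x. x \<in> set xs \<Longrightarrow> 0 < ep x \<Longrightarrow> g (e x) = g x) \<Longrightarrow> 0 < teps ep ph xs \<Longrightarrow>
    map g (trai ep ph e xs) = map g xs"
  by (induction xs) auto

text \<open>The predicate \<open>P\<close> restricts the law to a set closed under the operators: it
  is \<open>adm n\<close> for type C columns and trivial for letters and type A columns.\<close>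

definition crystal_law ::
  "('a \<Rightarrow> bool) \<Rightarrow> ('a \<Rightarrow> nat) \<Rightarrow> ('a \<Rightarrow> nat) \<Rightarrow> ('a \<Rightarrow> 'a) \<Rightarrow> ('a \<Rightarrow> 'a) \<Rightarrow> bool" where
  "crystal_law P ep ph f e \<longleftrightarrow>
     (\<forall>x. P x \<longrightarrow>
        (0 < ph x \<longrightarrow> P (f x) \<and> ep (f x) = Suc (ep x) \<and> ph x = Suc (ph (f x)) \<and> e (f x) = x) \<and>
        (0 < ep x \<longrightarrow> P (e x) \<and> ph (e x) = Suc (ph x) \<and> ep x = Suc (ep (e x)) \<and> f (e x) = x))"

lemma crystal_law_low:
  assumes "crystal_law P ep ph f e" "P x" "0 < ph x"
  shows "P (f x)" "ep (f x) = Suc (ep x)" "ph x = Suc (ph (f x))" "e (f x) = x"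
  using assms unfolding crystal_law_def by blast+

lemma crystal_law_rai:
  assumes "crystal_law P ep ph f e" "P x" "0 < ep x"
  shows "P (e x)" "ph (e x) = Suc (ph x)" "ep x = Suc (ep (e x))" "f (e x) = x"
  using assms unfolding crystal_law_def by blast+

lemma tensor_low:
  assumes "crystal_law P ep ph f e" "list_all P xs" "0 < tphi ep ph xs"
  shows "list_all P (tlow ep ph f xs) \<and>
    teps ep ph (tlow ep ph f xs) = Suc (teps ep ph xs) \<and>
    tphi ep ph xs = Suc (tphi ep ph (tlow ep ph f xs)) \<and>
    trai ep ph e (tlow ep ph f xs) = xs"
  using assms(2,3)
proof (induction xs)
  case (Cons x xs)
  show ?case
  proof (cases "teps ep ph xs < ph x")
    case True
    then have "0 < ph x" by simp
    moreover have "P x" "list_all P xs" using Cons.prems by auto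
    ultimately show ?thesis using True crystal_law_low[OF assms(1), of x] by auto
  next
    case False
    with Cons show ?thesis by auto
  qed
qed simp

lemma tensor_rai:
  assumes "crystal_law P ep ph f e" "list_all P xs" "0 < teps ep ph xs"
  shows "list_all P (trai ep ph e xs) \<and>
    tphi ep ph (trai ep ph e xs) = Suc (tphi ep ph xs) \<and>
    teps ep ph xs = Suc (teps ep ph (trai ep ph e xs)) \<and>
    tlow ep ph f (trai ep ph e xs) = xs"
  using assms(2,3)
proof (induction xs)
  case (Cons x xs)
  show ?case
  proof (cases "ph x < teps ep ph xs")
    case True
    with Cons show ?thesis by auto
  next
    case False
    then have "0 < ep x" using Cons.prems by simp
    moreover have "P x" "list_all P xs" using Cons.prems by auto
    ultimately show ?thesis using False crystal_law_rai[OF assms(1), of x] by auto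
  qed
qed simp

section \<open>The crystal of words\<close>

definition leps :: "nat \<Rightarrow> nat \<Rightarrow> int \<Rightarrow> nat" where
  "leps n i x = (if letter_sign n i x = - 1 then 1 else 0)"

definition lphi :: "nat \<Rightarrow> nat \<Rightarrow> int \<Rightarrow> nat" where
  "lphi n i x = (if letter_sign n i x = 1 then 1 else 0)"

abbreviation weps where "weps n i \<equiv> teps (leps n i) (lphi n i)"
abbreviation wphi where "wphi n i \<equiv> tphi (leps n i) (lphi n i)"
abbreviation wlow where "wlow n i \<equiv> tlow (leps n i) (lphi n i) (lower_letter n i)"
abbreviation wrai where "wrai n i \<equiv> trai (leps n i) (lphi n i) (raise_letter n i)"

lemma crystal_law_letters:
  assumes "i \<in> {1..n}"
  shows "crystal_law (\<lambda>_. True) (leps n i) (lphi n i) (lower_letter n i) (raise_letter n i)"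
  using assms
  by (auto simp: crystal_law_def leps_def lphi_def letter_sign_def lower_letter_def
      raise_letter_def split: if_splits)

text \<open>The offset \<open>m\<close> makes positions compatible with recursion: the tail of a
  word is treated with offset \<open>Suc m\<close>.\<close>

definition signature_from :: "nat \<Rightarrow> nat \<Rightarrow> nat \<Rightarrow> int list \<Rightarrow> (nat \<times> int) list" where
  "signature_from m n i w =
     filter (\<lambda>(k, s). s \<noteq> 0) (map (\<lambda>k. (m + k, letter_sign n i (w ! k))) [0..<length w])"

lemma signature_from_Nil [simp]: "signature_from m n i [] = []"
  by (simp add: signature_from_def)

lemma signature_from_Cons:
  "signature_from m n i (x # w) =
     (if letter_sign n i x = 0 then [] else [(m, letter_sign n i x)]) @ signature_from (Suc m) n i w"
proof -
  have *: "[0..<Suc (length w)] = 0 # map Suc [0..<length w]"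
    by (simp add: map_Suc_upt upt_conv_Cons del: upt_Suc)
  show ?thesis
    unfolding signature_from_def by (simp add: * comp_def del: upt_Suc)
qed

lemma letter_sign_cases: "letter_sign n i x \<in> {- 1, 0, 1}"
  by (auto simp: letter_sign_def)

text \<open>A new plus sign on the left either deletes the first sign of the block of minus signs
  or, if that block is empty, starts the block of plus signs; this is the recursion of
  \<open>weps\<close> and \<open>wphi\<close>. The last two conjuncts follow the position of the
  letter that an operator changes.\<close>

lemma reduced_signature_from:
  "\<exists>ms ps. foldr add_sign (signature_from m n i w) [] =
      map (\<lambda>p. (p, - 1)) ms @ map (\<lambda>p. (p, 1)) ps \<and>
    length ms = weps n i w \<and> length ps = wphi n i w \<and>
    (ps \<noteq> [] \<longrightarrow> (\<exists>q. hd ps = m + q \<and> wlow n i w = w[q := lower_letter n i (w ! q)])) \<and>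
    (ms \<noteq> [] \<longrightarrow> (\<exists>q. last ms = m + q \<and> wrai n i w = w[q := raise_letter n i (w ! q)]))"
proof (induction w arbitrary: m)
  case (Cons x w)
  obtain ms ps where IH: "foldr add_sign (signature_from (Suc m) n i w) [] =
      map (\<lambda>p. (p, - 1)) ms @ map (\<lambda>p. (p, 1)) ps"
    "length ms = weps n i w" "length ps = wphi n i w"
    "ps \<noteq> [] \<Longrightarrow> \<exists>q. hd ps = Suc m + q \<and> wlow n i w = w[q := lower_letter n i (w ! q)]"
    "ms \<noteq> [] \<Longrightarrow> \<exists>q. last ms = Suc m + q \<and> wrai n i w = w[q := raise_letter n i (w ! q)]"
    using Cons.IH[of "Suc m"] by blast
  have low: "\<exists>q. hd ps = m + q \<and> x # wlow n i w = (x # w)[q := lower_letter n i ((x # w) ! q)]"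
    if ne: "ps \<noteq> []"
  proof -
    obtain q where "hd ps = Suc m + q" "wlow n i w = w[q := lower_letter n i (w ! q)]"
      using IH(4)[OF ne] by blast
    then show ?thesis by (intro exI[of _ "Suc q"]) auto
  qed
  have rai: "\<exists>q. last ms = m + q \<and> x # wrai n i w = (x # w)[q := raise_letter n i ((x # w) ! q)]"
    if ne: "ms \<noteq> []"
  proof -
    obtain q where "last ms = Suc m + q" "wrai n i w = w[q := raise_letter n i (w ! q)]"
      using IH(5)[OF ne] by blast
    then show ?thesis by (intro exI[of _ "Suc q"]) auto
  qed
  have rai0: "wrai n i (x # w) = (x # w)[0 := raise_letter n i ((x # w) ! 0)]"
    if "weps n i w \<le> lphi n i x" using that by simp
  have low0: "wlow n i (x # w) = (x # w)[0 := lower_letter n i ((x # w) ! 0)]"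
    if "weps n i w < lphi n i x" using that by simp
  consider "letter_sign n i x = 0" | "letter_sign n i x = - 1" | "letter_sign n i x = 1"
    using letter_sign_cases[of n i x] by auto
  then show ?case
  proof cases
    case 1
    then have s: "leps n i x = 0" "lphi n i x = 0" by (auto simp: leps_def lphi_def)
    have "ms \<noteq> [] \<Longrightarrow> wrai n i (x # w) = x # wrai n i w" using s IH(2) by auto
    moreover have "wlow n i (x # w) = x # wlow n i w" using s by auto
    ultimately show ?thesis using 1 s IH(1-3) low rai
      by - (rule exI[of _ ms], rule exI[of _ ps], simp add: signature_from_Cons)
  next
    case 2
    then have s: "leps n i x = 1" "lphi n i x = 0" by (auto simp: leps_def lphi_def)
    have 3: "foldr add_sign (signature_from m n i (x # w)) [] =
        map (\<lambda>p. (p, - 1)) (m # ms) @ map (\<lambda>p. (p, 1)) ps"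
      using 2 IH(1)
      by (cases ms; cases ps) (auto simp: signature_from_Cons)
    have "wlow n i (x # w) = x # wlow n i w" using s by auto
    moreover have "\<exists>q. last (m # ms) = m + q \<and>
        wrai n i (x # w) = (x # w)[q := raise_letter n i ((x # w) ! q)]"
    proof (cases "ms = []")
      case True
      then show ?thesis using rai0 s IH(2) by (intro exI[of _ 0]) simp
    next
      case False
      then have "wrai n i (x # w) = x # wrai n i w" using s IH(2) by auto
      then show ?thesis using rai False by simp
    qed
    ultimately show ?thesis using s IH(2,3) 3 low
      by - (rule exI[of _ "m # ms"], rule exI[of _ ps], simp)
  next
    case 3
    then have s: "leps n i x = 0" "lphi n i x = 1" by (auto simp: leps_def lphi_def)
    show ?thesis
    proof (cases ms)
      case Nil
      have 4: "foldr add_sign (signature_from m n i (x # w)) [] =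
          map (\<lambda>p. (p, - 1)) ms @ map (\<lambda>p. (p, 1)) (m # ps)"
        using 3 IH(1) Nil by (cases ps) (auto simp: signature_from_Cons)
      have "\<exists>q. hd (m # ps) = m + q \<and>
          wlow n i (x # w) = (x # w)[q := lower_letter n i ((x # w) ! q)]"
        using low0 s IH(2) Nil by (intro exI[of _ 0]) simp
      then show ?thesis using s IH(2,3) Nil 4
        by - (rule exI[of _ ms], rule exI[of _ "m # ps"], simp)
    next
      case (Cons a ms')
      have 4: "foldr add_sign (signature_from m n i (x # w)) [] =
          map (\<lambda>p. (p, - 1)) ms' @ map (\<lambda>p. (p, 1)) ps"
        using 3 IH(1) Cons by (auto simp: signature_from_Cons)
      have len: "weps n i w = Suc (length ms')" using IH(2) Cons by simp
      have "wlow n i (x # w) = x # wlow n i w" using s len by auto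
      moreover have "\<exists>q. last ms' = m + q \<and>
          wrai n i (x # w) = (x # w)[q := raise_letter n i ((x # w) ! q)]" if "ms' \<noteq> []"
      proof -
        have "wrai n i (x # w) = x # wrai n i w" using s len that by auto
        then show ?thesis using rai Cons that by simp
      qed
      ultimately show ?thesis using s IH(3) len 4 low
        by - (rule exI[of _ ms'], rule exI[of _ ps], simp)
    qed
  qed
qed simp

lemma f_op_eq: "f_op n i w = (if wphi n i w = 0 then None else Some (wlow n i w))"
  and e_op_eq: "e_op n i w = (if weps n i w = 0 then None else Some (wrai n i w))"
proof -
  have sg: "reduced_signature n i w = foldr add_sign (signature_from 0 n i w) []"
    by (simp add: reduced_signature_def signature_def signature_from_def)
  obtain ms ps where r: "reduced_signature n i w =
      map (\<lambda>p. (p, - 1)) ms @ map (\<lambda>p. (p, 1)) ps"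
    "length ms = weps n i w" "length ps = wphi n i w"
    "ps \<noteq> [] \<Longrightarrow> wlow n i w = w[hd ps := lower_letter n i (w ! hd ps)]"
    "ms \<noteq> [] \<Longrightarrow> wrai n i w = w[last ms := raise_letter n i (w ! last ms)]"
    using reduced_signature_from[where m=0 and n=n and i=i and w=w] unfolding sg by auto
  have 1: "filter (\<lambda>(k, s). s = 1) (reduced_signature n i w) = map (\<lambda>p. (p, 1)) ps"
    "filter (\<lambda>(k, s). s = - 1) (reduced_signature n i w) = map (\<lambda>p. (p, - 1)) ms"
    unfolding r(1) by (simp_all add: comp_def)
  show "f_op n i w = (if wphi n i w = 0 then None else Some (wlow n i w))"
    unfolding f_op_def 1 Let_def using r(3,4) by (cases ps) auto
  show "e_op n i w = (if weps n i w = 0 then None else Some (wrai n i w))"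
    unfolding e_op_def 1 Let_def using r(2)[symmetric] r(5) by (auto simp: last_map)
qed

lemma weight_Cons: "weight (x # w) i = weight [x] i + weight w i"
  by (simp add: weight_def)

text \<open>Cancellation removes one sign of each kind, so the difference is additive over the
  letters; it is the pairing of the weight with a simple coroot.\<close>

lemma wphi_minus_weps:
  assumes "i \<in> {1..n}"
  shows "int (wphi n i w) - int (weps n i w) =
    (if i < n then weight w i - weight w (Suc i) else weight w i)"
proof (induction w)
  case Nil
  show ?case by (simp add: weight_def)
next
  case (Cons x w)
  have "int (lphi n i x) - int (leps n i x) =
      (if i < n then weight [x] i - weight [x] (Suc i) else weight [x] i)"
    using assms by (auto simp: weight_def lphi_def leps_def letter_sign_def)
  moreover have "int (wphi n i (x # w)) - int (weps n i (x # w)) =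
      int (lphi n i x) - int (leps n i x) + (int (wphi n i w) - int (weps n i w))"
    by (simp add: of_nat_diff_if)
  ultimately show ?case
    using Cons weight_Cons[of x w i] weight_Cons[of x w "Suc i"] by auto
qed

text \<open>The differences in \<open>wphi_minus_weps\<close> give the last entry of the weight and
  all differences of consecutive entries, so descending from \<open>n\<close> recovers the weight.
  Hence an isomorphism that respects \<open>weps\<close> and \<open>wphi\<close> preserves
  weights.\<close>

lemma weight_eqI:
  assumes "\<And>i. i \<in> {1..n} \<Longrightarrow> weps n i u = weps n i v \<and> wphi n i u = wphi n i v"
    and "i \<in> {1..n}"
  shows "weight u i = weight v i"
proof -
  have "i \<le> n" "1 \<le> i" using assms(2) by auto
  then show ?thesis
  proof (induction i rule: inc_induct)
    case base
    then show ?case using wphi_minus_weps[of n n] assms(1)[of n] by (metis atLeastAtMost_iff less_irrefl order_refl)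
  next
    case (step i)
    then have "weight u i - weight u (Suc i) = weight v i - weight v (Suc i)"
      using wphi_minus_weps[of i n u] wphi_minus_weps[of i n v] assms(1)[of i] by auto
    with step show ?case by simp
  qed
qed

section \<open>Pointed isomorphisms of components and bisimulations\<close>

definition word_iso :: "nat \<Rightarrow> int list \<Rightarrow> int list \<Rightarrow> bool" where
  "word_iso n w w' \<longleftrightarrow> (\<exists>\<phi>. crystal_iso n w w' \<phi> \<and> \<phi> w = w')"

lemma crystal_edges_iff:
  "(u, v) \<in> crystal_edges n \<longleftrightarrow> (\<exists>i\<in>{1..n}. 0 < wphi n i u \<and> v = wlow n i u)"
  by (auto simp: crystal_edges_def f_op_eq)

lemma crystal_edges_converse_iff:
  "(v, u) \<in> crystal_edges n \<longleftrightarrow> (\<exists>i\<in>{1..n}. 0 < weps n i u \<and> v = wrai n i u)"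
proof
  assume "(v, u) \<in> crystal_edges n"
  then obtain i where i: "i \<in> {1..n}" "0 < wphi n i v" "u = wlow n i v"
    unfolding crystal_edges_iff by blast
  then show "\<exists>i\<in>{1..n}. 0 < weps n i u \<and> v = wrai n i u"
    using tensor_low[OF crystal_law_letters[OF i(1)], of v]
    by (intro bexI[OF _ i(1)]) (simp add: list_all_iff)
next
  assume "\<exists>i\<in>{1..n}. 0 < weps n i u \<and> v = wrai n i u"
  then obtain i where i: "i \<in> {1..n}" "0 < weps n i u" "v = wrai n i u" by blast
  then show "(v, u) \<in> crystal_edges n"
    using tensor_rai[OF crystal_law_letters[OF i(1)], of u]
    unfolding crystal_edges_iff by (intro bexI[of _ i]) (auto simp: list_all_iff)
qed

lemma component_eq:
  assumes "(u, v) \<in> crystal_edges n \<or> (v, u) \<in> crystal_edges n"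
  shows "component n u = component n v"
proof -
  let ?R = "crystal_edges n \<union> (crystal_edges n)\<inverse>"
  have "(u, v) \<in> ?R" "(v, u) \<in> ?R" using assms by auto
  then show ?thesis unfolding component_def
    by (auto intro: converse_rtrancl_into_rtrancl)
qed

lemma component_self: "w \<in> component n w"
  by (simp add: component_def)

lemma word_iso_eps_phi:
  assumes "word_iso n w w'" "i \<in> {1..n}"
  shows "weps n i w = 0 \<longleftrightarrow> weps n i w' = 0" "wphi n i w = 0 \<longleftrightarrow> wphi n i w' = 0"
    "weight w i = weight w' i"
proof -
  obtain \<phi> where \<phi>: "crystal_iso n w w' \<phi>" "\<phi> w = w'"
    using assms(1) unfolding word_iso_def by blast
  then have *: "f_op n i w' = map_option \<phi> (f_op n i w)" "e_op n i w' = map_option \<phi> (e_op n i w)"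
    "weight w' i = weight w i"
    using assms(2) component_self[of w n] unfolding crystal_iso_def by metis+
  then show "weps n i w = 0 \<longleftrightarrow> weps n i w' = 0" "wphi n i w = 0 \<longleftrightarrow> wphi n i w' = 0"
    "weight w i = weight w' i"
    by (auto simp: f_op_eq e_op_eq split: if_splits)
qed

lemma word_iso_low:
  assumes "word_iso n w w'" "i \<in> {1..n}" "0 < wphi n i w"
  shows "word_iso n (wlow n i w) (wlow n i w')"
proof -
  obtain \<phi> where \<phi>: "crystal_iso n w w' \<phi>" "\<phi> w = w'"
    using assms(1) unfolding word_iso_def by blast
  have p: "0 < wphi n i w'" using word_iso_eps_phi[OF assms(1,2)] assms(3) by simp
  have "f_op n i w' = map_option \<phi> (f_op n i w)"
    using \<phi> assms(2) component_self[of w n] unfolding crystal_iso_def by metis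
  then have 1: "\<phi> (wlow n i w) = wlow n i w'" using p assms(3) by (simp add: f_op_eq)
  have "component n (wlow n i w) = component n w" "component n (wlow n i w') = component n w'"
    by (rule component_eq; use p assms(2,3) in \<open>unfold crystal_edges_iff, blast\<close>)+
  then show ?thesis using \<phi> 1 unfolding word_iso_def crystal_iso_def by auto
qed

lemma word_iso_rai:
  assumes "word_iso n w w'" "i \<in> {1..n}" "0 < weps n i w"
  shows "word_iso n (wrai n i w) (wrai n i w')"
proof -
  obtain \<phi> where \<phi>: "crystal_iso n w w' \<phi>" "\<phi> w = w'"
    using assms(1) unfolding word_iso_def by blast
  have p: "0 < weps n i w'" using word_iso_eps_phi[OF assms(1,2)] assms(3) by simp
  have "e_op n i w' = map_option \<phi> (e_op n i w)"
    using \<phi> assms(2) component_self[of w n] unfolding crystal_iso_def by metis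
  then have 1: "\<phi> (wrai n i w) = wrai n i w'" using p assms(3) by (simp add: e_op_eq)
  have "component n (wrai n i w) = component n w" "component n (wrai n i w') = component n w'"
    by (rule component_eq; use p assms(2,3) in \<open>unfold crystal_edges_converse_iff, blast\<close>)+
  then show ?thesis using \<phi> 1 unfolding word_iso_def crystal_iso_def by auto
qed

text \<open>Kept generic because it serves both for words with the indices \<open>{1..n}\<close> and
  for lists of type A columns with the indices \<open>{1..<N}\<close>.\<close>

definition bisimulation ::
  "'i set \<Rightarrow> ('i \<Rightarrow> 'a \<Rightarrow> nat) \<Rightarrow> ('i \<Rightarrow> 'a \<Rightarrow> nat) \<Rightarrow> ('i \<Rightarrow> 'a \<Rightarrow> 'a) \<Rightarrow> ('i \<Rightarrow> 'a \<Rightarrow> 'a) \<Rightarrow>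
    ('a \<Rightarrow> 'a \<Rightarrow> bool) \<Rightarrow> bool" where
  "bisimulation I ep ph f e R \<longleftrightarrow> (\<forall>x y. R x y \<longrightarrow> (\<forall>i\<in>I. ep i x = ep i y \<and> ph i x = ph i y \<and>
     (0 < ph i x \<longrightarrow> R (f i x) (f i y)) \<and> (0 < ep i x \<longrightarrow> R (e i x) (e i y))))"

lemma bisimulationD:
  assumes "bisimulation I ep ph f e R" "R x y" "i \<in> I"
  shows "ep i x = ep i y" "ph i x = ph i y" "0 < ph i x \<Longrightarrow> R (f i x) (f i y)"
    "0 < ep i x \<Longrightarrow> R (e i x) (e i y)"
  using assms unfolding bisimulation_def by blast+

lemma bisimulation_component:
  assumes R: "bisimulation {1..n} (weps n) (wphi n) (wlow n) (wrai n) R" and "R w w'"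
    and "u \<in> component n w"
  shows "\<exists>u'\<in>component n w'. R u u'"
  using assms(3) unfolding component_def mem_Collect_eq
proof (induction rule: rtrancl_induct)
  case base
  then show ?case using assms(2) by auto
next
  case (step u v)
  then obtain u' where u': "(w', u') \<in> (crystal_edges n \<union> (crystal_edges n)\<inverse>)\<^sup>*" "R u u'" by blast
  from step(2) consider "(u, v) \<in> crystal_edges n" | "(v, u) \<in> crystal_edges n" by blast
  then obtain v' where "R v v'" "(u', v') \<in> crystal_edges n \<union> (crystal_edges n)\<inverse>"
  proof cases
    case 1
    then obtain i where i: "i \<in> {1..n}" "0 < wphi n i u" "v = wlow n i u"
      by (auto simp: crystal_edges_iff)
    then have "R v (wlow n i u')" "(u', wlow n i u') \<in> crystal_edges n"
      using bisimulationD[OF R u'(2) i(1)] by (auto simp: crystal_edges_iff)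
    then show ?thesis using that by blast
  next
    case 2
    then obtain i where i: "i \<in> {1..n}" "0 < weps n i u" "v = wrai n i u"
      by (auto simp: crystal_edges_converse_iff)
    then have "R v (wrai n i u')" "(wrai n i u', u') \<in> crystal_edges n"
      using bisimulationD[OF R u'(2) i(1)] by (auto simp: crystal_edges_converse_iff)
    then show ?thesis using that by blast
  qed
  with u'(1) show ?case by (auto intro: rtrancl_into_rtrancl)
qed

lemma bisimulation_conversep:
  "bisimulation I ep ph f e R \<Longrightarrow> bisimulation I ep ph f e R\<inverse>\<inverse>"
  unfolding bisimulation_def by simp

text \<open>A bi-unique bisimulation restricts to the graph of a bijection between the components of
  two related words; surjectivity is obtained from the converse relation, which is again a
  bisimulation.\<close>

lemma word_iso_if_bisimulation:
  assumes R: "bisimulation {1..n} (weps n) (wphi n) (wlow n) (wrai n) R"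
    and bu: "bi_unique R" and w: "R w w'"
  shows "word_iso n w w'"
proof -
  define \<phi> where "\<phi> u = (THE u'. R u u')" for u
  have \<phi>: "\<phi> u = u'" if "R u u'" for u u'
    unfolding \<phi>_def using that bu by (auto dest: bi_uniqueDr)
  have ex: "\<exists>u'\<in>component n w'. R u u'" if "u \<in> component n w" for u
    by (rule bisimulation_component[OF R w that])
  have ex': "\<exists>u\<in>component n w. R u u'" if "u' \<in> component n w'" for u'
    using bisimulation_component[OF bisimulation_conversep[OF R], of w' w] w that by auto
  have "inj_on \<phi> (component n w)"
    using ex \<phi> bi_uniqueDl[OF bu] by (intro inj_onI) metis
  moreover have "\<phi> ` component n w = component n w'"
  proof (intro set_eqI iffI)
    fix v assume "v \<in> \<phi> ` component n w"
    then obtain u where u: "u \<in> component n w" "v = \<phi> u" by blast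
    then show "v \<in> component n w'" using ex[OF u(1)] \<phi> by auto
  next
    fix v assume "v \<in> component n w'"
    then obtain u where "u \<in> component n w" "R u v" using ex' by blast
    then show "v \<in> \<phi> ` component n w" using \<phi> by (metis imageI)
  qed
  moreover have "f_op n i (\<phi> u) = map_option \<phi> (f_op n i u) \<and>
      e_op n i (\<phi> u) = map_option \<phi> (e_op n i u) \<and> weight (\<phi> u) i = weight u i"
    if u: "u \<in> component n w" and i: "i \<in> {1..n}" for u i
  proof -
    obtain u' where u': "R u u'" using ex[OF u] by blast
    note D = bisimulationD[OF R u']
    have "weight u' i = weight u i"
      using D(1,2) by (intro weight_eqI[OF _ i]) auto
    then show ?thesis
      using D[OF i] \<phi>[OF u'] \<phi>[of "wlow n i u"] \<phi>[of "wrai n i u"]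
      by (auto simp: f_op_eq e_op_eq)
  qed
  ultimately have "crystal_iso n w w' \<phi>"
    unfolding crystal_iso_def bij_betw_def by blast
  then show ?thesis using \<phi>[OF w] unfolding word_iso_def by blast
qed

section \<open>Columns in type A\<close>

text \<open>A column is read in increasing order, so \<open>i\<close> and \<open>i + 1\<close> in
  the same column contribute a plus followed by a minus and cancel.\<close>

definition aeps :: "nat \<Rightarrow> nat set \<Rightarrow> nat" where
  "aeps i U = (if i \<notin> U \<and> Suc i \<in> U then 1 else 0)"

definition aphi :: "nat \<Rightarrow> nat set \<Rightarrow> nat" where
  "aphi i U = (if i \<in> U \<and> Suc i \<notin> U then 1 else 0)"

definition alow :: "nat \<Rightarrow> nat set \<Rightarrow> nat set" where
  "alow i U = insert (Suc i) (U - {i})"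

definition arai :: "nat \<Rightarrow> nat set \<Rightarrow> nat set" where
  "arai i U = insert i (U - {Suc i})"

abbreviation Aeps where "Aeps i \<equiv> teps (aeps i) (aphi i)"
abbreviation Aphi where "Aphi i \<equiv> tphi (aeps i) (aphi i)"
abbreviation Alow where "Alow i \<equiv> tlow (aeps i) (aphi i) (alow i)"
abbreviation Arai where "Arai i \<equiv> trai (aeps i) (aphi i) (arai i)"

lemma crystal_law_sets: "crystal_law (\<lambda>_. True) (aeps i) (aphi i) (alow i) (arai i)"
  by (auto simp: crystal_law_def aeps_def aphi_def alow_def arai_def split: if_splits)

text \<open>\<open>Q\<close> holds for all related pairs, hence for the images of \<open>L\<close>
  and \<open>L'\<close> under every common sequence of operators. In this way an inclusion of
  columns travels from highest weight elements to the whole component.\<close>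

definition aiso :: "nat \<Rightarrow> (nat set list \<Rightarrow> nat set list \<Rightarrow> bool) \<Rightarrow> nat set list \<Rightarrow> nat set list \<Rightarrow> bool"
  where "aiso N Q L L' \<longleftrightarrow> (\<exists>R. bisimulation {1..<N} Aeps Aphi Alow Arai R \<and> bi_unique R \<and>
    R L L' \<and> (\<forall>Y Y'. R Y Y' \<longrightarrow> Q Y Y'))"

abbreviation "aiso0 N \<equiv> aiso N (\<lambda>_ _. True)"

lemma aisoI:
  "bisimulation {1..<N} Aeps Aphi Alow Arai R \<Longrightarrow> bi_unique R \<Longrightarrow> R L L' \<Longrightarrow>
    (\<And>Y Y'. R Y Y' \<Longrightarrow> Q Y Y') \<Longrightarrow> aiso N Q L L'"
  unfolding aiso_def by blast

lemma aiso_mono: "aiso N Q L L' \<Longrightarrow> (\<And>Y Y'. Q Y Y' \<Longrightarrow> Q' Y Y') \<Longrightarrow> aiso N Q' L L'"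
  unfolding aiso_def by blast

lemma aiso_refl: "(\<And>Y. Q Y Y) \<Longrightarrow> aiso N Q L L"
  by (rule aisoI[where R = "(=)"]) (auto simp: bisimulation_def bi_unique_def)

lemma aiso_trans:
  assumes "aiso N Q L L'" "aiso N Q' L' L''" "\<And>X Y Z. Q X Y \<Longrightarrow> Q' Y Z \<Longrightarrow> Q'' X Z"
  shows "aiso N Q'' L L''"
proof -
  obtain R where R: "bisimulation {1..<N} Aeps Aphi Alow Arai R" "bi_unique R" "R L L'"
    "\<And>Y Y'. R Y Y' \<Longrightarrow> Q Y Y'"
    using assms(1) unfolding aiso_def by blast
  obtain R' where R': "bisimulation {1..<N} Aeps Aphi Alow Arai R'" "bi_unique R'" "R' L' L''"
    "\<And>Y Y'. R' Y Y' \<Longrightarrow> Q' Y Y'"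
    using assms(2) unfolding aiso_def by blast
  show ?thesis
  proof (rule aisoI[where R = "R OO R'"])
    show "bisimulation {1..<N} Aeps Aphi Alow Arai (R OO R')"
      unfolding bisimulation_def
    proof (intro allI impI ballI)
      fix x z i assume "(R OO R') x z" and i: "i \<in> {1..<N}"
      then obtain y where xy: "R x y" "R' y z" by blast
      note a = bisimulationD[OF R(1) xy(1) i] and b = bisimulationD[OF R'(1) xy(2) i]
      show "Aeps i x = Aeps i z \<and> Aphi i x = Aphi i z \<and>
        (0 < Aphi i x \<longrightarrow> (R OO R') (Alow i x) (Alow i z)) \<and>
        (0 < Aeps i x \<longrightarrow> (R OO R') (Arai i x) (Arai i z))"
      proof (intro conjI impI)
        assume "0 < Aphi i x"
        then show "(R OO R') (Alow i x) (Alow i z)" using a(2,3) b(3) by (intro relcomppI) auto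
      next
        assume "0 < Aeps i x"
        then show "(R OO R') (Arai i x) (Arai i z)" using a(1,4) b(4) by (intro relcomppI) auto
      qed (use a b in auto)
    qed
    show "bi_unique (R OO R')"
      using R(2) R'(2) by (auto simp: bi_unique_def relcompp_apply) metis+
    show "(R OO R') L L''" using R(3) R'(3) by blast
    show "Q'' Y Y'" if "(R OO R') Y Y'" for Y Y'
      using that R(4) R'(4) assms(3) by blast
  qed
qed

lemma aiso_sym:
  assumes "aiso N Q L L'" "\<And>X Y. Q X Y \<Longrightarrow> Q' Y X"
  shows "aiso N Q' L' L"
proof -
  obtain R where R: "bisimulation {1..<N} Aeps Aphi Alow Arai R" "bi_unique R" "R L L'"
    "\<And>Y Y'. R Y Y' \<Longrightarrow> Q Y Y'"
    using assms(1) unfolding aiso_def by blast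
  show ?thesis
  proof (rule aisoI[where R = "R\<inverse>\<inverse>"])
    show "bisimulation {1..<N} Aeps Aphi Alow Arai R\<inverse>\<inverse>" by (rule bisimulation_conversep[OF R(1)])
    show "bi_unique R\<inverse>\<inverse>" using R(2) unfolding bi_unique_def by blast
    show "R\<inverse>\<inverse> L' L" using R(3) by blast
    show "Q' Y Y'" if "R\<inverse>\<inverse> Y Y'" for Y Y' using that R(4) assms(2) by blast
  qed
qed

lemma aiso_eps_phi:
  assumes "aiso N Q L L'" "i \<in> {1..<N}"
  shows "Aeps i L = Aeps i L'" "Aphi i L = Aphi i L'"
proof -
  obtain R where R: "bisimulation {1..<N} Aeps Aphi Alow Arai R" "R L L'"
    using assms(1) unfolding aiso_def by blast
  show "Aeps i L = Aeps i L'" "Aphi i L = Aphi i L'"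
    using bisimulationD(1,2)[OF R assms(2)] by auto
qed

text \<open>Whether an operator acts on the first or on the second factor depends only on
  \<open>Aeps\<close> and \<open>Aphi\<close>, which related lists share. The recorded lengths fix
  the place of the cut, as bi-uniqueness requires.\<close>

lemma aiso_append:
  assumes "aiso N Q1 L1 L1'" "aiso N Q2 L2 L2'"
  shows "aiso N (\<lambda>Y Y'. \<exists>A B A' B'. Y = A @ B \<and> Y' = A' @ B' \<and> Q1 A A' \<and> Q2 B B' \<and>
    length A = length L1 \<and> length A' = length L1') (L1 @ L2) (L1' @ L2')"
proof -
  obtain R where R: "bisimulation {1..<N} Aeps Aphi Alow Arai R" "bi_unique R" "R L1 L1'"
    "\<And>Y Y'. R Y Y' \<Longrightarrow> Q1 Y Y'"
    using assms(1) unfolding aiso_def by blast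
  obtain R' where R': "bisimulation {1..<N} Aeps Aphi Alow Arai R'" "bi_unique R'" "R' L2 L2'"
    "\<And>Y Y'. R' Y Y' \<Longrightarrow> Q2 Y Y'"
    using assms(2) unfolding aiso_def by blast
  define S where "S Y Y' \<longleftrightarrow> (\<exists>A B A' B'. Y = A @ B \<and> Y' = A' @ B' \<and> R A A' \<and> R' B B' \<and>
    length A = length L1 \<and> length A' = length L1')" for Y Y'
  show ?thesis
  proof (rule aisoI[where R = S])
    show "bi_unique S"
      using R(2) R'(2) by (auto simp: bi_unique_def S_def)
    show "bisimulation {1..<N} Aeps Aphi Alow Arai S"
      unfolding bisimulation_def
    proof (intro allI impI ballI)
      fix Y Y' i assume "S Y Y'" and i: "i \<in> {1..<N}"
      then obtain A B A' B' where Y: "Y = A @ B" "Y' = A' @ B'" "R A A'" "R' B B'"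
        and len: "length A = length L1" "length A' = length L1'"
        unfolding S_def by blast
      note a = bisimulationD[OF R(1) Y(3) i] and b = bisimulationD[OF R'(1) Y(4) i]
      show "Aeps i Y = Aeps i Y' \<and> Aphi i Y = Aphi i Y' \<and>
        (0 < Aphi i Y \<longrightarrow> S (Alow i Y) (Alow i Y')) \<and> (0 < Aeps i Y \<longrightarrow> S (Arai i Y) (Arai i Y'))"
      proof (intro conjI impI)
        show "Aeps i Y = Aeps i Y'" "Aphi i Y = Aphi i Y'"
          using a(1,2) b(1,2) by (simp_all add: Y teps_append tphi_append)
      next
        assume pos: "0 < Aphi i Y"
        show "S (Alow i Y) (Alow i Y')"
        proof (cases "Aeps i B < Aphi i A")
          case True
          then show ?thesis using a b Y(4) len unfolding Y S_def
            by (intro exI[of _ "Alow i A"] exI[of _ B] exI[of _ "Alow i A'"] exI[of _ B'])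
              (simp add: tlow_append)
        next
          case False
          then show ?thesis using a b Y(3) len pos unfolding Y S_def
            by (intro exI[of _ A] exI[of _ "Alow i B"] exI[of _ A'] exI[of _ "Alow i B'"])
              (simp add: tlow_append tphi_append)
        qed
      next
        assume pos: "0 < Aeps i Y"
        show "S (Arai i Y) (Arai i Y')"
        proof (cases "Aphi i A < Aeps i B")
          case True
          then show ?thesis using a b Y(3) len unfolding Y S_def
            by (intro exI[of _ A] exI[of _ "Arai i B"] exI[of _ A'] exI[of _ "Arai i B'"])
              (simp add: trai_append)
        next
          case False
          then have "0 < Aeps i A" "0 < Aeps i A'" using pos a by (auto simp: Y teps_append)
          moreover have "\<not> Aphi i A' < Aeps i B'" using False a b by simp
          ultimately show ?thesis using a(4) Y(4) len False unfolding Y S_def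
            by (intro exI[of _ "Arai i A"] exI[of _ B] exI[of _ "Arai i A'"] exI[of _ B'])
              (auto simp: trai_append)
        qed
      qed
    qed
    show "S (L1 @ L2) (L1' @ L2')" using R(3) R'(3) unfolding S_def by blast
    show "\<exists>A B A' B'. Y = A @ B \<and> Y' = A' @ B' \<and> Q1 A A' \<and> Q2 B B' \<and>
      length A = length L1 \<and> length A' = length L1'" if "S Y Y'" for Y Y'
      using that R(4) R'(4) unfolding S_def by blast
  qed
qed

lemma aiso_Cons:
  assumes "aiso0 N L L'"
  shows "aiso N (\<lambda>Y Y'. Y \<noteq> [] \<and> Y' \<noteq> [] \<and> hd Y = hd Y') (U # L) (U # L')"
proof -
  have "aiso N (=) [U] [U]" by (rule aiso_refl) simp
  from aiso_append[OF this assms] show ?thesis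
    by (auto elim!: aiso_mono simp: length_Suc_conv)
qed

subsection \<open>Moving a letter between two columns\<close>

fun cnt :: "nat set \<Rightarrow> nat \<Rightarrow> nat" where
  "cnt U 0 = 0"
| "cnt U (Suc p) = cnt U p + (if Suc p \<in> U then 1 else 0)"

lemma cnt_eq_card: "cnt U p = card (U \<inter> {1..p})"
proof (induction p)
  case (Suc p)
  have "U \<inter> {1..Suc p} = U \<inter> {1..p} \<union> (if Suc p \<in> U then {Suc p} else {})"
    by (auto simp: le_Suc_eq)
  with Suc show ?case by (auto simp: card_insert_if)
qed simp

lemma cnt_alow:
  assumes "0 < i" "i \<in> U" "Suc i \<notin> U"
  shows "int (cnt (alow i U) q) = int (cnt U q) - (if q = i then 1 else 0)"
  using assms by (induction q) (auto simp: alow_def)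

lemma cnt_arai:
  assumes "0 < i" "i \<notin> U" "Suc i \<in> U"
  shows "int (cnt (arai i U) q) = int (cnt U q) + (if q = i then 1 else 0)"
  using assms by (induction q) (auto simp: arai_def)

lemma cnt_insert:
  "0 < p \<Longrightarrow> p \<notin> U \<Longrightarrow> cnt (insert p U) q = cnt U q + (if p \<le> q then 1 else 0)"
  by (induction q) (auto simp: le_Suc_eq)

lemma cnt_remove:
  "0 < p \<Longrightarrow> p \<in> U \<Longrightarrow> cnt U q = cnt (U - {p}) q + (if p \<le> q then 1 else 0)"
  by (induction q) (auto simp: le_Suc_eq)

definition cdiff :: "nat set \<Rightarrow> nat set \<Rightarrow> nat \<Rightarrow> int" where
  "cdiff U V p = int (cnt U p) - int (cnt V p)"

text \<open>View \<open>cdiff U V\<close> as the height of a lattice path that rises at letters of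
  \<open>U - V\<close> and falls at letters of \<open>V - U\<close>. The steps to a new record
  height are the unbracketed letters of \<open>U\<close>, and the first maximum is the last of them.
  Moving this letter is an operator of the second crystal structure on pairs of columns, dual to the
  type A one.\<close>

definition first_max :: "nat \<Rightarrow> nat set \<Rightarrow> nat set \<Rightarrow> nat \<Rightarrow> bool" where
  "first_max N U V p \<longleftrightarrow> 0 < p \<and> p \<le> N \<and> (\<forall>q<p. cdiff U V q < cdiff U V p) \<and>
     (\<forall>q\<le>N. cdiff U V q \<le> cdiff U V p)"

lemma cdiff_Suc:
  "cdiff U V (Suc p) = cdiff U V p + (if Suc p \<in> U then 1 else 0) - (if Suc p \<in> V then 1 else 0)"
  by (simp add: cdiff_def)

lemma first_max_mem:
  assumes "first_max N U V p"
  shows "p \<in> U" "p \<notin> V"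
proof -
  obtain m where "p = Suc m" using assms by (cases p) (auto simp: first_max_def)
  then have "cdiff U V m < cdiff U V (Suc m)" using assms by (simp add: first_max_def)
  then show "p \<in> U" "p \<notin> V" by (auto simp: cdiff_Suc \<open>p = Suc m\<close> split: if_splits)
qed

lemma first_max_unique: "first_max N U V p \<Longrightarrow> first_max N U V p' \<Longrightarrow> p = p'"
  unfolding first_max_def by (metis linorder_not_less nat_neq_iff)

lemma first_max_exists:
  assumes "q \<le> N" "0 < cdiff U V q"
  shows "\<exists>p. first_max N U V p"
proof -
  define M where "M = Max (cdiff U V ` {..N})"
  have M: "cdiff U V q \<le> M" if "q \<le> N" for q
    unfolding M_def using that by (intro Max_ge) auto
  have "M \<in> cdiff U V ` {..N}" unfolding M_def by (intro Max_in) auto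
  then obtain r where r: "r \<le> N" "cdiff U V r = M" by auto
  define p where "p = (LEAST p. cdiff U V p = M)"
  have p: "cdiff U V p = M" "p \<le> r" unfolding p_def
    using r(2) by (auto intro: LeastI Least_le)
  have "cdiff U V s < M" if "s < p" for s
    using that M[of s] not_less_Least[of s "\<lambda>p. cdiff U V p = M"] p r(1)
    unfolding p_def[symmetric] by force
  \<comment> \<open>The path starts at height 0, strictly below the value at
    \<open>q\<close>.\<close>
  moreover have "p \<noteq> 0"
    using p(1) M[OF assms(1)] assms(2) by (auto simp: cdiff_def intro: ccontr)
  ultimately show ?thesis using p r M unfolding first_max_def by auto
qed

text \<open>As \<open>p\<close> is neither \<open>i\<close> nor \<open>i + 1\<close>, the neighbours
  \<open>i - 1\<close> and \<open>i + 1\<close> lie below \<open>p\<close> whenever \<open>i\<close>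
  does. So the bound on the new value at \<open>i\<close> is strict exactly where it has to
  be.\<close>

lemma first_max_change:
  assumes "first_max N U V p" "0 < i" "i < N" "p \<noteq> i" "p \<noteq> Suc i"
    and "\<And>q. q \<noteq> i \<Longrightarrow> cdiff U' V' q = cdiff U V q"
    and "cdiff U' V' i \<le> max (cdiff U V (i - 1)) (cdiff U V (Suc i))"
  shows "first_max N U' V' p"
proof -
  have *: "cdiff U' V' i \<le> cdiff U V (i - 1) \<or> cdiff U' V' i \<le> cdiff U V (Suc i)"
    using assms(7) by linarith
  have "cdiff U' V' q < cdiff U' V' p" if "q < p" for q
  proof (cases "q = i")
    case True
    then have "i - 1 < p" "Suc i < p" using that assms(5) by auto
    then have "cdiff U V (i - 1) < cdiff U V p" "cdiff U V (Suc i) < cdiff U V p"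
      using assms(1) by (auto simp: first_max_def)
    then show ?thesis using True * assms(4,6) by auto
  qed (use that assms in \<open>auto simp: first_max_def\<close>)
  moreover have "cdiff U' V' q \<le> cdiff U' V' p" if "q \<le> N" for q
  proof (cases "q = i")
    case True
    have "cdiff U V (i - 1) \<le> cdiff U V p" "cdiff U V (Suc i) \<le> cdiff U V p"
      using assms(1,3) by (auto simp: first_max_def)
    then show ?thesis using True * assms(4,6) by auto
  qed (use that assms in \<open>auto simp: first_max_def\<close>)
  ultimately show ?thesis using assms(1) by (auto simp: first_max_def)
qed

text \<open>The first maximum lies at \<open>i\<close> or \<open>i + 1\<close>: it passes to
  \<open>i + 1\<close> when the value at \<open>i\<close> drops, and to \<open>i\<close> when the
  value at \<open>i\<close> rises to the maximum.\<close>

lemma first_max_shift: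
  assumes "first_max N U V p" "p = i \<and> p' = Suc i \<or> p = Suc i \<and> p' = i" "0 < i" "i < N"
    and "\<And>q. q \<noteq> i \<Longrightarrow> cdiff U' V' q = cdiff U V q"
    and "cdiff U' V' i = cdiff U V i + (if p = i then - 1 else 1)"
    and "cdiff U V (i - 1) < cdiff U V p" "cdiff U' V' p' = cdiff U V p"
  shows "first_max N U' V' p'"
proof -
  have a: "cdiff U V q \<le> cdiff U V p" if "q \<le> N" for q
    using that assms(1) by (auto simp: first_max_def)
  have b: "cdiff U V q < cdiff U V p" if "q < i" for q
    using that assms(1,2) by (auto simp: first_max_def)
  have c: "cdiff U' V' i \<le> cdiff U V p"
    using assms(2,6,8) a[of i] assms(4) by (auto split: if_splits)
  have "cdiff U' V' q \<le> cdiff U' V' p'" if "q \<le> N" for q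
    using a[OF that] c assms(5)[of q] assms(8) by (cases "q = i") auto
  moreover have "cdiff U' V' q < cdiff U' V' p'" if "q < p'" for q
  proof (cases "q < i")
    case True
    then show ?thesis using b[of q] assms(5)[of q] assms(8) by auto
  next
    case False
    then have "q = i" "p = i" "p' = Suc i" using that assms(2) by auto
    then show ?thesis using assms(6,8) by auto
  qed
  ultimately show ?thesis using assms(2,3,4) by (auto simp: first_max_def)
qed

lemma cdiff_alow1:
  "0 < i \<Longrightarrow> i \<in> U \<Longrightarrow> Suc i \<notin> U \<Longrightarrow> cdiff (alow i U) V q = cdiff U V q - (if q = i then 1 else 0)"
  by (simp add: cdiff_def cnt_alow)

lemma cdiff_alow2:
  "0 < i \<Longrightarrow> i \<in> V \<Longrightarrow> Suc i \<notin> V \<Longrightarrow> cdiff U (alow i V) q = cdiff U V q + (if q = i then 1 else 0)"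
  by (simp add: cdiff_def cnt_alow)

lemma cdiff_arai1:
  "0 < i \<Longrightarrow> i \<notin> U \<Longrightarrow> Suc i \<in> U \<Longrightarrow> cdiff (arai i U) V q = cdiff U V q + (if q = i then 1 else 0)"
  by (simp add: cdiff_def cnt_arai)

lemma cdiff_arai2:
  "0 < i \<Longrightarrow> i \<notin> V \<Longrightarrow> Suc i \<in> V \<Longrightarrow> cdiff U (arai i V) q = cdiff U V q - (if q = i then 1 else 0)"
  by (simp add: cdiff_def cnt_arai)

lemmas cdiff_ops = cdiff_alow1 cdiff_alow2 cdiff_arai1 cdiff_arai2

text \<open>
  An operator of index \<open>i\<close> changes \<open>cdiff U V\<close> only at \<open>i\<close>, and the new value is at most one of the
  neighbouring ones; so the maximum stays, and its first position moves at most between \<open>i\<close> and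
  \<open>i + 1\<close>.
\<close>

definition moves :: "nat \<Rightarrow> nat set list \<Rightarrow> nat set list \<Rightarrow> bool" where
  "moves N L L' \<longleftrightarrow> (\<exists>U V p. L = [U, V] \<and> L' = [U - {p}, insert p V] \<and> first_max N U V p)"

text \<open>The path does not rise just after its first maximum, and two steps before it the path is
  strictly lower. This leaves few configurations of \<open>i\<close> and \<open>i + 1\<close> in the
  two columns.\<close>

lemma first_max_local:
  assumes "first_max N U V p" "0 < i" "i < N"
  shows "p = i \<Longrightarrow> i \<in> U \<and> i \<notin> V \<and> (Suc i \<in> U \<longrightarrow> Suc i \<in> V)"
    and "p = Suc i \<Longrightarrow> Suc i \<in> U \<and> Suc i \<notin> V \<and> (i \<in> V \<longrightarrow> i \<in> U)"
proof -
  assume p: "p = i"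
  then have "cdiff U V (Suc i) \<le> cdiff U V i" using assms by (auto simp: first_max_def)
  then show "i \<in> U \<and> i \<notin> V \<and> (Suc i \<in> U \<longrightarrow> Suc i \<in> V)"
    using first_max_mem[OF assms(1)] p by (auto simp: cdiff_Suc split: if_splits)
next
  assume p: "p = Suc i"
  obtain m where m: "i = Suc m" using assms(2) by (cases i) auto
  have "cdiff U V m < cdiff U V (Suc i)" using p assms m by (auto simp: first_max_def)
  then show "Suc i \<in> U \<and> Suc i \<notin> V \<and> (i \<in> V \<longrightarrow> i \<in> U)"
    using first_max_mem[OF assms(1)] p by (auto simp: cdiff_Suc m split: if_splits)
qed

lemma moves_eps_phi:
  assumes "moves N L L'" "i \<in> {1..<N}"
  shows "Aeps i L = Aeps i L'" "Aphi i L = Aphi i L'"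
proof -
  obtain U V p where L: "L = [U, V]" "L' = [U - {p}, insert p V]" "first_max N U V p"
    using assms(1) unfolding moves_def by blast
  have "Aeps i L = Aeps i L' \<and> Aphi i L = Aphi i L'"
  proof (cases "p = i \<or> p = Suc i")
    case True
    have i: "0 < i" "i < N" using assms(2) by auto
    from True show ?thesis
    proof
      assume p: "p = i"
      show ?thesis using first_max_local(1)[OF L(3) i p] p
        by (cases "Suc i \<in> U"; cases "Suc i \<in> V") (simp_all add: L aeps_def aphi_def)
    next
      assume p: "p = Suc i"
      show ?thesis using first_max_local(2)[OF L(3) i p] p
        by (cases "i \<in> U"; cases "i \<in> V") (simp_all add: L aeps_def aphi_def)
    qed
  next
    case False
    then show ?thesis by (simp add: L aeps_def aphi_def)
  qed
  then show "Aeps i L = Aeps i L'" "Aphi i L = Aphi i L'" by auto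
qed

lemma moves_low:
  assumes "moves N L L'" "i \<in> {1..<N}" "0 < Aphi i L"
  shows "moves N (Alow i L) (Alow i L')"
proof -
  obtain U V p where L: "L = [U, V]" "L' = [U - {p}, insert p V]" and f: "first_max N U V p"
    using assms(1) unfolding moves_def by blast
  have i: "0 < i" "i < N" using assms(2) by auto
  obtain m where m: "i = Suc m" using i by (cases i) auto
  have h: "cdiff U V i = cdiff U V (i - 1) + (if i \<in> U then 1 else 0) - (if i \<in> V then 1 else 0)"
    "cdiff U V (Suc i) = cdiff U V i + (if Suc i \<in> U then 1 else 0) - (if Suc i \<in> V then 1 else 0)"
    by (simp_all add: m cdiff_Suc)
  have lt: "p = i \<or> p = Suc i \<Longrightarrow> cdiff U V (i - 1) < cdiff U V p"
    using f i by (auto simp: first_max_def)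
  note l = first_max_local[OF f i]
  consider "p = i" | "p = Suc i" | "p \<noteq> i" "p \<noteq> Suc i" by blast
  then show ?thesis
  proof cases
    \<comment> \<open>The operator turns the letter about to be moved into \<open>i + 1\<close>,
      which is then moved instead.\<close>
    case 1
    have s: "i \<in> U" "Suc i \<notin> U" "i \<notin> V" "Suc i \<notin> V"
      using l(1)[OF 1] assms(3) by (auto simp: L aphi_def aeps_def split: if_splits)
    have "first_max N (alow i U) V (Suc i)"
      by (rule first_max_shift[OF f _ i]) (use 1 s i lt h in \<open>auto simp: cdiff_ops\<close>)
    moreover have "Alow i L = [alow i U, V]" "Alow i L' = [alow i U - {Suc i}, insert (Suc i) V]"
      using s 1 by (auto simp: L aphi_def aeps_def alow_def)
    ultimately show ?thesis unfolding moves_def by blast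
  next
    \<comment> \<open>\<open>V\<close> acquires \<open>i + 1\<close>, which blocks this letter; the
      letter \<open>i\<close> of \<open>U\<close>, now absent from \<open>V\<close>, is moved in its
      place.\<close>
    case 2
    have s: "i \<in> U" "Suc i \<in> U" "i \<in> V" "Suc i \<notin> V"
      using l(2)[OF 2] assms(3) by (auto simp: L aphi_def aeps_def split: if_splits)
    have "first_max N U (alow i V) i"
      by (rule first_max_shift[OF f _ i]) (use 2 s i lt h in \<open>auto simp: cdiff_ops\<close>)
    moreover have "Alow i L = [U, alow i V]" "Alow i L' = [U - {i}, insert i (alow i V)]"
      using s 2 by (auto simp: L aphi_def aeps_def alow_def)
    ultimately show ?thesis unfolding moves_def by blast
  next
    case 3
    have eq: "aeps i (U - {p}) = aeps i U" "aphi i (U - {p}) = aphi i U"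
      "aeps i (insert p V) = aeps i V" "aphi i (insert p V) = aphi i V"
      "alow i (U - {p}) = alow i U - {p}" "alow i (insert p V) = insert p (alow i V)"
      using 3 by (auto simp: aeps_def aphi_def alow_def)
    show ?thesis
    proof (cases "Aeps i [V] < aphi i U")
      case True
      then have s: "i \<in> U" "Suc i \<notin> U" "i \<in> V \<or> Suc i \<notin> V"
        by (auto simp: aphi_def aeps_def split: if_splits)
      have "first_max N (alow i U) V p"
        by (rule first_max_change[OF f i 3]) (use s i h in \<open>auto simp: cdiff_ops\<close>)
      moreover have "Alow i L = [alow i U, V]" "Alow i L' = [alow i U - {p}, insert p V]"
        using True by (simp_all add: L eq)
      ultimately show ?thesis unfolding moves_def by blast
    next
      case False
      then have s: "i \<in> V" "Suc i \<notin> V" "i \<notin> U \<or> Suc i \<in> U"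
        using assms(3) by (auto simp: L aphi_def aeps_def split: if_splits)
      have "first_max N U (alow i V) p"
        by (rule first_max_change[OF f i 3]) (use s i h in \<open>auto simp: cdiff_ops\<close>)
      moreover have "aphi i V = 1" "aeps i V = 0" using s by (auto simp: aphi_def aeps_def)
      then have "Alow i L = [U, alow i V]" "Alow i L' = [U - {p}, insert p (alow i V)]"
        using False by (simp_all add: L eq)
      ultimately show ?thesis unfolding moves_def by blast
    qed
  qed
qed

lemma moves_rai:
  assumes "moves N L L'" "i \<in> {1..<N}" "0 < Aeps i L"
  shows "moves N (Arai i L) (Arai i L')"
proof -
  obtain U V p where L: "L = [U, V]" "L' = [U - {p}, insert p V]" and f: "first_max N U V p"
    using assms(1) unfolding moves_def by blast
  have i: "0 < i" "i < N" using assms(2) by auto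
  obtain m where m: "i = Suc m" using i by (cases i) auto
  have h: "cdiff U V i = cdiff U V (i - 1) + (if i \<in> U then 1 else 0) - (if i \<in> V then 1 else 0)"
    "cdiff U V (Suc i) = cdiff U V i + (if Suc i \<in> U then 1 else 0) - (if Suc i \<in> V then 1 else 0)"
    by (simp_all add: m cdiff_Suc)
  have lt: "p = i \<or> p = Suc i \<Longrightarrow> cdiff U V (i - 1) < cdiff U V p"
    using f i by (auto simp: first_max_def)
  note l = first_max_local[OF f i]
  consider "p = i" | "p = Suc i" | "p \<noteq> i" "p \<noteq> Suc i" by blast
  then show ?thesis
  proof cases
    case 1
    have s: "i \<in> U" "Suc i \<in> U" "i \<notin> V" "Suc i \<in> V"
      using l(1)[OF 1] assms(3) by (auto simp: L aphi_def aeps_def split: if_splits)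
    have "first_max N U (arai i V) (Suc i)"
      by (rule first_max_shift[OF f _ i]) (use 1 s i lt h in \<open>auto simp: cdiff_ops\<close>)
    moreover have "Arai i L = [U, arai i V]" "Arai i L' = [U - {Suc i}, insert (Suc i) (arai i V)]"
      using s 1 by (auto simp: L aphi_def aeps_def arai_def)
    ultimately show ?thesis unfolding moves_def by blast
  next
    case 2
    have s: "i \<notin> U" "Suc i \<in> U" "i \<notin> V" "Suc i \<notin> V"
      using l(2)[OF 2] assms(3) by (auto simp: L aphi_def aeps_def split: if_splits)
    have "first_max N (arai i U) V i"
      by (rule first_max_shift[OF f _ i]) (use 2 s i lt h in \<open>auto simp: cdiff_ops\<close>)
    moreover have "Arai i L = [arai i U, V]" "Arai i L' = [arai i U - {i}, insert i V]"
      using s 2 by (auto simp: L aphi_def aeps_def arai_def)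
    ultimately show ?thesis unfolding moves_def by blast
  next
    case 3
    have eq: "aeps i (U - {p}) = aeps i U" "aphi i (U - {p}) = aphi i U"
      "aeps i (insert p V) = aeps i V" "aphi i (insert p V) = aphi i V"
      "arai i (U - {p}) = arai i U - {p}" "arai i (insert p V) = insert p (arai i V)"
      using 3 by (auto simp: aeps_def aphi_def arai_def)
    show ?thesis
    proof (cases "aphi i U < Aeps i [V]")
      case True
      then have s: "i \<notin> V" "Suc i \<in> V" "i \<notin> U \<or> Suc i \<in> U"
        by (auto simp: aphi_def aeps_def split: if_splits)
      have "first_max N U (arai i V) p"
        by (rule first_max_change[OF f i 3]) (use s i h in \<open>auto simp: cdiff_ops\<close>)
      moreover have "Arai i L = [U, arai i V]" "Arai i L' = [U - {p}, insert p (arai i V)]"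
        using True by (simp_all add: L eq)
      ultimately show ?thesis unfolding moves_def by blast
    next
      case False
      then have s: "i \<notin> U" "Suc i \<in> U" "i \<in> V \<or> Suc i \<notin> V"
        using assms(3) by (auto simp: L aphi_def aeps_def split: if_splits)
      have "first_max N (arai i U) V p"
        by (rule first_max_change[OF f i 3]) (use s i h in \<open>auto simp: cdiff_ops\<close>)
      moreover have "Arai i L = [arai i U, V]" "Arai i L' = [arai i U - {p}, insert p V]"
        using False by (simp_all add: L eq)
      ultimately show ?thesis unfolding moves_def by blast
    qed
  qed
qed

text \<open>After a move, the new path has its last maximum at \<open>p - 1\<close>: heights from
  \<open>p\<close> on have dropped by 2, the others are unchanged. So \<open>p\<close> can be
  recovered and a move can be undone.\<close>

lemma first_max_left_unique:
  assumes "first_max N U V p" "first_max N U' V' p'" "U - {p} = U' - {p'}"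
    "insert p V = insert p' V'" "p < p'"
  shows False
proof -
  have A: "cdiff U V q = cdiff (U - {p}) (insert p V) q + (if p \<le> q then 2 else 0)"
    if "first_max N U V p" for U V p q
    using that first_max_mem[OF that] cnt_remove[of p U q] cnt_insert[of p V q]
    by (auto simp: first_max_def cdiff_def)
  obtain m m' where m: "p = Suc m" "p' = Suc m'"
    using assms(1,2) by (metis first_max_def gr0_implies_Suc)
  let ?h = "cdiff (U - {p}) (insert p V)"
  have 1: "cdiff U V q = ?h q + (if p \<le> q then 2 else 0)"
    "cdiff U' V' q = ?h q + (if p' \<le> q then 2 else 0)" for q
    using A[OF assms(1)] A[OF assms(2)] assms(3,4) by auto
  have "cdiff U V m' \<le> cdiff U V p" using assms(1,2) m by (auto simp: first_max_def)
  moreover have "cdiff U' V' m < cdiff U' V' p'" using assms(2,5) m by (auto simp: first_max_def)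
  moreover have "cdiff U' V' p' = cdiff U' V' m' + 1" "cdiff U V p = cdiff U V m + 1"
    using first_max_mem[OF assms(1)] first_max_mem[OF assms(2)] by (simp_all add: m cdiff_Suc)
  ultimately show False using assms(5) m by (auto simp: 1)
qed

lemma moves_bi_unique: "bi_unique (moves N)"
proof -
  have "L = K" if mv: "moves N L L'" "moves N K L'" for L K L'
  proof -
    obtain U V p where L: "L = [U, V]" "L' = [U - {p}, insert p V]" "first_max N U V p"
      using mv(1) unfolding moves_def by blast
    obtain U' V' p' where K: "K = [U', V']" "L' = [U' - {p'}, insert p' V']" "first_max N U' V' p'"
      using mv(2) unfolding moves_def by blast
    have "p = p'"
      using first_max_left_unique[OF L(3) K(3)] first_max_left_unique[OF K(3) L(3)] L(2) K(2)
      by (metis linorder_neqE_nat list.inject)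
    moreover have "U = insert p (U - {p})" "V = insert p V - {p}"
      "U' = insert p' (U' - {p'})" "V' = insert p' V' - {p'}"
      using first_max_mem[OF L(3)] first_max_mem[OF K(3)] by auto
    ultimately show ?thesis using L(1,2) K(1,2) by (metis list.inject)
  qed
  moreover have "L = K" if "moves N L' L" "moves N L' K" for L K L'
    using that first_max_unique unfolding moves_def by blast
  ultimately show ?thesis unfolding bi_unique_def by blast
qed

lemma moves_bisimulation: "bisimulation {1..<N} Aeps Aphi Alow Arai (moves N)"
  unfolding bisimulation_def using moves_eps_phi moves_low moves_rai by blast

lemma aiso0_trans: "aiso N Q L L' \<Longrightarrow> aiso N Q' L' L'' \<Longrightarrow> aiso0 N L L''"
  by (erule aiso_trans) auto

lemma aiso0_sym: "aiso N Q L L' \<Longrightarrow> aiso0 N L' L"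
  by (erule aiso_sym) auto

subsection \<open>Highest weight elements in type A\<close>

definition ivl :: "nat \<Rightarrow> nat set" where
  "ivl k = {1..k}"

text \<open>No letter can be moved between adjacent columns. For columns within
  \<open>{1..N}\<close>, listed from right to left, this says that they form a semistandard tableau
  of partition shape.\<close>

definition normal :: "nat \<Rightarrow> nat set list \<Rightarrow> bool" where
  "normal N L \<longleftrightarrow> successively (\<lambda>U V. \<forall>q\<le>N. cnt U q \<le> cnt V q) L"

text \<open>A move takes a letter away from the column nearer to the head, so the head can only lose
  letters. All inclusions between right columns originate here.\<close>

definition shrinks :: "nat set list \<Rightarrow> nat set list \<Rightarrow> bool" where
  "shrinks Y Y' \<longleftrightarrow> length Y = length Y' \<and> (Y \<noteq> [] \<longrightarrow> hd Y' \<subseteq> hd Y)"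

text \<open>The termination measure of \<open>normalize\<close>: columns weigh more the nearer they
  are to the head, so passing a letter to the next column lowers the sum.\<close>

fun wsum :: "nat set list \<Rightarrow> nat" where
  "wsum [] = 0"
| "wsum (U # L) = Suc (length L) * card U + wsum L"

lemma wsum_append:
  "wsum (A @ B) = wsum A + length B * (\<Sum>U\<leftarrow>A. card U) + wsum B"
  by (induction A) (auto simp: algebra_simps)

lemma not_successively:
  "\<not> successively P L \<Longrightarrow> \<exists>A U V B. L = A @ [U, V] @ B \<and> \<not> P U V"
proof (induction L rule: induct_list012)
  case (3 x y zs)
  show ?case
  proof (cases "P x y")
    case True
    then obtain A U V B where "y # zs = A @ [U, V] @ B" "\<not> P U V" using 3 by auto
    then show ?thesis by (intro exI[of _ "x # A"]) auto
  next
    case False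
    then show ?thesis by (intro exI[of _ "[]"]) auto
  qed
qed auto

lemma moves_aiso:
  assumes "moves N L L'"
  shows "aiso N shrinks L L'"
  by (rule aisoI[OF moves_bisimulation moves_bi_unique assms])
    (auto simp: moves_def shrinks_def)

lemma aiso_shrinks_append:
  assumes "aiso N shrinks L L'" "length L = length L'"
  shows "aiso N shrinks (A @ L @ B) (A @ L' @ B)"
proof -
  have "aiso N (=) A A" "aiso N (=) B B" by (auto intro: aiso_refl)
  from aiso_append[OF this(1) aiso_append[OF assms(1) this(2)]] show ?thesis
  proof (rule aiso_mono, elim exE conjE)
    fix Y Y' X Z X' Z' U V U' V'
    assume Y: "Y = X @ Z" "Y' = X' @ Z'" "X = X'" "Z = U @ V" "Z' = U' @ V'"
      "shrinks U U'" "V = V'"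
    show "shrinks Y Y'"
    proof (cases "X = []")
      case True
      then show ?thesis using Y by (cases U; cases U') (auto simp: shrinks_def)
    qed (use Y in \<open>auto simp: shrinks_def\<close>)
  qed
qed

lemma normalize:
  assumes "\<forall>U\<in>set L. U \<subseteq> {1..N}"
  shows "\<exists>L'. aiso N shrinks L L' \<and> normal N L' \<and> (\<forall>U\<in>set L'. U \<subseteq> {1..N})"
  using assms
proof (induction "wsum L" arbitrary: L rule: less_induct)
  case less
  show ?case
  proof (cases "normal N L")
    case True
    have "aiso N shrinks L L" by (rule aiso_refl) (simp add: shrinks_def)
    then show ?thesis using True less.prems by blast
  next
    case False
    then obtain A U V B where L: "L = A @ [U, V] @ B" "\<not> (\<forall>q\<le>N. cnt U q \<le> cnt V q)"
      using not_successively[of "\<lambda>U V. \<forall>q\<le>N. cnt U q \<le> cnt V q" L] unfolding normal_def by blast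
    then obtain q where "q \<le> N" "cnt V q < cnt U q" by (auto simp: not_le)
    then obtain p where p: "first_max N U V p"
      using first_max_exists[of q N U V] by (auto simp: cdiff_def)
    note m = first_max_mem[OF p]
    define L1 where "L1 = A @ [U - {p}, insert p V] @ B"
    have "U \<subseteq> {1..N}" "V \<subseteq> {1..N}" using less.prems L by auto
    then have fin: "finite U" "finite V" by (auto intro: finite_subset)
    have "card U = Suc (card (U - {p}))" using fin m by (metis card_Suc_Diff1)
    moreover have "card (insert p V) = Suc (card V)" using fin m by simp
    ultimately have "wsum L1 < wsum L" unfolding L1_def L(1) by (simp add: wsum_append)
    moreover have "\<forall>U\<in>set L1. U \<subseteq> {1..N}"
      using less.prems p unfolding L1_def L(1) first_max_def by auto
    ultimately obtain L' where L': "aiso N shrinks L1 L'" "normal N L'" "\<forall>U\<in>set L'. U \<subseteq> {1..N}"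
      using less.hyps by blast
    have "moves N [U, V] [U - {p}, insert p V]" using p unfolding moves_def by blast
    from aiso_shrinks_append[OF moves_aiso[OF this]] have "aiso N shrinks L L1"
      unfolding L(1) L1_def by simp
    then have "aiso N shrinks L L'" using L'(1)
      by (rule aiso_trans) (auto simp: shrinks_def)
    then show ?thesis using L'(2,3) by blast
  qed
qed

lemma cnt_subset_eq:
  assumes "cnt U q = q" "r \<in> {1..q}"
  shows "r \<in> U"
proof -
  have "card (U \<inter> {1..q}) = card {1..q}" using assms(1) by (simp add: cnt_eq_card)
  then have "U \<inter> {1..q} = {1..q}" by (intro card_subset_eq) auto
  then show ?thesis using assms(2) by blast
qed

lemma cnt_ivl: "cnt (ivl k) q = min k q"
proof -
  have "ivl k \<inter> {1..q} = {1..min k q}" by (auto simp: ivl_def)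
  then show ?thesis by (simp add: cnt_eq_card)
qed

lemma card_ivl [simp]: "card (ivl k) = k"
  by (simp add: ivl_def)

lemma aeps_ivl: "0 < i \<Longrightarrow> aeps i (ivl k) = 0"
  by (auto simp: aeps_def ivl_def)

lemma aphi_ivl: "0 < i \<Longrightarrow> aphi i (ivl k) = (if k = i then 1 else 0)"
  by (auto simp: aphi_def ivl_def)

lemma tensor_highest:
  "\<forall>x\<in>set xs. ep x = 0 \<Longrightarrow> teps ep ph xs = 0 \<and> tphi ep ph xs = (\<Sum>x\<leftarrow>xs. ph x)"
  by (induction xs) auto

lemma Aeps_ivl: "0 < i \<Longrightarrow> Aeps i (map ivl ks) = 0"
  using tensor_highest[of "map ivl ks" "aeps i" "aphi i"] by (simp add: aeps_ivl)

lemma Aphi_ivl: "0 < i \<Longrightarrow> Aphi i (map ivl ks) = count_list ks i"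
proof -
  assume i: "0 < i"
  then have "Aphi i (map ivl ks) = (\<Sum>k\<leftarrow>ks. aphi i (ivl k))"
    using tensor_highest[of "map ivl ks" "aeps i" "aphi i"] by (simp add: aeps_ivl comp_def)
  also have "\<dots> = count_list ks i" using i by (induction ks) (auto simp: aphi_ivl)
  finally show ?thesis .
qed

lemma ivl_if_contiguous:
  assumes "U \<subseteq> {1..N}" "\<And>c. 0 < c \<Longrightarrow> Suc c \<in> U \<Longrightarrow> c \<in> U"
  shows "\<exists>m. U = ivl m"
proof (cases "U = {}")
  case True
  then show ?thesis by (intro exI[of _ 0]) (simp add: ivl_def)
next
  case False
  have fin: "finite U" using assms(1) finite_subset by blast
  have down: "0 < d \<longrightarrow> d \<in> U" if "d \<le> Max U" for d
    using that
  proof (induction d rule: inc_induct)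
    case base
    show ?case using Max_in[OF fin False] by simp
  next
    case (step m)
    then show ?case using assms(2)[of m] by simp
  qed
  have "U = {1..Max U}"
  proof (intro equalityI subsetI)
    fix d assume "d \<in> {1..Max U}"
    then show "d \<in> U" using down[of d] by auto
  next
    fix d assume "d \<in> U"
    then show "d \<in> {1..Max U}" using fin assms(1) by auto
  qed
  then show ?thesis unfolding ivl_def by blast
qed

text \<open>Normality puts \<open>{1..k}\<close> into the last column, where \<open>k\<close> is the
  length of the interval before it. A letter \<open>Suc c\<close> of the last column with
  \<open>c\<close> missing is a minus sign that must be cancelled by an earlier interval of length
  \<open>c\<close>; then \<open>c \<le> k\<close>, so \<open>c\<close> is not missing.\<close>

lemma normal_highest:
  assumes "normal N L" "\<forall>U\<in>set L. U \<subseteq> {1..N}" "\<forall>i\<in>{1..<N}. Aeps i L = 0"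
  shows "\<exists>ks. L = map ivl ks \<and> sorted ks \<and> (\<forall>k\<in>set ks. k \<le> N)"
  using assms
proof (induction L rule: rev_induct)
  case Nil
  then show ?case by simp
next
  case (snoc V L)
  have "normal N L" using snoc.prems(1) by (simp add: normal_def successively_append_iff)
  moreover have "\<forall>i\<in>{1..<N}. Aeps i L = 0" using snoc.prems(3) by (auto simp: teps_append)
  ultimately obtain ks where ks: "L = map ivl ks" "sorted ks" "\<forall>k\<in>set ks. k \<le> N"
    using snoc by auto
  define k where "k = (if ks = [] then 0 else last ks)"
  have le: "j \<le> k" if "j \<in> set ks" for j
  proof -
    from that obtain a where "a < length ks" "j = ks ! a" by (auto simp: in_set_conv_nth)
    then show ?thesis
      using sorted_nth_mono[OF ks(2), of a "length ks - 1"] by (auto simp: k_def last_conv_nth)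
  qed
  have kN: "k \<le> N" using ks(3) by (auto simp: k_def)
  have "cnt V k \<ge> k"
  proof (cases "ks = []")
    case False
    then have "cnt (ivl (last ks)) k \<le> cnt V k"
      using snoc.prems(1) kN ks(1)
      by (auto simp: normal_def successively_append_iff last_map)
    then show ?thesis using False by (simp add: cnt_ivl k_def)
  qed (simp add: k_def)
  moreover have "cnt V k \<le> k" by (induction k) auto
  ultimately have kV: "r \<in> V" if "r \<in> {1..k}" for r using cnt_subset_eq[of V k r] that by simp
  have contiguous: "c \<in> V" if "0 < c" "Suc c \<in> V" for c
  proof (rule ccontr)
    assume c: "c \<notin> V"
    have "c < N" using that snoc.prems(2) by auto
    then have "aeps c V \<le> Aphi c L" using snoc.prems(3) that(1) by (auto simp: teps_append)
    moreover have "aeps c V = 1" using c that by (simp add: aeps_def)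
    ultimately have "c \<in> set ks" using that(1) ks(1) by (metis Aphi_ivl count_notin not_one_le_zero)
    then show False using le kV[of c] c that(1) by auto
  qed
  obtain m where m: "V = ivl m"
    using ivl_if_contiguous[of V N] snoc.prems(2) contiguous by auto
  have "k \<le> m" using kV[of k] m by (cases "k = 0") (auto simp: ivl_def)
  moreover have "m \<le> N" using m snoc.prems(2) by (auto simp: ivl_def)
  ultimately show ?case using ks le
    by (intro exI[of _ "ks @ [m]"]) (use m in \<open>force simp: sorted_append\<close>)
qed

text \<open>Blocks without surviving signs of any index take no part in the action. By
  \<open>replicate_inert\<close>, empty and full columns are of this kind.\<close>

lemma inert_insert:
  assumes "\<forall>i\<in>{1..<N}. Aeps i A = 0 \<and> Aphi i A = 0" "\<forall>i\<in>{1..<N}. Aeps i B = 0 \<and> Aphi i B = 0"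
  shows "aiso0 N L (A @ L @ B)"
proof (rule aisoI[where R = "\<lambda>X Y. Y = A @ X @ B"])
  show "bisimulation {1..<N} Aeps Aphi Alow Arai (\<lambda>X Y. Y = A @ X @ B)"
    unfolding bisimulation_def using assms
    by (auto simp: teps_append tphi_append tlow_append trai_append)
qed (auto simp: bi_unique_def)

lemma replicate_inert:
  assumes "i \<in> {1..<N}" "k = 0 \<or> k = N"
  shows "Aeps i (replicate m (ivl k)) = 0 \<and> Aphi i (replicate m (ivl k)) = 0"
  using assms Aeps_ivl[of i "replicate m k"] Aphi_ivl[of i "replicate m k"]
  by (auto simp: count_list_0_iff)

lemma sorted_filter_split:
  assumes "sorted ks" "\<forall>k\<in>set ks. k \<le> N" "0 < N"
  shows "\<exists>a b. ks = replicate a 0 @ filter (\<lambda>k. k \<in> {1..<N}) ks @ replicate b (N::nat)"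
  using assms
proof (induction ks)
  case (Cons k ks)
  then obtain a b where ab: "ks = replicate a 0 @ filter (\<lambda>k. k \<in> {1..<N}) ks @ replicate b N"
    by auto
  consider "k = 0" | "k \<in> {1..<N}" | "k = N" using Cons.prems by fastforce
  then show ?case
  proof cases
    case 1
    then show ?thesis using ab by (intro exI[of _ "Suc a"] exI[of _ b]) auto
  next
    case 2
    then have "0 \<notin> set ks" using Cons.prems by auto
    then have "a = 0" using ab by (metis in_set_replicate Un_iff set_append)
    then show ?thesis using ab 2 by (intro exI[of _ 0] exI[of _ b]) auto
  next
    case 3
    then have "\<forall>j\<in>set ks. j = N" using Cons.prems by (auto intro: antisym)
    then have "ks = replicate (length ks) N" by (simp add: list_eq_iff_nth_eq)
    then have "k # ks = replicate (Suc (length ks)) N" using 3 by simp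
    moreover have "filter (\<lambda>k. k \<in> {1..<N}) (k # ks) = []"
      using 3 \<open>\<forall>j\<in>set ks. j = N\<close> by auto
    ultimately show ?thesis by (intro exI[of _ 0] exI[of _ "Suc (length ks)"]) simp
  qed
qed simp

lemma sorted_eq_if_count:
  fixes xs :: "nat list"
  assumes "sorted xs" "sorted ys" "\<And>k. count_list xs k = count_list ys k"
  shows "xs = ys"
proof -
  show ?thesis
    using assms
  proof (induction xs arbitrary: ys)
    case Nil
    then show ?case by (metis count_list.simps(1) count_list_0_iff list.set_intros(1) neq_Nil_conv)
  next
    case (Cons x xs)
    have "count_list ys x \<noteq> 0" using Cons.prems(3)[of x] by simp
    then have x: "x \<in> set ys" by (metis count_notin)
    then obtain y zs where ys: "ys = y # zs" by (cases ys) auto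
    have "count_list (x # xs) y \<noteq> 0" using Cons.prems(3)[of y] ys by simp
    then have "y \<in> set (x # xs)" by (metis count_notin)
    then have "y = x" using Cons.prems(1,2) x ys by (auto intro: antisym)
    moreover have "count_list xs k = count_list zs k" for k
      using Cons.prems(3)[of k] ys \<open>y = x\<close> by (auto split: if_splits)
    ultimately show ?case using Cons.IH[of zs] Cons.prems ys by auto
  qed
qed

lemma count_list_filter: "count_list (filter P xs) k = (if P k then count_list xs k else 0)"
  by (induction xs) auto

lemma highest_aiso_ivl:
  assumes "\<forall>U\<in>set L. U \<subseteq> {1..N}" "\<forall>i\<in>{1..<N}. Aeps i L = 0"
  obtains ks where "aiso N shrinks L (map ivl ks)" "sorted ks" "\<forall>k\<in>set ks. k \<le> N"
proof -
  obtain L' where L': "aiso N shrinks L L'" "normal N L'" "\<forall>U\<in>set L'. U \<subseteq> {1..N}"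
    using normalize[OF assms(1)] by blast
  have "\<forall>i\<in>{1..<N}. Aeps i L' = 0" using aiso_eps_phi[OF L'(1)] assms(2) by auto
  then show ?thesis using normal_highest[OF L'(2,3)] L'(1) that by blast
qed

text \<open>Both lists are normalized to sorted lists of intervals and stripped of the lengths
  \<open>0\<close> and \<open>N\<close>; the remaining lengths are counted by \<open>Aphi\<close>,
  so the results coincide.\<close>

lemma highest_aiso:
  assumes "\<forall>U\<in>set L. U \<subseteq> {1..N}" "\<forall>i\<in>{1..<N}. Aeps i L = 0"
    and "\<forall>U\<in>set L'. U \<subseteq> {1..N}" "\<forall>i\<in>{1..<N}. Aeps i L' = 0"
    and "\<forall>i\<in>{1..<N}. Aphi i L = Aphi i L'" "0 < N"
  shows "aiso0 N L L'"
proof -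
  have *: "aiso0 N L (map ivl (filter (\<lambda>k. k \<in> {1..<N}) ks))"
    if L: "aiso N shrinks L (map ivl ks)" and "sorted ks" "\<forall>k\<in>set ks. k \<le> N" for L ks
  proof -
    obtain a b where ab: "ks = replicate a 0 @ filter (\<lambda>k. k \<in> {1..<N}) ks @ replicate b N"
      using sorted_filter_split[OF \<open>sorted ks\<close> \<open>\<forall>k\<in>set ks. k \<le> N\<close> assms(6)] by blast
    have eq: "map ivl ks = replicate a (ivl 0) @ map ivl (filter (\<lambda>k. k \<in> {1..<N}) ks) @
        replicate b (ivl N)"
      using arg_cong[OF ab, of "map ivl"] by (simp only: map_append map_replicate)
    have "aiso0 N (map ivl (filter (\<lambda>k. k \<in> {1..<N}) ks)) (map ivl ks)"
      unfolding eq using replicate_inert by (intro inert_insert) blast+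
    then show ?thesis using aiso0_trans[OF L aiso0_sym] by blast
  qed
  obtain ks where ks: "aiso N shrinks L (map ivl ks)" "sorted ks" "\<forall>k\<in>set ks. k \<le> N"
    using highest_aiso_ivl[OF assms(1,2)] by blast
  obtain ls where ls: "aiso N shrinks L' (map ivl ls)" "sorted ls" "\<forall>k\<in>set ls. k \<le> N"
    using highest_aiso_ivl[OF assms(3,4)] by blast
  have "count_list ks i = count_list ls i" if "i \<in> {1..<N}" for i
    using aiso_eps_phi(2)[OF ks(1) that] aiso_eps_phi(2)[OF ls(1) that] assms(5) that
    by (simp add: Aphi_ivl)
  then have "filter (\<lambda>k. k \<in> {1..<N}) ks = filter (\<lambda>k. k \<in> {1..<N}) ls"
    using ks(2) ls(2) by (intro sorted_eq_if_count) (auto simp: count_list_filter sorted_wrt_filter)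
  then show ?thesis
    using aiso0_trans[OF *[OF ks] aiso0_sym] *[OF ls] by metis
qed

section \<open>Columns in type C\<close>

definition alph :: "nat \<Rightarrow> int list" where
  "alph n = [1..int n] @ [- int n..- 1]"

definition colw :: "nat \<Rightarrow> int set \<Rightarrow> int list" where
  "colw n X = filter (\<lambda>x. x \<in> X) (alph n)"

definition pos :: "int set \<Rightarrow> nat \<Rightarrow> bool" where
  "pos X p \<longleftrightarrow> int p \<in> X"

definition neg :: "int set \<Rightarrow> nat \<Rightarrow> bool" where
  "neg X p \<longleftrightarrow> - int p \<in> X"

definition same :: "int set \<Rightarrow> int set \<Rightarrow> nat \<Rightarrow> bool" where
  "same X Y p \<longleftrightarrow> (pos X p \<longleftrightarrow> pos Y p) \<and> (neg X p \<longleftrightarrow> neg Y p)"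

definition both :: "int set \<Rightarrow> nat \<Rightarrow> bool" where
  "both X p \<longleftrightarrow> pos X p \<and> neg X p"

definition free :: "int set \<Rightarrow> nat \<Rightarrow> bool" where
  "free X p \<longleftrightarrow> \<not> pos X p \<and> \<not> neg X p"

text \<open>The number of letters of absolute value at most \<open>p\<close>, in a form suited to
  induction on \<open>p\<close>; see \<open>hgt_card\<close>.\<close>

fun hgt :: "int set \<Rightarrow> nat \<Rightarrow> nat" where
  "hgt X 0 = 0"
| "hgt X (Suc p) = hgt X p + (if pos X (Suc p) then 1 else 0) + (if neg X (Suc p) then 1 else 0)"

text \<open>The bound is imposed at every \<open>p\<close>, not only where both \<open>p\<close> and
  \<open>- p\<close> occur. At the other positions \<open>hgt\<close> grows by at most one, so the
  two conditions agree; see \<open>admissible_colw\<close>.\<close>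

definition adm :: "nat \<Rightarrow> int set \<Rightarrow> bool" where
  "adm n X \<longleftrightarrow> X \<subseteq> letters n \<and> (\<forall>p\<le>n. hgt X p \<le> p)"

text \<open>
  Scanning downwards from \<open>n\<close>, \<open>gap n X p\<close> counts the \<open>z > p\<close> with \<open>z, - z \<in> X\<close> that still wait
  for their partner \<open>t\<close>.
\<close>

function gap :: "nat \<Rightarrow> int set \<Rightarrow> nat \<Rightarrow> nat" where
  "gap n X p = (if n \<le> p then 0
     else if both X (Suc p) then Suc (gap n X (Suc p))
     else if free X (Suc p) then gap n X (Suc p) - 1
     else gap n X (Suc p))"
  by auto
termination by (relation "measure (\<lambda>(n, X, p). n - p)") auto

declare gap.simps [simp del]

text \<open>The greedy choice of the letters \<open>t\<close> seen as a scan: a free letter becomes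
  a partner as soon as some larger repeated letter is waiting. \<open>t_list_from_partners\<close>
  proves the agreement.\<close>

definition matched :: "nat \<Rightarrow> int set \<Rightarrow> nat \<Rightarrow> bool" where
  "matched n X p \<longleftrightarrow> free X p \<and> 0 < gap n X p"

lemma gap_ge: "n \<le> p \<Longrightarrow> gap n X p = 0"
  by (simp add: gap.simps)

lemma gap_rec:
  "p < n \<Longrightarrow> gap n X p = (if both X (Suc p) then Suc (gap n X (Suc p))
     else if free X (Suc p) then gap n X (Suc p) - 1 else gap n X (Suc p))"
  by (subst gap.simps) simp

lemma hgt_cong:
  "(\<And>q. 0 < q \<Longrightarrow> q \<le> p \<Longrightarrow> same X Y q) \<Longrightarrow>
    hgt X p = hgt Y p"
  by (induction p) (auto simp: same_def)

lemma gap_cong: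
  assumes "\<And>q. p < q \<Longrightarrow> q \<le> n \<Longrightarrow> same X Y q"
  shows "gap n X p = gap n Y p"
proof (cases "n \<le> p")
  case False
  then have "p \<le> n" by simp
  then show ?thesis using assms
  proof (induction p rule: inc_induct)
    case (step m)
    then have "same X Y (Suc m)" by simp
    then show ?case using step by (simp add: gap_rec both_def free_def same_def)
  qed (simp add: gap_ge)
qed (simp add: gap_ge)

lemma gap_below:
  assumes "gap n X p = gap n Y p" "q \<le> p" "p \<le> n"
    and "\<And>r. q < r \<Longrightarrow> r \<le> p \<Longrightarrow> same X Y r"
  shows "gap n X q = gap n Y q"
  using assms(2,1,3,4)
proof (induction q rule: inc_induct)
  case (step m)
  then have "same X Y (Suc m)" by simp
  then show ?case using step by (simp add: gap_rec both_def free_def same_def)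
qed simp

text \<open>An invariant of the downward scan. At \<open>p = 0\<close> it says that no repeated
  letter is left without a partner, which is where admissibility enters.\<close>

lemma gap_hgt:
  assumes "adm n X" "p \<le> n"
  shows "gap n X p + hgt X p \<le> p"
  using assms(2)
proof (induction p rule: inc_induct)
  case base
  then show ?case using assms(1) by (simp add: gap_ge adm_def)
next
  case (step m)
  moreover have "hgt X m \<le> m" using step assms(1) by (simp add: adm_def)
  ultimately show ?case by (auto simp: gap_rec both_def free_def split: if_splits)
qed

lemma adm_gap_0: "adm n X \<Longrightarrow> gap n X 0 = 0"
  using gap_hgt[of n X 0] by simp

text \<open>Each repeated letter opens a request and each matched letter closes one;
  \<open>gap\<close> counts the open ones.\<close>

lemma gap_card:
  assumes "p \<le> n"
  shows "gap n X p + card {t. p < t \<and> t \<le> n \<and> matched n X t} = card {z. p < z \<and> z \<le> n \<and> both X z}"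
  using assms
proof (induction p rule: inc_induct)
  case base
  have "{t. n < t \<and> t \<le> n \<and> P t} = {}" for P by auto
  from this[of "matched n X"] this[of "both X"] show ?case by (simp only: gap_ge)
next
  case (step m)
  have *: "{t. m < t \<and> t \<le> n \<and> P t} =
      (if P (Suc m) then insert (Suc m) {t. Suc m < t \<and> t \<le> n \<and> P t}
       else {t. Suc m < t \<and> t \<le> n \<and> P t})" for P
    using step.hyps by (auto simp: less_Suc_eq_le Suc_le_eq) (metis Suc_lessI)+
  have fin: "finite {t. Suc m < t \<and> t \<le> n \<and> P t}" for P
    by (rule finite_subset[of _ "{..n}"]) auto
  consider "both X (Suc m)" | "free X (Suc m)" | "\<not> both X (Suc m)" "\<not> free X (Suc m)" by blast
  then show ?case
  proof cases
    case 1
    then have "\<not> matched n X (Suc m)" by (simp add: matched_def both_def free_def)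
    then show ?thesis using 1 step fin by (simp add: * gap_rec)
  next
    case 2
    then have "\<not> both X (Suc m)" by (simp add: both_def free_def)
    then show ?thesis using 2 step fin by (auto simp: * gap_rec matched_def[of n X "Suc m"])
  next
    case 3
    then have "\<not> matched n X (Suc m)" by (simp add: matched_def)
    then show ?thesis using 3 step fin by (simp add: * gap_rec)
  qed
qed

subsection \<open>Crystal operators on columns\<close>

definition ceps :: "nat \<Rightarrow> nat \<Rightarrow> int set \<Rightarrow> nat" where
  "ceps n i X = weps n i (colw n X)"

definition cphi :: "nat \<Rightarrow> nat \<Rightarrow> int set \<Rightarrow> nat" where
  "cphi n i X = wphi n i (colw n X)"

definition clow :: "nat \<Rightarrow> nat \<Rightarrow> int set \<Rightarrow> int set" where
  "clow n i X = set (wlow n i (colw n X))"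

definition crai :: "nat \<Rightarrow> nat \<Rightarrow> int set \<Rightarrow> int set" where
  "crai n i X = set (wrai n i (colw n X))"

lemma set_alph: "set (alph n) = letters n"
  by (auto simp: alph_def letters_def)

lemma distinct_alph: "distinct (alph n)"
  by (auto simp: alph_def)

lemma set_colw: "X \<subseteq> letters n \<Longrightarrow> set (colw n X) = X"
  by (auto simp: colw_def set_alph)

lemma length_colw: "X \<subseteq> letters n \<Longrightarrow> length (colw n X) = card X"
  using distinct_card[of "colw n X"] by (simp add: set_colw) (simp add: colw_def distinct_alph)

lemma upto_three:
  assumes "a \<le> b" "b \<le> c"
  shows "[a..c] = [a..b - 1] @ [b..c]"
  using assms by (metis diff_add_cancel order_trans upto_split1 zle_diff1_eq upto_split2 upto_empty
      append_Nil linorder_not_le)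

lemma inert_sign:
  assumes "\<forall>x\<in>set xs. letter_sign n i x = 0"
  shows "weps n i xs = 0" "wphi n i xs = 0"
  using assms by (induction xs) (auto simp: leps_def lphi_def)

text \<open>Only these four letters carry a sign of index \<open>i\<close>; in column order their
  signs are plus, minus, plus, minus.\<close>

lemma alph_split:
  assumes "0 < i" "i < n"
  shows "\<exists>A B C. alph n = A @ [int i, int i + 1] @ B @ [- int i - 1, - int i] @ C \<and>
    (\<forall>x\<in>set A \<union> set B \<union> set C. \<bar>x\<bar> \<noteq> int i \<and> \<bar>x\<bar> \<noteq> int i + 1)"
proof -
  have "[1..int n] = [1..int i - 1] @ [int i..int n]" using assms by (intro upto_three) auto
  moreover have "[int i..int n] = int i # (int i + 1) # [int i + 2..int n]"
    using assms by (simp add: upto_rec1 add.commute)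
  moreover have "[- int n..- 1] = [- int n..(- int i - 1) - 1] @ [- int i - 1..- 1]"
    using assms by (intro upto_three) auto
  moreover have "[- int i - 1..- 1] = (- int i - 1) # (- int i) # [- int i + 1..- 1]"
    using assms by (simp add: upto_rec1)
  ultimately have "alph n = [1..int i - 1] @ [int i, int i + 1] @
      ([int i + 2..int n] @ [- int n..- 2 - int i]) @ [- int i - 1, - int i] @ [- int i + 1..- 1]"
    by (simp add: alph_def)
  then show ?thesis by (intro exI[of _ "[1..int i - 1]"] exI[of _ "[int i + 2..int n] @ [- int n..- 2 - int i]"]
      exI[of _ "[- int i + 1..- 1]"]) auto
qed

lemma alph_split_last:
  assumes "0 < n"
  shows "\<exists>A C. alph n = A @ [int n, - int n] @ C \<and> (\<forall>x\<in>set A \<union> set C. \<bar>x\<bar> \<noteq> int n)"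
proof -
  have "[1..int n] = [1..int n - 1] @ [int n]" using assms by (simp add: upto_rec2)
  moreover have "[- int n..- 1] = - int n # [- int n + 1..- 1]" using assms by (simp add: upto_rec1)
  ultimately have "alph n = [1..int n - 1] @ [int n, - int n] @ [- int n + 1..- 1]"
    by (simp add: alph_def)
  then show ?thesis by (intro exI[of _ "[1..int n - 1]"] exI[of _ "[- int n + 1..- 1]"]) auto
qed

lemma letter_op_simps:
  assumes "0 < i" "i < n"
  shows "letter_sign n i (int i) = 1" "letter_sign n i (int i + 1) = - 1"
    "letter_sign n i (- int i - 1) = 1" "letter_sign n i (- int i) = - 1"
    "lower_letter n i (int i) = int i + 1" "lower_letter n i (- int i - 1) = - int i"
    "raise_letter n i (int i + 1) = int i" "raise_letter n i (- int i) = - int i - 1"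
  using assms by (auto simp: letter_sign_def lower_letter_def raise_letter_def)

text \<open>The signature rule evaluated on the sixteen possible intersections of \<open>X\<close>
  with the four letters of \<open>alph_split\<close>.\<close>

lemma column_local:
  fixes X :: "int set"
  assumes "0 < i" "i < n"
  defines "a \<equiv> int i \<in> X" and "b \<equiv> int i + 1 \<in> X" and "c \<equiv> - int i - 1 \<in> X" and "d \<equiv> - int i \<in> X"
  shows "ceps n i X = (if b \<and> \<not> a then 1 else 0) + (if d \<and> \<not> c \<and> (a \<longrightarrow> b) then 1 else 0)"
    and "cphi n i X = (if a \<and> \<not> b \<and> (d \<longrightarrow> c) then 1 else 0) + (if c \<and> \<not> d then 1 else 0)"
    and "a \<and> \<not> b \<and> (d \<longrightarrow> c) \<Longrightarrow> wlow n i (colw n X) = colw n (insert (int i + 1) (X - {int i}))"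
    and "c \<and> \<not> d \<and> (a \<longrightarrow> b) \<Longrightarrow>
      wlow n i (colw n X) = colw n (insert (- int i) (X - {- int i - 1}))"
    and "b \<and> \<not> a \<and> (d \<longrightarrow> c) \<Longrightarrow> wrai n i (colw n X) = colw n (insert (int i) (X - {int i + 1}))"
    and "d \<and> \<not> c \<and> (a \<longrightarrow> b) \<Longrightarrow>
      wrai n i (colw n X) = colw n (insert (- int i - 1) (X - {- int i}))"
proof -
  obtain A B C where s: "alph n = A @ [int i, int i + 1] @ B @ [- int i - 1, - int i] @ C"
    and out: "\<forall>x\<in>set A \<union> set B \<union> set C. \<bar>x\<bar> \<noteq> int i \<and> \<bar>x\<bar> \<noteq> int i + 1"
    using alph_split[OF assms(1,2)] by blast
  let ?f = "filter (\<lambda>x. x \<in> X)"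
  have col: "colw n Y = filter (\<lambda>x. x \<in> Y) A @ filter (\<lambda>x. x \<in> Y) [int i, int i + 1] @
      filter (\<lambda>x. x \<in> Y) B @ filter (\<lambda>x. x \<in> Y) [- int i - 1, - int i] @ filter (\<lambda>x. x \<in> Y) C" for Y
    unfolding colw_def s by simp
  have z: "\<forall>x\<in>set A \<union> set B \<union> set C. letter_sign n i x = 0"
  proof
    fix x assume "x \<in> set A \<union> set B \<union> set C"
    then have "\<bar>x\<bar> \<noteq> int i" "\<bar>x\<bar> \<noteq> int i + 1" using out by blast+
    then show "letter_sign n i x = 0" using assms(2) by (auto simp: letter_sign_def)
  qed
  have inert: "weps n i (?f A) = 0" "wphi n i (?f A) = 0" "weps n i (?f B) = 0"
    "wphi n i (?f B) = 0" "weps n i (?f C) = 0" "wphi n i (?f C) = 0"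
    by (rule inert_sign; use z in auto)+
  note simps = teps_append tphi_append tlow_append trai_append inert leps_def lphi_def letter_op_simps[OF assms(1,2)]
  have ne: "int i \<noteq> int i + 1" "- int i - 1 \<noteq> - int i" by auto
  show "ceps n i X = (if b \<and> \<not> a then 1 else 0) + (if d \<and> \<not> c \<and> (a \<longrightarrow> b) then 1 else 0)"
    unfolding ceps_def col by (cases a; cases b; cases c; cases d)
      (simp_all add: simps a_def b_def c_def d_def)
  show "cphi n i X = (if a \<and> \<not> b \<and> (d \<longrightarrow> c) then 1 else 0) + (if c \<and> \<not> d then 1 else 0)"
    unfolding cphi_def col by (cases a; cases b; cases c; cases d)
      (simp_all add: simps a_def b_def c_def d_def)
  show "wlow n i (colw n X) = colw n (insert (int i + 1) (X - {int i}))"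
    if h: "a \<and> \<not> b \<and> (d \<longrightarrow> c)"
  proof -
    let ?Y = "insert (int i + 1) (X - {int i})"
    have f: "filter (\<lambda>x. x \<in> ?Y) D = ?f D" if D: "set D \<subseteq> set A \<union> set B \<union> set C" for D
    proof (intro filter_cong refl)
      fix x assume "x \<in> set D"
      then have "\<bar>x\<bar> \<noteq> int i" "\<bar>x\<bar> \<noteq> int i + 1" using D out by blast+
      then show "x \<in> ?Y \<longleftrightarrow> x \<in> X" by auto
    qed
    have f': "filter (\<lambda>x. x \<in> ?Y) A = ?f A" "filter (\<lambda>x. x \<in> ?Y) B = ?f B"
      "filter (\<lambda>x. x \<in> ?Y) C = ?f C"
      by (rule f; blast)+
    show ?thesis unfolding col[of X] col[of ?Y] f' using h
      by (cases c; cases d) (simp_all add: simps a_def b_def c_def d_def assms(1))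
  qed
  show "wlow n i (colw n X) = colw n (insert (- int i) (X - {- int i - 1}))"
    if h: "c \<and> \<not> d \<and> (a \<longrightarrow> b)"
  proof -
    let ?Y = "insert (- int i) (X - {- int i - 1})"
    have f: "filter (\<lambda>x. x \<in> ?Y) D = ?f D" if D: "set D \<subseteq> set A \<union> set B \<union> set C" for D
    proof (intro filter_cong refl)
      fix x assume "x \<in> set D"
      then have "\<bar>x\<bar> \<noteq> int i" "\<bar>x\<bar> \<noteq> int i + 1" using D out by blast+
      then show "x \<in> ?Y \<longleftrightarrow> x \<in> X" by auto
    qed
    have f': "filter (\<lambda>x. x \<in> ?Y) A = ?f A" "filter (\<lambda>x. x \<in> ?Y) B = ?f B"
      "filter (\<lambda>x. x \<in> ?Y) C = ?f C"
      by (rule f; blast)+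
    show ?thesis unfolding col[of X] col[of ?Y] f' using h
      by (cases a; cases b) (simp_all add: simps a_def b_def c_def d_def assms(1))
  qed
  show "wrai n i (colw n X) = colw n (insert (int i) (X - {int i + 1}))"
    if h: "b \<and> \<not> a \<and> (d \<longrightarrow> c)"
  proof -
    let ?Y = "insert (int i) (X - {int i + 1})"
    have f: "filter (\<lambda>x. x \<in> ?Y) D = ?f D" if D: "set D \<subseteq> set A \<union> set B \<union> set C" for D
    proof (intro filter_cong refl)
      fix x assume "x \<in> set D"
      then have "\<bar>x\<bar> \<noteq> int i" "\<bar>x\<bar> \<noteq> int i + 1" using D out by blast+
      then show "x \<in> ?Y \<longleftrightarrow> x \<in> X" by auto
    qed
    have f': "filter (\<lambda>x. x \<in> ?Y) A = ?f A" "filter (\<lambda>x. x \<in> ?Y) B = ?f B"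
      "filter (\<lambda>x. x \<in> ?Y) C = ?f C"
      by (rule f; blast)+
    show ?thesis unfolding col[of X] col[of ?Y] f' using h
      by (cases c; cases d) (simp_all add: simps a_def b_def c_def d_def assms(1))
  qed
  show "wrai n i (colw n X) = colw n (insert (- int i - 1) (X - {- int i}))"
    if h: "d \<and> \<not> c \<and> (a \<longrightarrow> b)"
  proof -
    let ?Y = "insert (- int i - 1) (X - {- int i})"
    have f: "filter (\<lambda>x. x \<in> ?Y) D = ?f D" if D: "set D \<subseteq> set A \<union> set B \<union> set C" for D
    proof (intro filter_cong refl)
      fix x assume "x \<in> set D"
      then have "\<bar>x\<bar> \<noteq> int i" "\<bar>x\<bar> \<noteq> int i + 1" using D out by blast+
      then show "x \<in> ?Y \<longleftrightarrow> x \<in> X" by auto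
    qed
    have f': "filter (\<lambda>x. x \<in> ?Y) A = ?f A" "filter (\<lambda>x. x \<in> ?Y) B = ?f B"
      "filter (\<lambda>x. x \<in> ?Y) C = ?f C"
      by (rule f; blast)+
    show ?thesis unfolding col[of X] col[of ?Y] f' using h
      by (cases a; cases b) (simp_all add: simps a_def b_def c_def d_def assms(1))
  qed
qed

lemma column_local_last:
  fixes X :: "int set"
  assumes "0 < n"
  defines "a \<equiv> int n \<in> X" and "d \<equiv> - int n \<in> X"
  shows "ceps n n X = (if d \<and> \<not> a then 1 else 0)" "cphi n n X = (if a \<and> \<not> d then 1 else 0)"
    "a \<and> \<not> d \<Longrightarrow> wlow n n (colw n X) = colw n (insert (- int n) (X - {int n}))"
    "d \<and> \<not> a \<Longrightarrow> wrai n n (colw n X) = colw n (insert (int n) (X - {- int n}))"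
proof -
  obtain A C where s: "alph n = A @ [int n, - int n] @ C"
    and out: "\<forall>x\<in>set A \<union> set C. \<bar>x\<bar> \<noteq> int n"
    using alph_split_last[OF assms(1)] by blast
  let ?f = "filter (\<lambda>x. x \<in> X)"
  have col: "colw n Y = filter (\<lambda>x. x \<in> Y) A @ filter (\<lambda>x. x \<in> Y) [int n, - int n] @
      filter (\<lambda>x. x \<in> Y) C" for Y
    unfolding colw_def s by simp
  have z: "\<forall>x\<in>set A \<union> set C. letter_sign n n x = 0"
  proof
    fix x assume "x \<in> set A \<union> set C"
    then have "\<bar>x\<bar> \<noteq> int n" using out by blast
    then show "letter_sign n n x = 0" by (auto simp: letter_sign_def)
  qed
  have inert: "weps n n (?f A) = 0" "wphi n n (?f A) = 0" "weps n n (?f C) = 0" "wphi n n (?f C) = 0"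
    by (rule inert_sign; use z in auto)+
  have ops: "letter_sign n n (int n) = 1" "letter_sign n n (- int n) = - 1"
    "lower_letter n n (int n) = - int n" "raise_letter n n (- int n) = int n"
    using assms(1) by (auto simp: letter_sign_def lower_letter_def raise_letter_def)
  note simps = teps_append tphi_append tlow_append trai_append inert leps_def lphi_def ops
  show "ceps n n X = (if d \<and> \<not> a then 1 else 0)"
    unfolding ceps_def col by (cases a; cases d) (simp_all add: simps a_def d_def)
  show "cphi n n X = (if a \<and> \<not> d then 1 else 0)"
    unfolding cphi_def col by (cases a; cases d) (simp_all add: simps a_def d_def)
  show "wlow n n (colw n X) = colw n (insert (- int n) (X - {int n}))" if h: "a \<and> \<not> d"
  proof -
    let ?Y = "insert (- int n) (X - {int n})"
    have f: "filter (\<lambda>x. x \<in> ?Y) D = ?f D" if D: "set D \<subseteq> set A \<union> set C" for D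
    proof (intro filter_cong refl)
      fix x assume "x \<in> set D"
      then have "\<bar>x\<bar> \<noteq> int n" using D out by blast
      then show "x \<in> ?Y \<longleftrightarrow> x \<in> X" by auto
    qed
    have f': "filter (\<lambda>x. x \<in> ?Y) A = ?f A" "filter (\<lambda>x. x \<in> ?Y) C = ?f C"
      by (rule f; blast)+
    show ?thesis unfolding col[of X] col[of ?Y] f' using h assms(1)
      by (simp add: simps a_def d_def)
  qed
  show "wrai n n (colw n X) = colw n (insert (int n) (X - {- int n}))" if h: "d \<and> \<not> a"
  proof -
    let ?Y = "insert (int n) (X - {- int n})"
    have f: "filter (\<lambda>x. x \<in> ?Y) D = ?f D" if D: "set D \<subseteq> set A \<union> set C" for D
    proof (intro filter_cong refl)
      fix x assume "x \<in> set D"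
      then have "\<bar>x\<bar> \<noteq> int n" using D out by blast
      then show "x \<in> ?Y \<longleftrightarrow> x \<in> X" by auto
    qed
    have f': "filter (\<lambda>x. x \<in> ?Y) A = ?f A" "filter (\<lambda>x. x \<in> ?Y) C = ?f C"
      by (rule f; blast)+
    show ?thesis unfolding col[of X] col[of ?Y] f' using h assms(1)
      by (simp add: simps a_def d_def)
  qed
qed

text \<open>A set of ranks is given by its unbarred letters \<open>A\<close> and its barred letters \<open>B\<close>.\<close>

definition halves :: "nat \<Rightarrow> (nat \<Rightarrow> bool) \<Rightarrow> (nat \<Rightarrow> bool) \<Rightarrow> nat set" where
  "halves n A B = {p \<in> {1..n}. A p} \<union> (\<lambda>p. 2 * n + 1 - p) ` {p \<in> {1..n}. B p}"

lemma halves_mem: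
  assumes "0 < p" "p \<le> n"
  shows "p \<in> halves n A B \<longleftrightarrow> A p" "2 * n + 1 - p \<in> halves n A B \<longleftrightarrow> B p"
proof -
  show "p \<in> halves n A B \<longleftrightarrow> A p" using assms by (auto simp: halves_def)
  have 1: "2 * n + 1 - p = 2 * n + 1 - q \<longleftrightarrow> q = p" if "q \<in> {1..n}" for q using assms that by auto
  have "2 * n + 1 - p \<notin> {1..n}" using assms by auto
  then have "2 * n + 1 - p \<in> halves n A B \<longleftrightarrow> (\<exists>q\<in>{1..n}. B q \<and> 2 * n + 1 - p = 2 * n + 1 - q)"
    unfolding halves_def by blast
  also have "\<dots> \<longleftrightarrow> B p" using 1 assms by (metis atLeastAtMost_iff One_nat_def Suc_leI)
  finally show "2 * n + 1 - p \<in> halves n A B \<longleftrightarrow> B p" .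
qed

lemma halves_subset: "halves n A B \<subseteq> {1..2 * n}"
  by (auto simp: halves_def)

lemma halves_cases:
  fixes n q :: nat
  assumes "q \<in> {1..2 * n}"
  obtains p where "0 < p" "p \<le> n" "q = p \<or> q = 2 * n + 1 - p"
proof (cases "q \<le> n")
  case False
  then have "0 < 2 * n + 1 - q" "2 * n + 1 - q \<le> n" "q = 2 * n + 1 - (2 * n + 1 - q)"
    using assms by auto
  then show ?thesis using that by blast
next
  case True
  then show ?thesis using that[of q] assms by auto
qed

lemma halves_eqI:
  assumes "U \<subseteq> {1..2 * n}"
    and "\<And>p. 0 < p \<Longrightarrow> p \<le> n \<Longrightarrow> (p \<in> U \<longleftrightarrow> A p) \<and> (2 * n + 1 - p \<in> U \<longleftrightarrow> B p)"
  shows "U = halves n A B"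
proof (intro set_eqI)
  fix q
  show "q \<in> U \<longleftrightarrow> q \<in> halves n A B"
  proof (cases "q \<in> {1..2 * n}")
    case True
    then obtain p where "0 < p" "p \<le> n" "q = p \<or> q = 2 * n + 1 - p" by (rule halves_cases)
    then show ?thesis using assms(2)[of p] halves_mem[of p n A B] by auto
  next
    case False
    then show ?thesis using assms(1) halves_subset[of n A B] by blast
  qed
qed

lemma halves_cong:
  "(\<And>p. 0 < p \<Longrightarrow> p \<le> n \<Longrightarrow> (A p \<longleftrightarrow> A' p) \<and> (B p \<longleftrightarrow> B' p)) \<Longrightarrow> halves n A B = halves n A' B'"
proof (rule halves_eqI[OF halves_subset])
  fix p assume eq: "\<And>p. 0 < p \<Longrightarrow> p \<le> n \<Longrightarrow> (A p \<longleftrightarrow> A' p) \<and> (B p \<longleftrightarrow> B' p)" and p: "0 < p" "p \<le> n"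
  show "(p \<in> halves n A B \<longleftrightarrow> A' p) \<and> (2 * n + 1 - p \<in> halves n A B \<longleftrightarrow> B' p)"
    unfolding halves_mem[OF p] by (rule eq[OF p])
qed

lemma halves_inj:
  assumes "halves n A B = halves n A' B'" "0 < p" "p \<le> n"
  shows "(A p \<longleftrightarrow> A' p) \<and> (B p \<longleftrightarrow> B' p)"
proof -
  have "p \<in> halves n A B \<longleftrightarrow> p \<in> halves n A' B'" "2 * n + 1 - p \<in> halves n A B \<longleftrightarrow> 2 * n + 1 - p \<in> halves n A' B'"
    by (simp_all only: assms(1))
  then show ?thesis unfolding halves_mem[OF assms(2,3)] by blast
qed

text \<open>Index \<open>2 * n - i\<close> acts on the ranks \<open>2 * n - i\<close> and
  \<open>2 * n + 1 - i\<close>, which belong to the barred letters of \<open>i + 1\<close> and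
  \<open>i\<close> in this order. This is why \<open>i\<close> and \<open>Suc i\<close> exchange
  their roles in \<open>B\<close>.\<close>

lemma halves_ops:
  assumes "0 < i" "i < n"
  shows "aeps i (halves n A B) = (if \<not> A i \<and> A (Suc i) then 1 else 0)"
    "aphi i (halves n A B) = (if A i \<and> \<not> A (Suc i) then 1 else 0)"
    "alow i (halves n A B) = halves n (A(i := False, Suc i := True)) B"
    "aeps (2 * n - i) (halves n A B) = (if \<not> B (Suc i) \<and> B i then 1 else 0)"
    "aphi (2 * n - i) (halves n A B) = (if B (Suc i) \<and> \<not> B i then 1 else 0)"
    "alow (2 * n - i) (halves n A B) = halves n A (B(Suc i := False, i := True))"
proof -
  have j: "2 * n - i = 2 * n + 1 - Suc i" "Suc (2 * n - i) = 2 * n + 1 - i" using assms by auto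
  have m1: "i \<in> halves n A B \<longleftrightarrow> A i" "Suc i \<in> halves n A B \<longleftrightarrow> A (Suc i)"
    using assms halves_mem(1)[of i n A B] halves_mem(1)[of "Suc i" n A B] by auto
  have m2: "2 * n - i \<in> halves n A B \<longleftrightarrow> B (Suc i)"
    unfolding j(1) by (rule halves_mem(2)) (use assms in auto)
  have m3: "Suc (2 * n - i) \<in> halves n A B \<longleftrightarrow> B i"
    unfolding j(2) by (rule halves_mem(2)) (use assms in auto)
  note m = m1 m2 m3
  show "aeps i (halves n A B) = (if \<not> A i \<and> A (Suc i) then 1 else 0)"
    "aphi i (halves n A B) = (if A i \<and> \<not> A (Suc i) then 1 else 0)"
    "aeps (2 * n - i) (halves n A B) = (if \<not> B (Suc i) \<and> B i then 1 else 0)"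
    "aphi (2 * n - i) (halves n A B) = (if B (Suc i) \<and> \<not> B i then 1 else 0)"
    unfolding aeps_def aphi_def m by simp_all
  show "alow i (halves n A B) = halves n (A(i := False, Suc i := True)) B"
  proof (rule halves_eqI)
    show "alow i (halves n A B) \<subseteq> {1..2 * n}" using halves_subset[of n A B] assms by (auto simp: alow_def)
    fix p assume p: "0 < p" "p \<le> n"
    then have "2 * n + 1 - p \<noteq> i" "2 * n + 1 - p \<noteq> Suc i" using assms by auto
    then show "(p \<in> alow i (halves n A B) \<longleftrightarrow> (A(i := False, Suc i := True)) p) \<and>
        (2 * n + 1 - p \<in> alow i (halves n A B) \<longleftrightarrow> B p)"
      using halves_mem[OF p, of A B] by (auto simp: alow_def)
  qed
  show "alow (2 * n - i) (halves n A B) = halves n A (B(Suc i := False, i := True))"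
  proof (rule halves_eqI)
    show "alow (2 * n - i) (halves n A B) \<subseteq> {1..2 * n}"
      using halves_subset[of n A B] assms by (auto simp: alow_def)
    fix p assume p: "0 < p" "p \<le> n"
    then have "p \<noteq> 2 * n - i" "p \<noteq> Suc (2 * n - i)"
      "2 * n + 1 - p = 2 * n - i \<longleftrightarrow> p = Suc i" "2 * n + 1 - p = Suc (2 * n - i) \<longleftrightarrow> p = i"
      using assms by auto
    then show "(p \<in> alow (2 * n - i) (halves n A B) \<longleftrightarrow> A p) \<and>
        (2 * n + 1 - p \<in> alow (2 * n - i) (halves n A B) \<longleftrightarrow> (B(Suc i := False, i := True)) p)"
      using halves_mem[OF p, of A B] by (auto simp: alow_def)
  qed
qed

lemma halves_ops_last:
  assumes "0 < n"
  shows "aeps n (halves n A B) = (if \<not> A n \<and> B n then 1 else 0)"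
    "aphi n (halves n A B) = (if A n \<and> \<not> B n then 1 else 0)"
    "alow n (halves n A B) = halves n (A(n := False)) (B(n := True))"
proof -
  have m: "n \<in> halves n A B \<longleftrightarrow> A n" "Suc n \<in> halves n A B \<longleftrightarrow> B n"
    using halves_mem[of n n A B] assms by (simp_all add: mult_2)
  show "aeps n (halves n A B) = (if \<not> A n \<and> B n then 1 else 0)"
    "aphi n (halves n A B) = (if A n \<and> \<not> B n then 1 else 0)"
    unfolding aeps_def aphi_def m by simp_all
  show "alow n (halves n A B) = halves n (A(n := False)) (B(n := True))"
  proof (rule halves_eqI)
    show "alow n (halves n A B) \<subseteq> {1..2 * n}" using halves_subset[of n A B] assms by (auto simp: alow_def)
    fix p assume p: "0 < p" "p \<le> n"
    then have "2 * n + 1 - p \<noteq> n" "2 * n + 1 - p = Suc n \<longleftrightarrow> p = n" "p \<noteq> Suc n" by auto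
    then show "(p \<in> alow n (halves n A B) \<longleftrightarrow> (A(n := False)) p) \<and>
        (2 * n + 1 - p \<in> alow n (halves n A B) \<longleftrightarrow> (B(n := True)) p)"
      using halves_mem[OF p, of A B] by (auto simp: alow_def)
  qed
qed

subsection \<open>Virtual operators\<close>

definition aligned :: "nat \<Rightarrow> nat \<Rightarrow> nat set list \<Rightarrow> nat \<Rightarrow> nat \<Rightarrow> bool" where
  "aligned n i L e p \<longleftrightarrow>
     (if i < n then Aeps i L = e \<and> Aphi i L = p \<and> Aeps (2 * n - i) L = e \<and> Aphi (2 * n - i) L = p
      else Aeps n L = 2 * e \<and> Aphi n L = 2 * p)"

definition vlow :: "nat \<Rightarrow> nat \<Rightarrow> nat set list \<Rightarrow> nat set list" where
  "vlow n i L = (if i < n then Alow i (Alow (2 * n - i) L) else Alow n (Alow n L))"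

text \<open>The two raisings are taken in the order opposite to \<open>vlow\<close>, so that
  \<open>vrai_vlow\<close> follows by undoing one operator after the other.\<close>

definition vrai :: "nat \<Rightarrow> nat \<Rightarrow> nat set list \<Rightarrow> nat set list" where
  "vrai n i L = (if i < n then Arai (2 * n - i) (Arai i L) else Arai n (Arai n L))"

lemma tensor_cong:
  assumes "map ep xs = map ep ys" "map ph xs = map ph ys"
  shows "teps ep ph xs = teps ep ph ys \<and> tphi ep ph xs = tphi ep ph ys"
proof -
  have "length xs = length ys" using assms(1) by (metis length_map)
  then show ?thesis using assms by (induction xs ys rule: list_induct2) auto
qed

lemma Alow_indep:
  assumes "i + 1 < j \<or> j + 1 < i"
  shows "Aeps i (Alow j L) = Aeps i L" "Aphi i (Alow j L) = Aphi i L"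
proof -
  have "map (aeps i) (Alow j L) = map (aeps i) L" "map (aphi i) (Alow j L) = map (aphi i) L"
    using assms by (auto intro!: tlow_map_inv simp: aeps_def aphi_def alow_def)
  from tensor_cong[OF this] show "Aeps i (Alow j L) = Aeps i L" "Aphi i (Alow j L) = Aphi i L"
    by auto
qed

lemma Arai_indep:
  assumes "i + 1 < j \<or> j + 1 < i" "0 < Aeps j L"
  shows "Aeps i (Arai j L) = Aeps i L" "Aphi i (Arai j L) = Aphi i L"
proof -
  have "map (aeps i) (Arai j L) = map (aeps i) L" "map (aphi i) (Arai j L) = map (aphi i) L"
    using assms by (auto intro!: trai_map_inv simp: aeps_def aphi_def arai_def)
  from tensor_cong[OF this] show "Aeps i (Arai j L) = Aeps i L" "Aphi i (Arai j L) = Aphi i L"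
    by auto
qed

lemma Alow_law:
  assumes "0 < Aphi i L"
  shows "Aeps i (Alow i L) = Suc (Aeps i L)" "Aphi i L = Suc (Aphi i (Alow i L))"
    "Arai i (Alow i L) = L"
  using tensor_low[OF crystal_law_sets, of L i] assms by (auto simp: list_all_iff)

lemma Arai_law:
  assumes "0 < Aeps i L"
  shows "Aphi i (Arai i L) = Suc (Aphi i L)" "Aeps i L = Suc (Aeps i (Arai i L))"
    "Alow i (Arai i L) = L"
  using tensor_rai[OF crystal_law_sets, of L i] assms by (auto simp: list_all_iff)

lemma aligned_append:
  assumes "aligned n i L e p" "aligned n i K e' p'"
  shows "aligned n i (L @ K) (e + (e' - p)) (p' + (p - e'))"
  using assms by (auto simp: aligned_def teps_append tphi_append split: if_splits)

text \<open>For \<open>i < n\<close> the two operators have distant indices and do not affect each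
  other's signs. For \<open>i = n\<close> the numbers compared are even, so after the first
  application the second one still falls into the same factor.\<close>

lemma vlow_append:
  assumes "i \<in> {1..n}" "aligned n i L e p" "aligned n i K e' p'" "0 < p' + (p - e')"
  shows "vlow n i (L @ K) = (if e' < p then vlow n i L @ K else L @ vlow n i K)"
proof (cases "i < n")
  case True
  then have ind: "i + 1 < 2 * n - i \<or> 2 * n - i + 1 < i" by auto
  show ?thesis using True assms(2,3) Alow_indep[OF ind]
    by (auto simp: vlow_def aligned_def tlow_append)
next
  case False
  then have n: "\<not> i < n" "i = n" using assms(1) by auto
  show ?thesis
  proof (cases "e' < p")
    case True
    have "0 < Aphi n L" using True assms(2) n by (simp add: aligned_def)
    then have "Aphi n (Alow n L) = 2 * p - 1"
      using Alow_law(2)[of n L] assms(2) n by (simp add: aligned_def) linarith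
    then show ?thesis using True assms(2,3) n by (auto simp: vlow_def aligned_def tlow_append)
  next
    case False
    then have "0 < Aphi n K" using assms(3,4) n by (simp add: aligned_def)
    then have "Aeps n (Alow n K) = Suc (2 * e')" using Alow_law(1)[of n K] assms(3) n by (simp add: aligned_def)
    then show ?thesis using False assms(2,3) n by (auto simp: vlow_def aligned_def tlow_append)
  qed
qed

lemma vrai_append:
  assumes "i \<in> {1..n}" "aligned n i L e p" "aligned n i K e' p'" "0 < e + (e' - p)"
  shows "vrai n i (L @ K) = (if p < e' then L @ vrai n i K else vrai n i L @ K)"
proof -
  \<comment> \<open>This rules out the exceptional case of an empty first factor in
    \<open>trai_append\<close>.\<close>
  have ne: "L \<noteq> []" if "\<not> p < e'"
    using that assms(2,4) by (auto simp: aligned_def split: if_splits)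
  have neA: "Arai j L = [] \<longleftrightarrow> L = []" for j by (metis length_0_conv length_trai)
  show ?thesis
  proof (cases "i < n")
    case True
    then have ind: "2 * n - i + 1 < i \<or> i + 1 < 2 * n - i" by auto
    have "0 < Aeps i (if p < e' then K else L)"
      using True assms(2,3,4) by (auto simp: aligned_def)
    then show ?thesis using True assms(2,3) Arai_indep[OF ind] ne neA
      by (auto simp: vrai_def aligned_def trai_append)
  next
    case False
    then have n: "\<not> i < n" "i = n" using assms(1) by auto
    show ?thesis
    proof (cases "p < e'")
      case True
      have "0 < Aeps n K" using True assms(3) n by (simp add: aligned_def)
      then have "Aeps n (Arai n K) = 2 * e' - 1"
        using Arai_law(2)[of n K] assms(3) n by (simp add: aligned_def) linarith
      then show ?thesis using True assms(2,3) n by (auto simp: vrai_def aligned_def trai_append)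
    next
      case False
      then have "0 < Aeps n L" using assms(2,4) n by (simp add: aligned_def)
      then have "Aphi n (Arai n L) = Suc (2 * p)" using Arai_law(1)[of n L] assms(2) n by (simp add: aligned_def)
      then show ?thesis using False assms(2,3) n ne neA by (auto simp: vrai_def aligned_def trai_append)
    qed
  qed
qed

lemma vlow_positive:
  assumes "i \<in> {1..n}" "aligned n i L e p" "0 < p"
  shows "i < n \<Longrightarrow> 0 < Aphi (2 * n - i) L \<and> 0 < Aphi i (Alow (2 * n - i) L)"
    and "\<not> i < n \<Longrightarrow> 0 < Aphi n L \<and> 0 < Aphi n (Alow n L)"
proof -
  assume "i < n"
  then have "i + 1 < 2 * n - i \<or> 2 * n - i + 1 < i" by auto
  from Alow_indep[OF this] show "0 < Aphi (2 * n - i) L \<and> 0 < Aphi i (Alow (2 * n - i) L)"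
    using assms \<open>i < n\<close> by (simp add: aligned_def)
next
  assume "\<not> i < n"
  then have "Aphi n L = 2 * p" using assms by (simp add: aligned_def)
  then show "0 < Aphi n L \<and> 0 < Aphi n (Alow n L)" using Alow_law(2)[of n L] assms(3) by simp presburger
qed

lemma vrai_positive:
  assumes "i \<in> {1..n}" "aligned n i L e p" "0 < e"
  shows "i < n \<Longrightarrow> 0 < Aeps i L \<and> 0 < Aeps (2 * n - i) (Arai i L)"
    and "\<not> i < n \<Longrightarrow> 0 < Aeps n L \<and> 0 < Aeps n (Arai n L)"
proof -
  assume "i < n"
  then have "2 * n - i + 1 < i \<or> i + 1 < 2 * n - i" "0 < Aeps i L"
    using assms by (auto simp: aligned_def)
  from Arai_indep[OF this] show "0 < Aeps i L \<and> 0 < Aeps (2 * n - i) (Arai i L)"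
    using assms \<open>i < n\<close> by (simp add: aligned_def)
next
  assume "\<not> i < n"
  then have "Aeps n L = 2 * e" using assms by (simp add: aligned_def)
  then show "0 < Aeps n L \<and> 0 < Aeps n (Arai n L)" using Arai_law(2)[of n L] assms(3) by simp presburger
qed

lemma vrai_vlow:
  assumes "i \<in> {1..n}" "aligned n i L e p" "0 < p"
  shows "vrai n i (vlow n i L) = L"
  using vlow_positive[OF assms] by (auto simp: vrai_def vlow_def Alow_law(3))

lemma bisimulation_virtual:
  assumes R: "bisimulation {1..<2 * n} Aeps Aphi Alow Arai R" "R L L'" and i: "i \<in> {1..n}"
    and al: "aligned n i L e p"
  shows "aligned n i L' e p" "0 < p \<Longrightarrow> R (vlow n i L) (vlow n i L')"
    "0 < e \<Longrightarrow> R (vrai n i L) (vrai n i L')"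
proof -
  have I: "i \<in> {1..<2 * n}" "2 * n - i \<in> {1..<2 * n}" "n \<in> {1..<2 * n}" using i by auto
  note D = bisimulationD[OF R(1)]
  show "aligned n i L' e p"
    using al D(1,2)[OF R(2) I(1)] D(1,2)[OF R(2) I(2)] D(1,2)[OF R(2) I(3)]
    unfolding aligned_def by (auto split: if_splits)
  show "R (vlow n i L) (vlow n i L')" if "0 < p"
    using vlow_positive[OF i al that] D(3)[OF D(3)[OF R(2) I(2)] I(1)] D(3)[OF D(3)[OF R(2) I(3)] I(3)]
    by (auto simp: vlow_def)
  show "R (vrai n i L) (vrai n i L')" if "0 < e"
    using vrai_positive[OF i al that] D(4)[OF D(4)[OF R(2) I(1)] I(2)] D(4)[OF D(4)[OF R(2) I(3)] I(3)]
    by (auto simp: vrai_def)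
qed

subsection \<open>Virtualization of columns\<close>

text \<open>
  The ranks of the letters of the right column are \<open>RA\<close>, those of the left column are \<open>LA\<close>;
  \<open>RC\<close> and \<open>LC\<close> are the complements of their images under the bar.
\<close>

definition RA :: "nat \<Rightarrow> int set \<Rightarrow> nat set" where
  "RA n X = halves n (pos X) (\<lambda>p. neg X p \<and> \<not> pos X p \<or> matched n X p)"

definition LA :: "nat \<Rightarrow> int set \<Rightarrow> nat set" where
  "LA n X = halves n (\<lambda>p. pos X p \<and> \<not> neg X p \<or> matched n X p) (neg X)"

definition RC :: "nat \<Rightarrow> int set \<Rightarrow> nat set" where
  "RC n X = halves n (\<lambda>p. \<not> (neg X p \<and> \<not> pos X p \<or> matched n X p)) (\<lambda>p. \<not> pos X p)"

definition LC :: "nat \<Rightarrow> int set \<Rightarrow> nat set" where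
  "LC n X = halves n (\<lambda>p. \<not> neg X p) (\<lambda>p. \<not> (pos X p \<and> \<not> neg X p \<or> matched n X p))"

text \<open>Only lowering is recorded; the statement for raising is its inverse,
  \<open>virtual_rai\<close>.\<close>

definition virtual :: "nat \<Rightarrow> (int set \<Rightarrow> nat set list) \<Rightarrow> bool" where
  "virtual n v \<longleftrightarrow> (\<forall>X i. adm n X \<longrightarrow> i \<in> {1..n} \<longrightarrow>
     aligned n i (v X) (ceps n i X) (cphi n i X) \<and>
     (0 < cphi n i X \<longrightarrow> v (clow n i X) = vlow n i (v X)))"

lemma letters_simps:
  "0 < i \<Longrightarrow> i < n \<Longrightarrow> int i \<in> letters n \<and> int i + 1 \<in> letters n \<and> - int i - 1 \<in> letters n \<and> - int i \<in> letters n"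
  "0 < n \<Longrightarrow> int n \<in> letters n \<and> - int n \<in> letters n"
  by (auto simp: letters_def)

lemma ceps_cphi_bits:
  assumes "0 < i" "i < n"
  shows "ceps n i X = (if pos X (Suc i) \<and> \<not> pos X i then 1 else 0) +
      (if neg X i \<and> \<not> neg X (Suc i) \<and> (pos X i \<longrightarrow> pos X (Suc i)) then 1 else 0)"
    "cphi n i X = (if pos X i \<and> \<not> pos X (Suc i) \<and> (neg X i \<longrightarrow> neg X (Suc i)) then 1 else 0) +
      (if neg X (Suc i) \<and> \<not> neg X i then 1 else 0)"
proof -
  have e: "int (Suc i) = int i + 1" "- int (Suc i) = - int i - 1" by auto
  show "ceps n i X = (if pos X (Suc i) \<and> \<not> pos X i then 1 else 0) +
      (if neg X i \<and> \<not> neg X (Suc i) \<and> (pos X i \<longrightarrow> pos X (Suc i)) then 1 else 0)"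
    "cphi n i X = (if pos X i \<and> \<not> pos X (Suc i) \<and> (neg X i \<longrightarrow> neg X (Suc i)) then 1 else 0) +
      (if neg X (Suc i) \<and> \<not> neg X i then 1 else 0)"
    unfolding column_local(1,2)[OF assms] pos_def neg_def e by simp_all
qed

lemma clow_bits:
  assumes "0 < i" "i < n" "X \<subseteq> letters n" "0 < cphi n i X"
  defines "Y \<equiv> clow n i X"
  shows "Y \<subseteq> letters n" "colw n Y = wlow n i (colw n X)"
    "\<And>p. p \<noteq> i \<Longrightarrow> p \<noteq> Suc i \<Longrightarrow> same X Y p"
    "pos X i \<and> \<not> pos X (Suc i) \<and> (neg X i \<longrightarrow> neg X (Suc i)) \<and> \<not> pos Y i \<and> pos Y (Suc i) \<and>
       (neg Y i \<longleftrightarrow> neg X i) \<and> (neg Y (Suc i) \<longleftrightarrow> neg X (Suc i)) \<or>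
     neg X (Suc i) \<and> \<not> neg X i \<and> (pos X i \<longrightarrow> pos X (Suc i)) \<and> neg Y i \<and> \<not> neg Y (Suc i) \<and>
       (pos Y i \<longleftrightarrow> pos X i) \<and> (pos Y (Suc i) \<longleftrightarrow> pos X (Suc i))" (is ?bits)
proof -
  note l = letters_simps(1)[OF assms(1,2)]
  have e: "int (Suc i) = int i + 1" "- int (Suc i) = - int i - 1" by auto
  have ph: "int i \<in> X \<and> int i + 1 \<notin> X \<and> (- int i \<in> X \<longrightarrow> - int i - 1 \<in> X) \<or>
      - int i - 1 \<in> X \<and> - int i \<notin> X \<and> (int i \<in> X \<longrightarrow> int i + 1 \<in> X)"
    using assms(4) unfolding column_local(2)[OF assms(1,2)] by (auto split: if_splits)
  have "Y \<subseteq> letters n \<and> colw n Y = wlow n i (colw n X) \<and> (\<forall>p. p \<noteq> i \<longrightarrow> p \<noteq> Suc i \<longrightarrow> same X Y p) \<and> ?bits"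
    using ph
  proof
    assume h: "int i \<in> X \<and> int i + 1 \<notin> X \<and> (- int i \<in> X \<longrightarrow> - int i - 1 \<in> X)"
    let ?Y = "insert (int i + 1) (X - {int i})"
    have sub: "?Y \<subseteq> letters n" using l assms(3) by auto
    have w: "wlow n i (colw n X) = colw n ?Y" by (rule column_local(3)[OF assms(1,2) h])
    then have Y: "Y = ?Y" unfolding Y_def clow_def w by (simp add: set_colw[OF sub])
    show ?thesis using sub w h assms(1) unfolding Y same_def pos_def neg_def e by auto
  next
    assume h: "- int i - 1 \<in> X \<and> - int i \<notin> X \<and> (int i \<in> X \<longrightarrow> int i + 1 \<in> X)"
    let ?Y = "insert (- int i) (X - {- int i - 1})"
    have sub: "?Y \<subseteq> letters n" using l assms(3) by auto
    have w: "wlow n i (colw n X) = colw n ?Y" by (rule column_local(4)[OF assms(1,2) h])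
    then have Y: "Y = ?Y" unfolding Y_def clow_def w by (simp add: set_colw[OF sub])
    show ?thesis using sub w h assms(1) unfolding Y same_def pos_def neg_def e by auto
  qed
  then show "Y \<subseteq> letters n" "colw n Y = wlow n i (colw n X)"
    "\<And>p. p \<noteq> i \<Longrightarrow> p \<noteq> Suc i \<Longrightarrow> same X Y p" ?bits by blast+
qed

lemma clow_bits_last:
  assumes "0 < n" "X \<subseteq> letters n" "0 < cphi n n X"
  defines "Y \<equiv> clow n n X"
  shows "Y \<subseteq> letters n" "colw n Y = wlow n n (colw n X)"
    "\<And>p. p \<noteq> n \<Longrightarrow> same X Y p" "pos X n \<and> \<not> neg X n \<and> \<not> pos Y n \<and> neg Y n"
proof -
  have h: "int n \<in> X \<and> - int n \<notin> X"
    using assms(3) unfolding column_local_last(2)[OF assms(1)] by (auto split: if_splits)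
  let ?Y = "insert (- int n) (X - {int n})"
  have sub: "?Y \<subseteq> letters n" using letters_simps(2)[OF assms(1)] assms(2) by auto
  have w: "wlow n n (colw n X) = colw n ?Y" by (rule column_local_last(3)[OF assms(1) h])
  then have Y: "Y = ?Y" unfolding Y_def clow_def w by (simp add: set_colw[OF sub])
  show "Y \<subseteq> letters n" "colw n Y = wlow n n (colw n X)"
    "\<And>p. p \<noteq> n \<Longrightarrow> same X Y p" "pos X n \<and> \<not> neg X n \<and> \<not> pos Y n \<and> neg Y n"
    using sub w h assms(1) unfolding Y same_def pos_def neg_def by auto
qed

lemma hgt_above:
  assumes "hgt X p = hgt Y p" "p \<le> q" "\<And>r. p < r \<Longrightarrow> same X Y r"
  shows "hgt X q = hgt Y q"
  using assms(2)
proof (induction q rule: dec_induct)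
  case (step m)
  then have "same X Y (Suc m)" using assms(3) by simp
  then show ?case using step by (simp add: same_def)
qed (rule assms(1))

text \<open>An operator of index \<open>i < n\<close> can change \<open>hgt\<close> only at
  \<open>i\<close>. There the bounds at \<open>i - 1\<close> and \<open>i + 1\<close>, combined with
  the local pattern, imply the bound both before and after.\<close>

lemma adm_clow:
  assumes X: "X \<subseteq> letters n" and "i \<in> {1..n}" "0 < cphi n i X"
  shows "adm n (clow n i X) \<longleftrightarrow> adm n X"
proof -
  let ?Y = "clow n i X"
  obtain m where m: "i = Suc m" using assms(2) by (cases i) auto
  show ?thesis
  proof (cases "i < n")
    case True
    note b = clow_bits[OF _ True X assms(3)]
    have i: "0 < i" using m by simp
    have below: "hgt X p = hgt ?Y p" if "p \<le> m" for p
      using that b(3)[OF i] m by (intro hgt_cong) auto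
    have up: "hgt X (Suc i) = hgt ?Y (Suc i)"
      using b(4)[OF i] below[of m] m by auto
    have above: "hgt X p = hgt ?Y p" if "Suc i \<le> p" for p
      using that b(3)[OF i] by (intro hgt_above[OF up]) auto
    have at: "hgt X i \<le> i \<and> hgt ?Y i \<le> i" if "hgt X m \<le> m" "hgt X (Suc i) \<le> Suc i"
      using that b(4)[OF i] below[of m] m by (auto split: if_splits)
    have "(\<forall>p\<le>n. hgt X p \<le> p) \<longleftrightarrow> (\<forall>p\<le>n. hgt ?Y p \<le> p)"
    proof -
      have "hgt X p = hgt ?Y p \<or> p = i" for p using below[of p] above[of p] m by linarith
      moreover have "m \<le> n" "Suc i \<le> n" "m \<noteq> i" "Suc i \<noteq> i" using m True by auto
      ultimately show ?thesis using at by metis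
    qed
    then show ?thesis using b(1)[OF i] X by (simp add: adm_def)
  next
    case False
    then have i: "i = n" using assms(2) by simp
    then have n: "0 < n" using m by simp
    note b = clow_bits_last[OF n X assms(3)[unfolded i]]
    have below: "hgt X p = hgt (clow n n X) p" if "p \<le> m" for p
      using that b(3) m i by (intro hgt_cong) auto
    have "hgt (clow n n X) n = hgt X n" using b(4) below[of m] m i by auto
    then have "hgt (clow n n X) p = hgt X p" if "p \<le> n" for p
      using that below[of p] m i by (metis le_Suc_eq)
    then show ?thesis using b(1) i X by (simp add: adm_def)
  qed
qed

lemma matched_bits:
  assumes "i < n"
  shows "matched n X i \<Longrightarrow> free X i" "matched n X (Suc i) \<Longrightarrow> free X (Suc i)"
    "free X i \<Longrightarrow> both X (Suc i) \<Longrightarrow> matched n X i"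
    "matched n X i \<Longrightarrow> free X (Suc i) \<Longrightarrow> matched n X (Suc i)"
  using assms by (auto simp: matched_def gap_rec both_def free_def)

text \<open>
  An operator of index \<open>i < n\<close> preserves \<open>gap\<close> except possibly at \<open>i\<close>, so the virtualization can be
  checked at the positions \<open>i\<close> and \<open>i + 1\<close>.
\<close>

lemma matched_clow:
  assumes "0 < i" "i < n" "X \<subseteq> letters n" "0 < cphi n i X"
  defines "Y \<equiv> clow n i X"
  shows "\<And>p. p \<noteq> i \<Longrightarrow> p \<noteq> Suc i \<Longrightarrow> matched n X p \<longleftrightarrow> matched n Y p"
    "free X i \<Longrightarrow> free Y (Suc i) \<Longrightarrow> matched n X i \<longleftrightarrow> matched n Y (Suc i)"
    "free X (Suc i) \<Longrightarrow> free Y i \<Longrightarrow> matched n X (Suc i) \<longleftrightarrow> matched n Y i"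
proof -
  note b = clow_bits[OF assms(1-4), folded Y_def]
  obtain m where m: "i = Suc m" using assms(1) by (cases i) auto
  have above: "gap n X p = gap n Y p" if "Suc i \<le> p" for p
    using that b(3) by (intro gap_cong) auto
  have g: "gap n X i = (if both X (Suc i) then Suc (gap n X (Suc i))
      else if free X (Suc i) then gap n X (Suc i) - 1 else gap n X (Suc i))"
    "gap n Y i = (if both Y (Suc i) then Suc (gap n X (Suc i))
      else if free Y (Suc i) then gap n X (Suc i) - 1 else gap n X (Suc i))"
    using assms(2) above[of "Suc i"] by (simp_all add: gap_rec)
  have gm: "gap n X m = gap n Y m"
  proof -
    have r: "gap n Z m = (if both Z i then Suc (gap n Z i) else if free Z i then gap n Z i - 1
        else gap n Z i)" for Z
      unfolding m using assms(2) m by (intro gap_rec) simp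
    from b(4) show ?thesis
    proof (elim disjE)
      assume "pos X i \<and> \<not> pos X (Suc i) \<and> (neg X i \<longrightarrow> neg X (Suc i)) \<and> \<not> pos Y i \<and>
        pos Y (Suc i) \<and> (neg Y i \<longleftrightarrow> neg X i) \<and> (neg Y (Suc i) \<longleftrightarrow> neg X (Suc i))"
      then show ?thesis unfolding r g both_def free_def
        by (cases "neg X i"; cases "neg X (Suc i)"; cases "gap n X (Suc i)") simp_all
    next
      assume "neg X (Suc i) \<and> \<not> neg X i \<and> (pos X i \<longrightarrow> pos X (Suc i)) \<and> neg Y i \<and>
        \<not> neg Y (Suc i) \<and> (pos Y i \<longleftrightarrow> pos X i) \<and> (pos Y (Suc i) \<longleftrightarrow> pos X (Suc i))"
      then show ?thesis unfolding r g both_def free_def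
        by (cases "pos X i"; cases "pos X (Suc i)"; cases "gap n X (Suc i)") simp_all
    qed
  qed
  have below: "gap n X p = gap n Y p" if "p < i" for p
    using that m assms(2) b(3) by (intro gap_below[OF gm]) auto
  show "matched n X p \<longleftrightarrow> matched n Y p" if "p \<noteq> i" "p \<noteq> Suc i" for p
    using below[of p] above[of p] b(3)[OF that] that
    by (cases "p < i") (auto simp: matched_def free_def same_def)
  show "matched n X i \<longleftrightarrow> matched n Y (Suc i)" if "free X i" "free Y (Suc i)"
    using that b(4) g above[of "Suc i"] by (auto simp: matched_def free_def both_def)
  show "matched n X (Suc i) \<longleftrightarrow> matched n Y i" if "free X (Suc i)" "free Y i"
    using that b(4) g above[of "Suc i"] by (auto simp: matched_def free_def both_def)
qed

text \<open>The tensor product rule for two columns, each reduced to the two bits that matter for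
  one index.\<close>

definition epsb :: "bool \<Rightarrow> bool \<Rightarrow> bool \<Rightarrow> bool \<Rightarrow> nat" where
  "epsb u u' v v' = (if \<not> u \<and> u' then 1 else 0) + ((if \<not> v \<and> v' then 1 else 0) - (if u \<and> \<not> u' then 1 else 0))"

definition phib :: "bool \<Rightarrow> bool \<Rightarrow> bool \<Rightarrow> bool \<Rightarrow> nat" where
  "phib u u' v v' = (if v \<and> \<not> v' then 1 else 0) + ((if u \<and> \<not> u' then 1 else 0) - (if \<not> v \<and> v' then 1 else 0))"

lemma tensor_pair:
  "teps ep ph [x, y] = ep x + (ep y - ph x)" "tphi ep ph [x, y] = ph y + (ph x - ep y)"
  by simp_all

lemma aligned_mk:
  assumes "0 < i" "i < n"
  shows "aligned n i [halves n A B, halves n A' B'] e p \<longleftrightarrow>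
    epsb (A i) (A (Suc i)) (A' i) (A' (Suc i)) = e \<and> phib (A i) (A (Suc i)) (A' i) (A' (Suc i)) = p \<and>
    epsb (B (Suc i)) (B i) (B' (Suc i)) (B' i) = e \<and> phib (B (Suc i)) (B i) (B' (Suc i)) (B' i) = p"
  using assms(2) by (simp only: aligned_def tensor_pair halves_ops[OF assms] epsb_def phib_def if_True)

text \<open>The bits \<open>a\<close>, \<open>b\<close>, \<open>c\<close>, \<open>d\<close> stand
  for the presence of \<open>i\<close>, \<open>i + 1\<close> and of the barred letters of
  \<open>i + 1\<close> and \<open>i\<close>, in column order; \<open>m\<close> and \<open>m'\<close>
  stand for a match at \<open>i\<close> and at \<open>i + 1\<close>. The premise collects the
  constraints of \<open>matched_bits\<close>, and what remains is a finite check.\<close>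

lemma aligned_bits:
  "(m \<longrightarrow> \<not> a \<and> \<not> d) \<and> (m' \<longrightarrow> \<not> b \<and> \<not> c) \<and> (\<not> a \<and> \<not> d \<and> b \<and> c \<longrightarrow> m) \<and>
    (m \<and> \<not> b \<and> \<not> c \<longrightarrow> m') \<longrightarrow>
    epsb a b (\<not> d) (\<not> c) =
      (if b \<and> \<not> a then 1 else 0) + (if d \<and> \<not> c \<and> (a \<longrightarrow> b) then 1 else 0) \<and>
    phib a b (\<not> d) (\<not> c) =
      (if a \<and> \<not> b \<and> (d \<longrightarrow> c) then 1 else 0) + (if c \<and> \<not> d then 1 else 0) \<and>
    epsb (c \<and> \<not> b \<or> m') (d \<and> \<not> a \<or> m) (\<not> (b \<and> \<not> c \<or> m')) (\<not> (a \<and> \<not> d \<or> m)) =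
      (if b \<and> \<not> a then 1 else 0) + (if d \<and> \<not> c \<and> (a \<longrightarrow> b) then 1 else 0) \<and>
    phib (c \<and> \<not> b \<or> m') (d \<and> \<not> a \<or> m) (\<not> (b \<and> \<not> c \<or> m')) (\<not> (a \<and> \<not> d \<or> m)) =
      (if a \<and> \<not> b \<and> (d \<longrightarrow> c) then 1 else 0) + (if c \<and> \<not> d then 1 else 0)"
  "(m \<longrightarrow> \<not> a \<and> \<not> d) \<and> (m' \<longrightarrow> \<not> b \<and> \<not> c) \<and> (\<not> a \<and> \<not> d \<and> b \<and> c \<longrightarrow> m) \<and>
    (m \<and> \<not> b \<and> \<not> c \<longrightarrow> m') \<longrightarrow>
    epsb (\<not> (d \<and> \<not> a \<or> m)) (\<not> (c \<and> \<not> b \<or> m')) (a \<and> \<not> d \<or> m) (b \<and> \<not> c \<or> m') =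
      (if b \<and> \<not> a then 1 else 0) + (if d \<and> \<not> c \<and> (a \<longrightarrow> b) then 1 else 0) \<and>
    phib (\<not> (d \<and> \<not> a \<or> m)) (\<not> (c \<and> \<not> b \<or> m')) (a \<and> \<not> d \<or> m) (b \<and> \<not> c \<or> m') =
      (if a \<and> \<not> b \<and> (d \<longrightarrow> c) then 1 else 0) + (if c \<and> \<not> d then 1 else 0) \<and>
    epsb (\<not> b) (\<not> a) c d =
      (if b \<and> \<not> a then 1 else 0) + (if d \<and> \<not> c \<and> (a \<longrightarrow> b) then 1 else 0) \<and>
    phib (\<not> b) (\<not> a) c d =
      (if a \<and> \<not> b \<and> (d \<longrightarrow> c) then 1 else 0) + (if c \<and> \<not> d then 1 else 0)"
  by (cases a; cases b; cases c; cases d; cases m; cases m'; simp add: epsb_def phib_def)+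

lemma aligned_columns:
  assumes "i \<in> {1..n}"
  shows "aligned n i [RA n X, LC n X] (ceps n i X) (cphi n i X)"
    "aligned n i [RC n X, LA n X] (ceps n i X) (cphi n i X)"
proof -
  have "aligned n i [RA n X, LC n X] (ceps n i X) (cphi n i X) \<and>
    aligned n i [RC n X, LA n X] (ceps n i X) (cphi n i X)"
  proof (cases "i < n")
    case True
    have i: "0 < i" using assms by simp
    have m: "(matched n X i \<longrightarrow> \<not> pos X i \<and> \<not> neg X i) \<and>
      (matched n X (Suc i) \<longrightarrow> \<not> pos X (Suc i) \<and> \<not> neg X (Suc i)) \<and>
      (\<not> pos X i \<and> \<not> neg X i \<and> pos X (Suc i) \<and> neg X (Suc i) \<longrightarrow> matched n X i) \<and>
      (matched n X i \<and> \<not> pos X (Suc i) \<and> \<not> neg X (Suc i) \<longrightarrow> matched n X (Suc i))"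
      using matched_bits[OF True, of X] unfolding free_def both_def by blast
    show ?thesis
      unfolding ceps_cphi_bits[OF i True] RA_def LC_def RC_def LA_def aligned_mk[OF i True]
      using aligned_bits(1)[THEN mp, OF m] aligned_bits(2)[THEN mp, OF m] by blast
  next
    case False
    then have i: "i = n" "0 < n" using assms by auto
    have "\<not> matched n X n" by (simp add: matched_def gap_ge)
    moreover have "ceps n n X = (if neg X n \<and> \<not> pos X n then 1 else 0)"
      "cphi n n X = (if pos X n \<and> \<not> neg X n then 1 else 0)"
      using column_local_last(1,2)[OF i(2), of X] by (simp_all add: pos_def neg_def)
    ultimately show ?thesis
      unfolding aligned_def i RA_def LC_def RC_def LA_def teps.simps tphi.simps
        halves_ops_last[OF i(2)]
      by (cases "pos X n"; cases "neg X n") simp_all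
  qed
  then show "aligned n i [RA n X, LC n X] (ceps n i X) (cphi n i X)"
    "aligned n i [RC n X, LA n X] (ceps n i X) (cphi n i X)" by auto
qed

text \<open>The first three patterns lower an unbarred letter, the last three a barred one. In each,
  the lines about \<open>matched\<close> tell whether a match passes between \<open>i\<close> and
  \<open>i + 1\<close>, appears, disappears or is absent.\<close>

lemma clow_cases:
  assumes "0 < i" "i < n" "X \<subseteq> letters n" "0 < cphi n i X"
  defines "Y \<equiv> clow n i X"
  obtains "pos X i" "\<not> neg X i" "\<not> pos X (Suc i)" "\<not> neg X (Suc i)"
      "\<not> pos Y i" "\<not> neg Y i" "pos Y (Suc i)" "\<not> neg Y (Suc i)"
      "matched n Y i \<longleftrightarrow> matched n X (Suc i)" "\<not> matched n X i" "\<not> matched n Y (Suc i)"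
    | "pos X i" "\<not> neg X i" "\<not> pos X (Suc i)" "neg X (Suc i)"
      "\<not> pos Y i" "\<not> neg Y i" "pos Y (Suc i)" "neg Y (Suc i)"
      "matched n Y i" "\<not> matched n X i" "\<not> matched n X (Suc i)" "\<not> matched n Y (Suc i)"
    | "pos X i" "neg X i" "\<not> pos X (Suc i)" "neg X (Suc i)"
      "\<not> pos Y i" "neg Y i" "pos Y (Suc i)" "neg Y (Suc i)"
      "\<not> matched n Y i" "\<not> matched n X i" "\<not> matched n X (Suc i)" "\<not> matched n Y (Suc i)"
    | "\<not> pos X i" "\<not> neg X i" "\<not> pos X (Suc i)" "neg X (Suc i)"
      "\<not> pos Y i" "neg Y i" "\<not> pos Y (Suc i)" "\<not> neg Y (Suc i)"
      "matched n Y (Suc i) \<longleftrightarrow> matched n X i" "\<not> matched n Y i" "\<not> matched n X (Suc i)"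
    | "\<not> pos X i" "\<not> neg X i" "pos X (Suc i)" "neg X (Suc i)"
      "\<not> pos Y i" "neg Y i" "pos Y (Suc i)" "\<not> neg Y (Suc i)"
      "matched n X i" "\<not> matched n Y i" "\<not> matched n X (Suc i)" "\<not> matched n Y (Suc i)"
    | "pos X i" "\<not> neg X i" "pos X (Suc i)" "neg X (Suc i)"
      "pos Y i" "neg Y i" "pos Y (Suc i)" "\<not> neg Y (Suc i)"
      "\<not> matched n Y i" "\<not> matched n X i" "\<not> matched n X (Suc i)" "\<not> matched n Y (Suc i)"
proof -
  note b = clow_bits(4)[OF assms(1-4), folded Y_def]
  note m = matched_bits[OF assms(2), of X, unfolded free_def both_def]
    matched_bits[OF assms(2), of Y, unfolded free_def both_def]
    matched_clow(2,3)[OF assms(1-4), folded Y_def, unfolded free_def both_def]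
  have bm: "\<not> matched n X i" if "pos X i \<or> neg X i" using m(1) that by blast
  have bm': "\<not> matched n X (Suc i)" if "pos X (Suc i) \<or> neg X (Suc i)" using m(2) that by blast
  have bn: "\<not> matched n Y i" if "pos Y i \<or> neg Y i" using m(5) that by blast
  have bn': "\<not> matched n Y (Suc i)" if "pos Y (Suc i) \<or> neg Y (Suc i)" using m(6) that by blast
  show ?thesis using b
  proof (elim disjE conjE)
    assume h: "pos X i" "\<not> pos X (Suc i)" "neg X i \<longrightarrow> neg X (Suc i)" "\<not> pos Y i"
      "pos Y (Suc i)" "neg Y i \<longleftrightarrow> neg X i" "neg Y (Suc i) \<longleftrightarrow> neg X (Suc i)"
    consider "\<not> neg X i" "\<not> neg X (Suc i)" | "\<not> neg X i" "neg X (Suc i)" | "neg X i" "neg X (Suc i)"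
      using h(3) by blast
    then show ?thesis
    proof cases
      case 1
      have "matched n Y i \<longleftrightarrow> matched n X (Suc i)" using m(10) h 1 by blast
      then show ?thesis using that(1) h 1 bm bn' by blast
    next
      case 2
      have "matched n Y i" using m(7) h 2 by blast
      then show ?thesis using that(2) h 2 bm bm' bn' by blast
    next
      case 3
      then show ?thesis using that(3) h bm bm' bn bn' by blast
    qed
  next
    assume h: "neg X (Suc i)" "\<not> neg X i" "pos X i \<longrightarrow> pos X (Suc i)" "neg Y i"
      "\<not> neg Y (Suc i)" "pos Y i \<longleftrightarrow> pos X i" "pos Y (Suc i) \<longleftrightarrow> pos X (Suc i)"
    consider "\<not> pos X i" "\<not> pos X (Suc i)" | "\<not> pos X i" "pos X (Suc i)" | "pos X i" "pos X (Suc i)"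
      using h(3) by blast
    then show ?thesis
    proof cases
      case 1
      have "matched n Y (Suc i) \<longleftrightarrow> matched n X i" using m(9) h 1 by blast
      then show ?thesis using that(4) h 1 bm' bn by blast
    next
      case 2
      have "matched n X i" using m(3) h 2 by blast
      then show ?thesis using that(5) h 2 bm' bn bn' by blast
    next
      case 3
      then show ?thesis using that(6) h bm bm' bn bn' by blast
    qed
  qed
qed

lemma virtual_low:
  assumes "0 < i" "i < n" "X \<subseteq> letters n" "0 < cphi n i X"
  shows "[RA n (clow n i X), LC n (clow n i X)] = vlow n i [RA n X, LC n X]"
    "[RC n (clow n i X), LA n (clow n i X)] = vlow n i [RC n X, LA n X]"
proof -
  define Y where "Y = clow n i X"
  have o: "(pos Y p \<longleftrightarrow> pos X p) \<and> (neg Y p \<longleftrightarrow> neg X p) \<and> (matched n Y p \<longleftrightarrow> matched n X p)"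
    if "p \<noteq> i" "p \<noteq> Suc i" for p
    using clow_bits(3)[OF assms that] matched_clow(1)[OF assms that] unfolding Y_def same_def by simp
  note simps = RA_def LC_def RC_def LA_def vlow_def assms(2) halves_ops[OF assms(1,2)]
  have mkI: "halves n A B = halves n A' B'" if "A i = A' i" "A (Suc i) = A' (Suc i)" "B i = B' i"
    "B (Suc i) = B' (Suc i)" "\<And>p. p \<noteq> i \<Longrightarrow> p \<noteq> Suc i \<Longrightarrow> A p = A' p \<and> B p = B' p" for A B A' B'
    by (rule halves_cong) (use that in metis)
  have "[RA n Y, LC n Y] = vlow n i [RA n X, LC n X] \<and> [RC n Y, LA n Y] = vlow n i [RC n X, LA n X]"
    using assms
  proof (cases rule: clow_cases)
    case 1
    note c = 1[folded Y_def]
    show ?thesis using c by (simp add: simps; intro conjI impI mkI; simp add: o)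
  next
    case 2
    note c = 2[folded Y_def]
    show ?thesis using c by (simp add: simps; intro conjI impI mkI; simp add: o)
  next
    case 3
    note c = 3[folded Y_def]
    show ?thesis using c by (simp add: simps; intro conjI impI mkI; simp add: o)
  next
    case 4
    note c = 4[folded Y_def]
    show ?thesis using c by (simp add: simps; intro conjI impI mkI; simp add: o)
  next
    case 5
    note c = 5[folded Y_def]
    show ?thesis using c by (simp add: simps; intro conjI impI mkI; simp add: o)
  next
    case 6
    note c = 6[folded Y_def]
    show ?thesis using c by (simp add: simps; intro conjI impI mkI; simp add: o)
  qed
  then show "[RA n (clow n i X), LC n (clow n i X)] = vlow n i [RA n X, LC n X]"
    "[RC n (clow n i X), LA n (clow n i X)] = vlow n i [RC n X, LA n X]"
    by (simp_all add: Y_def)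
qed

lemma matched_last: "0 < n \<Longrightarrow> \<not> matched n X n"
  by (simp add: matched_def gap_ge)

text \<open>Before and after the operator exactly one of the two letters of absolute value
  \<open>n\<close> is present, so the scan passes \<open>n\<close> without any effect on
  \<open>gap\<close>.\<close>

lemma matched_clow_last:
  assumes "0 < n" "X \<subseteq> letters n" "0 < cphi n n X"
  shows "matched n (clow n n X) p \<longleftrightarrow> matched n X p"
proof -
  note b = clow_bits_last[OF assms]
  obtain m where m: "n = Suc m" using assms(1) by (cases n) auto
  have gm: "gap n X m = gap n (clow n n X) m"
    using b(4) unfolding m by (simp add: gap_rec gap_ge both_def free_def)
  have "gap n X p = gap n (clow n n X) p"
  proof (cases "p \<le> m")
    case True
    then show ?thesis using b(3) m by (intro gap_below[OF gm]) auto
  qed (simp add: gap_ge m)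
  moreover have "free X p \<longleftrightarrow> free (clow n n X) p"
    using b(3)[of p] b(4) by (cases "p = n") (auto simp: free_def same_def)
  ultimately show ?thesis by (simp add: matched_def)
qed

lemma virtual_low_last:
  assumes "0 < n" "X \<subseteq> letters n" "0 < cphi n n X"
  shows "[RA n (clow n n X), LC n (clow n n X)] = vlow n n [RA n X, LC n X]"
    "[RC n (clow n n X), LA n (clow n n X)] = vlow n n [RC n X, LA n X]"
proof -
  define Y where "Y = clow n n X"
  note b = clow_bits_last(4)[OF assms, folded Y_def] matched_last[OF assms(1), of X]
  have m: "matched n Y p \<longleftrightarrow> matched n X p" for p
    using matched_clow_last[OF assms] by (simp add: Y_def)
  have o: "(pos Y p \<longleftrightarrow> pos X p) \<and> (neg Y p \<longleftrightarrow> neg X p)" if "p \<noteq> n" for p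
    using clow_bits_last(3)[OF assms that] unfolding Y_def same_def by simp
  have mkI: "halves n A B = halves n A' B'" if "A n = A' n" "B n = B' n"
    "\<And>p. p \<noteq> n \<Longrightarrow> A p = A' p \<and> B p = B' p" for A B A' B'
    by (rule halves_cong) (use that in metis)
  have "[RA n Y, LC n Y] = vlow n n [RA n X, LC n X]"
    using b by (simp add: RA_def LC_def vlow_def halves_ops_last[OF assms(1)] m;
        intro conjI impI mkI; simp add: o)
  moreover have "[RC n Y, LA n Y] = vlow n n [RC n X, LA n X]"
    using b by (simp add: RC_def LA_def vlow_def halves_ops_last[OF assms(1)] m;
        intro conjI impI mkI; simp add: o)
  ultimately show "[RA n (clow n n X), LC n (clow n n X)] = vlow n n [RA n X, LC n X]"
    "[RC n (clow n n X), LA n (clow n n X)] = vlow n n [RC n X, LA n X]"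
    by (simp_all add: Y_def)
qed

lemma virtual_columns:
  "virtual n (\<lambda>X. [RA n X, LC n X])" "virtual n (\<lambda>X. [RC n X, LA n X])"
proof -
  have "aligned n i [RA n X, LC n X] (ceps n i X) (cphi n i X) \<and>
      aligned n i [RC n X, LA n X] (ceps n i X) (cphi n i X) \<and>
      (0 < cphi n i X \<longrightarrow> [RA n (clow n i X), LC n (clow n i X)] = vlow n i [RA n X, LC n X] \<and>
        [RC n (clow n i X), LA n (clow n i X)] = vlow n i [RC n X, LA n X])"
    if "adm n X" "i \<in> {1..n}" for X i
  proof -
    have X: "X \<subseteq> letters n" using that(1) by (simp add: adm_def)
    show ?thesis
    proof (cases "i < n")
      case True
      then show ?thesis using aligned_columns[OF that(2), of X] virtual_low[OF _ True X] that(2) by auto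
    next
      case False
      then have "i = n" "0 < n" using that(2) by auto
      then show ?thesis using aligned_columns[OF that(2), of X] virtual_low_last[OF _ X] by auto
    qed
  qed
  then show "virtual n (\<lambda>X. [RA n X, LC n X])" "virtual n (\<lambda>X. [RC n X, LA n X])"
    unfolding virtual_def by blast+
qed

lemma colw_clow:
  assumes "X \<subseteq> letters n" "i \<in> {1..n}" "0 < cphi n i X"
  shows "colw n (clow n i X) = wlow n i (colw n X)" "clow n i X \<subseteq> letters n"
proof -
  have "colw n (clow n i X) = wlow n i (colw n X) \<and> clow n i X \<subseteq> letters n"
  proof (cases "i < n")
    case True
    then show ?thesis using clow_bits(1,2)[OF _ True assms(1,3)] assms(2) by auto
  next
    case False
    then have "i = n" "0 < n" using assms(2) by auto
    then show ?thesis using clow_bits_last(1,2)[OF _ assms(1)] assms(3) by auto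
  qed
  then show "colw n (clow n i X) = wlow n i (colw n X)" "clow n i X \<subseteq> letters n" by auto
qed

lemma colw_crai:
  assumes "X \<subseteq> letters n" "i \<in> {1..n}" "0 < ceps n i X"
  shows "colw n (crai n i X) = wrai n i (colw n X)" "crai n i X \<subseteq> letters n"
proof -
  have "\<exists>Y\<subseteq>letters n. wrai n i (colw n X) = colw n Y"
  proof (cases "i < n")
    case True
    have i: "0 < i" using assms(2) by simp
    note l = letters_simps(1)[OF i True]
    have "int i + 1 \<in> X \<and> int i \<notin> X \<and> (- int i \<in> X \<longrightarrow> - int i - 1 \<in> X) \<or>
        - int i \<in> X \<and> - int i - 1 \<notin> X \<and> (int i \<in> X \<longrightarrow> int i + 1 \<in> X)"
      using assms(3) unfolding column_local(1)[OF i True] by (auto split: if_splits)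
    then show ?thesis
    proof
      assume "int i + 1 \<in> X \<and> int i \<notin> X \<and> (- int i \<in> X \<longrightarrow> - int i - 1 \<in> X)"
      from column_local(5)[OF i True this] show ?thesis
        using l assms(1) by (intro exI[of _ "insert (int i) (X - {int i + 1})"]) auto
    next
      assume "- int i \<in> X \<and> - int i - 1 \<notin> X \<and> (int i \<in> X \<longrightarrow> int i + 1 \<in> X)"
      from column_local(6)[OF i True this] show ?thesis
        using l assms(1) by (intro exI[of _ "insert (- int i - 1) (X - {- int i})"]) auto
    qed
  next
    case False
    then have i: "i = n" "0 < n" using assms(2) by auto
    have "- int n \<in> X \<and> int n \<notin> X"
      using assms(3) unfolding i column_local_last(1)[OF i(2)] by (auto split: if_splits)
    from column_local_last(4)[OF i(2) this] show ?thesis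
      using letters_simps(2)[OF i(2)] assms(1) unfolding i
      by (intro exI[of _ "insert (int n) (X - {- int n})"]) auto
  qed
  then obtain Y where Y: "Y \<subseteq> letters n" "wrai n i (colw n X) = colw n Y" by blast
  then have "crai n i X = Y" by (simp add: crai_def set_colw)
  then show "colw n (crai n i X) = wrai n i (colw n X)" "crai n i X \<subseteq> letters n"
    using Y by simp_all
qed

section \<open>Admissible columns form a crystal\<close>

lemma word_law:
  assumes "i \<in> {1..n}"
  shows "0 < wphi n i w \<Longrightarrow> weps n i (wlow n i w) = Suc (weps n i w) \<and>
      wphi n i w = Suc (wphi n i (wlow n i w)) \<and> wrai n i (wlow n i w) = w"
    "0 < weps n i w \<Longrightarrow> wphi n i (wrai n i w) = Suc (wphi n i w) \<and>
      weps n i w = Suc (weps n i (wrai n i w)) \<and> wlow n i (wrai n i w) = w"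
  using tensor_low[OF crystal_law_letters[OF assms], of w]
    tensor_rai[OF crystal_law_letters[OF assms], of w] by (auto simp: list_all_iff)

lemma crystal_law_columns:
  assumes i: "i \<in> {1..n}"
  shows "crystal_law (adm n) (ceps n i) (cphi n i) (clow n i) (crai n i)"
  unfolding crystal_law_def
proof (intro allI impI conjI)
  fix X assume X: "adm n X"
  then have s: "X \<subseteq> letters n" by (simp add: adm_def)
  { assume p: "0 < cphi n i X"
    note c = colw_clow[OF s i p] and w = word_law(1)[OF i p[unfolded cphi_def]]
    show "adm n (clow n i X)" using adm_clow[OF s i p] X by simp
    show "ceps n i (clow n i X) = Suc (ceps n i X)" "cphi n i X = Suc (cphi n i (clow n i X))"
      using w unfolding ceps_def cphi_def c by auto
    show "crai n i (clow n i X) = X" using w unfolding crai_def c by (simp add: set_colw[OF s]) }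
  { assume p: "0 < ceps n i X"
    note c = colw_crai[OF s i p] and w = word_law(2)[OF i p[unfolded ceps_def]]
    show ph: "cphi n i (crai n i X) = Suc (cphi n i X)" "ceps n i X = Suc (ceps n i (crai n i X))"
      using w unfolding ceps_def cphi_def c by auto
    show l: "clow n i (crai n i X) = X" using w unfolding clow_def c by (simp add: set_colw[OF s])
    show "adm n (crai n i X)" using adm_clow[OF c(2) i] X ph(1) l by simp }
qed

lemma card_clow:
  assumes "X \<subseteq> letters n" "i \<in> {1..n}" "0 < cphi n i X"
  shows "card (clow n i X) = card X"
  using colw_clow[OF assms] length_colw[OF assms(1)] length_colw[of "clow n i X" n] by simp

lemma card_crai:
  assumes "X \<subseteq> letters n" "i \<in> {1..n}" "0 < ceps n i X"
  shows "card (crai n i X) = card X"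
  using colw_crai[OF assms] length_colw[OF assms(1)] length_colw[of "crai n i X" n] by simp

lemma virtual_rai:
  assumes "virtual n v" "adm n X" "i \<in> {1..n}" "0 < ceps n i X"
  shows "v (crai n i X) = vrai n i (v X)"
proof -
  note l = crystal_law_rai[OF crystal_law_columns[OF assms(3)] assms(2,4)]
  have "aligned n i (v (crai n i X)) (ceps n i (crai n i X)) (cphi n i (crai n i X))"
    "v X = vlow n i (v (crai n i X))"
    using assms(1,3) l unfolding virtual_def by (metis zero_less_Suc)+
  then show ?thesis using vrai_vlow[OF assms(3)] l(2) by simp
qed

section \<open>Lists of columns\<close>

abbreviation Ceps where "Ceps n i \<equiv> teps (ceps n i) (cphi n i)"
abbreviation Cphi where "Cphi n i \<equiv> tphi (ceps n i) (cphi n i)"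
abbreviation Clow where "Clow n i \<equiv> tlow (ceps n i) (cphi n i) (clow n i)"
abbreviation Crai where "Crai n i \<equiv> trai (ceps n i) (cphi n i) (crai n i)"
abbreviation "adms n \<equiv> list_all (adm n)"

definition colsw :: "nat \<Rightarrow> int set list \<Rightarrow> int list" where
  "colsw n Xs = concat (map (colw n) Xs)"

definition colsA :: "nat \<Rightarrow> int set list \<Rightarrow> nat set list" where
  "colsA n Xs = concat (map (\<lambda>X. [RA n X, LC n X]) Xs)"

lemma colsw_simps [simp]: "colsw n [] = []" "colsw n (X # Xs) = colw n X @ colsw n Xs"
  by (simp_all add: colsw_def)

lemma colsA_simps [simp]: "colsA n [] = []" "colsA n (X # Xs) = [RA n X, LC n X] @ colsA n Xs"
  by (simp_all add: colsA_def)

lemma colsw_eps_phi: "weps n i (colsw n Xs) = Ceps n i Xs \<and> wphi n i (colsw n Xs) = Cphi n i Xs"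
  by (induction Xs) (auto simp: teps_append tphi_append ceps_def cphi_def)

lemma colsw_low:
  assumes "adms n Xs" "i \<in> {1..n}" "0 < Cphi n i Xs"
  shows "colsw n (Clow n i Xs) = wlow n i (colsw n Xs)"
  using assms(1,3)
proof (induction Xs)
  case (Cons X Xs)
  have X: "X \<subseteq> letters n" using Cons.prems by (simp add: adm_def)
  show ?case
  proof (cases "Ceps n i Xs < cphi n i X")
    case True
    then have "0 < cphi n i X" by simp
    from colw_clow(1)[OF X assms(2) this] True show ?thesis
      using colsw_eps_phi[of n i Xs] by (simp add: tlow_append cphi_def[symmetric])
  next
    case False
    then show ?thesis using Cons colsw_eps_phi[of n i Xs] by (simp add: tlow_append cphi_def[symmetric])
  qed
qed simp

lemma Clow_law:
  assumes "adms n Xs" "i \<in> {1..n}" "0 < Cphi n i Xs"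
  shows "adms n (Clow n i Xs)" "Ceps n i (Clow n i Xs) = Suc (Ceps n i Xs)"
    "Cphi n i Xs = Suc (Cphi n i (Clow n i Xs))" "Crai n i (Clow n i Xs) = Xs"
  using tensor_low[OF crystal_law_columns[OF assms(2)] assms(1,3)] by auto

lemma Crai_law:
  assumes "adms n Xs" "i \<in> {1..n}" "0 < Ceps n i Xs"
  shows "adms n (Crai n i Xs)" "Cphi n i (Crai n i Xs) = Suc (Cphi n i Xs)"
    "Ceps n i Xs = Suc (Ceps n i (Crai n i Xs))" "Clow n i (Crai n i Xs) = Xs"
  using tensor_rai[OF crystal_law_columns[OF assms(2)] assms(1,3)] by auto

lemma colsw_rai:
  assumes "adms n Xs" "i \<in> {1..n}" "0 < Ceps n i Xs"
  shows "colsw n (Crai n i Xs) = wrai n i (colsw n Xs)"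
proof -
  note l = Crai_law[OF assms]
  have p: "0 < Cphi n i (Crai n i Xs)" using l(2) by simp
  have "colsw n Xs = wlow n i (colsw n (Crai n i Xs))"
    using colsw_low[OF l(1) assms(2) p] l(4) by simp
  then show ?thesis
    using word_law(1)[OF assms(2), of "colsw n (Crai n i Xs)"] p colsw_eps_phi[of n i "Crai n i Xs"]
    by simp
qed

lemma colsA_aligned:
  assumes "adms n Xs" "i \<in> {1..n}"
  shows "aligned n i (colsA n Xs) (Ceps n i Xs) (Cphi n i Xs)"
  using assms(1)
proof (induction Xs)
  case Nil
  then show ?case by (simp add: aligned_def)
next
  case (Cons X Xs)
  then show ?case using aligned_append[OF aligned_columns(1)[OF assms(2), of X]] by simp
qed

lemma colsA_low:
  assumes "adms n Xs" "i \<in> {1..n}" "0 < Cphi n i Xs"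
  shows "colsA n (Clow n i Xs) = vlow n i (colsA n Xs)"
  using assms(1,3)
proof (induction Xs)
  case (Cons X Xs)
  have a: "adm n X" "adms n Xs" using Cons.prems by auto
  have p: "0 < Cphi n i Xs + (cphi n i X - Ceps n i Xs)" using Cons.prems by simp
  note v = vlow_append[OF assms(2) aligned_columns(1)[OF assms(2), of X] colsA_aligned[OF a(2) assms(2)] p]
  show ?case
  proof (cases "Ceps n i Xs < cphi n i X")
    case True
    then have "[RA n (clow n i X), LC n (clow n i X)] = vlow n i [RA n X, LC n X]"
      using virtual_columns(1)[of n] a(1) assms(2) unfolding virtual_def by auto
    then show ?thesis using v True by simp
  next
    case False
    then show ?thesis using v Cons p by simp
  qed
qed simp

lemma colsA_rai:
  assumes "adms n Xs" "i \<in> {1..n}" "0 < Ceps n i Xs"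
  shows "colsA n (Crai n i Xs) = vrai n i (colsA n Xs)"
proof -
  note l = Crai_law[OF assms]
  have p: "0 < Cphi n i (Crai n i Xs)" using l(2) by simp
  have "colsA n Xs = vlow n i (colsA n (Crai n i Xs))"
    using colsA_low[OF l(1) assms(2) p] l(4) by simp
  then show ?thesis using vrai_vlow[OF assms(2) colsA_aligned[OF l(1) assms(2)] p] by simp
qed

lemma card_Clow:
  assumes "adms n Xs" "i \<in> {1..n}"
  shows "map card (Clow n i Xs) = map card Xs"
  by (rule tlow_map_inv) (use assms card_clow in \<open>auto simp: list_all_iff adm_def\<close>)

lemma card_Crai:
  assumes "adms n Xs" "i \<in> {1..n}" "0 < Ceps n i Xs"
  shows "map card (Crai n i Xs) = map card Xs"
  by (rule trai_map_inv) (use assms card_crai in \<open>auto simp: list_all_iff adm_def\<close>)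

section \<open>Injectivity of the virtualization and transfer of isomorphisms from type A to type
  C\<close>

lemma pos_neg_ext:
  assumes "X \<subseteq> letters n" "Y \<subseteq> letters n" "\<And>p. 0 < p \<Longrightarrow> p \<le> n \<Longrightarrow> same X Y p"
  shows "X = Y"
proof -
  have "x \<in> X \<longleftrightarrow> x \<in> Y" if "x \<in> letters n" for x
  proof -
    have "0 < nat \<bar>x\<bar>" "nat \<bar>x\<bar> \<le> n" using that by (auto simp: letters_def)
    from assms(3)[OF this] show ?thesis by (cases "0 \<le> x") (auto simp: same_def pos_def neg_def)
  qed
  then show ?thesis using assms(1,2) by blast
qed

text \<open>The lower half of \<open>RA\<close> shows the unbarred letters of the column, and the
  lower half of \<open>LC\<close> is the complement of its barred ones.\<close>

lemma RA_LC_inj: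
  assumes "X \<subseteq> letters n" "Y \<subseteq> letters n" "RA n X = RA n Y" "LC n X = LC n Y"
  shows "X = Y"
proof (rule pos_neg_ext[OF assms(1,2)])
  fix p assume "0 < p" "p \<le> n"
  then show "same X Y p"
    using halves_inj[OF assms(3)[unfolded RA_def], of p] halves_inj[OF assms(4)[unfolded LC_def], of p]
    by (simp add: same_def)
qed

lemma colsA_inj:
  assumes "adms n Xs" "adms n Ys" "colsA n Xs = colsA n Ys"
  shows "Xs = Ys"
  using assms
proof (induction Xs arbitrary: Ys)
  case Nil
  then show ?case by (cases Ys) auto
next
  case (Cons X Xs)
  then obtain Y Zs where Ys: "Ys = Y # Zs" by (cases Ys) auto
  then have "X = Y" using RA_LC_inj[of X n Y] Cons.prems by (auto simp: adm_def)
  then show ?case using Ys Cons.prems Cons.IH[of Zs] by simp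
qed

lemma colsw_inj:
  assumes "adms n Xs" "adms n Ys" "map card Xs = map card Ys" "colsw n Xs = colsw n Ys"
  shows "Xs = Ys"
  using assms
proof (induction Xs arbitrary: Ys)
  case (Cons X Xs)
  then obtain Y Zs where Ys: "Ys = Y # Zs" by (cases Ys) auto
  have s: "X \<subseteq> letters n" "Y \<subseteq> letters n" "card X = card Y" using Cons.prems Ys by (auto simp: adm_def)
  then have "length (colw n X) = length (colw n Y)" by (simp add: length_colw)
  then have e: "colw n X = colw n Y" "colsw n Xs = colsw n Zs" using Cons.prems(4) Ys by auto
  then have "X = Y" using s set_colw by metis
  then show ?case using Ys Cons e by simp
qed simp

text \<open>Words are related through the lists of columns that they spell. The lengths of the
  columns belong to the relation, because a word alone does not determine where it is cut.\<close>

lemma word_iso_colsw: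
  assumes "adms n Xs" "adms n Ys" "aiso0 (2 * n) (colsA n Xs) (colsA n Ys)"
  shows "word_iso n (colsw n Xs) (colsw n Ys)"
proof -
  obtain R where R: "bisimulation {1..<2 * n} Aeps Aphi Alow Arai R" "bi_unique R"
    "R (colsA n Xs) (colsA n Ys)"
    using assms(3) unfolding aiso_def by blast
  define Q where "Q u u' \<longleftrightarrow> (\<exists>As Bs. u = colsw n As \<and> u' = colsw n Bs \<and> adms n As \<and> adms n Bs \<and>
    map card As = map card Xs \<and> map card Bs = map card Ys \<and> R (colsA n As) (colsA n Bs))" for u u'
  have "bi_unique Q"
    unfolding bi_unique_def
  proof (intro conjI allI impI)
    fix u u' v assume "Q u v" "Q u' v"
    then obtain As Bs As' Bs' where q: "u = colsw n As" "v = colsw n Bs" "adms n As" "adms n Bs"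
      "map card As = map card Xs" "map card Bs = map card Ys" "R (colsA n As) (colsA n Bs)"
      "u' = colsw n As'" "v = colsw n Bs'" "adms n As'" "adms n Bs'"
      "map card As' = map card Xs" "map card Bs' = map card Ys" "R (colsA n As') (colsA n Bs')"
      unfolding Q_def by blast
    then have "Bs = Bs'" using colsw_inj[of n Bs Bs'] by simp
    then have "colsA n As = colsA n As'" using q bi_uniqueDl[OF R(2)] by blast
    then show "u = u'" using q colsA_inj by metis
  next
    fix u v v' assume "Q u v" "Q u v'"
    then obtain As Bs As' Bs' where q: "u = colsw n As" "v = colsw n Bs" "adms n As" "adms n Bs"
      "map card As = map card Xs" "map card Bs = map card Ys" "R (colsA n As) (colsA n Bs)"
      "u = colsw n As'" "v' = colsw n Bs'" "adms n As'" "adms n Bs'"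
      "map card As' = map card Xs" "map card Bs' = map card Ys" "R (colsA n As') (colsA n Bs')"
      unfolding Q_def by blast
    then have "As = As'" using colsw_inj[of n As As'] by simp
    then have "colsA n Bs = colsA n Bs'" using q bi_uniqueDr[OF R(2)] by blast
    then show "v = v'" using q colsA_inj by metis
  qed
  moreover have "bisimulation {1..n} (weps n) (wphi n) (wlow n) (wrai n) Q"
    unfolding bisimulation_def
  proof (intro allI impI ballI)
    fix u u' i assume "Q u u'" and i: "i \<in> {1..n}"
    then obtain As Bs where q: "u = colsw n As" "u' = colsw n Bs" "adms n As" "adms n Bs"
      "map card As = map card Xs" "map card Bs = map card Ys" "R (colsA n As) (colsA n Bs)"
      unfolding Q_def by blast
    note al = colsA_aligned[OF q(3) i] colsA_aligned[OF q(4) i]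
    note b = bisimulation_virtual[OF R(1) q(7) i al(1)]
    have e: "Ceps n i As = Ceps n i Bs" "Cphi n i As = Cphi n i Bs"
      using b(1) al(2) by (auto simp: aligned_def split: if_splits)
    note ep = colsw_eps_phi[of n i As] colsw_eps_phi[of n i Bs]
    have "Q (wlow n i u) (wlow n i u')" if p: "0 < Cphi n i As"
      unfolding Q_def
      using colsw_low[OF q(3) i p] colsw_low[OF q(4) i] Clow_law(1)[OF q(3) i p] Clow_law(1)[OF q(4) i]
        card_Clow[OF q(3) i] card_Clow[OF q(4) i] b(2)[OF p] colsA_low[OF q(3) i p] colsA_low[OF q(4) i]
        p e q
      by (intro exI[of _ "Clow n i As"] exI[of _ "Clow n i Bs"]) simp
    moreover have "Q (wrai n i u) (wrai n i u')" if p: "0 < Ceps n i As"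
      unfolding Q_def
      using colsw_rai[OF q(3) i p] colsw_rai[OF q(4) i] Crai_law(1)[OF q(3) i p] Crai_law(1)[OF q(4) i]
        card_Crai[OF q(3) i p] card_Crai[OF q(4) i] b(3)[OF p] colsA_rai[OF q(3) i p] colsA_rai[OF q(4) i]
        p e q
      by (intro exI[of _ "Crai n i As"] exI[of _ "Crai n i Bs"]) simp
    ultimately show "weps n i u = weps n i u' \<and> wphi n i u = wphi n i u' \<and>
      (0 < wphi n i u \<longrightarrow> Q (wlow n i u) (wlow n i u')) \<and>
      (0 < weps n i u \<longrightarrow> Q (wrai n i u) (wrai n i u'))"
      using e ep q(1,2) by simp
  qed
  moreover have "Q (colsw n Xs) (colsw n Ys)" unfolding Q_def using assms R(3) by blast
  ultimately show ?thesis using word_iso_if_bisimulation by blast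
qed

section \<open>Highest weight lists of columns\<close>

definition hcol :: "nat \<Rightarrow> int set" where
  "hcol k = {1..int k}"

lemma hcol_bits: "0 < p \<Longrightarrow> pos (hcol k) p \<longleftrightarrow> p \<le> k" "0 < p \<Longrightarrow> \<not> neg (hcol k) p"
  by (auto simp: hcol_def pos_def neg_def)

lemma card_hcol [simp]: "card (hcol k) = k"
  by (simp add: hcol_def)

lemma gap_no_both:
  assumes "\<And>q. 0 < q \<Longrightarrow> q \<le> n \<Longrightarrow> \<not> both X q"
  shows "gap n X p = 0"
proof (cases "n \<le> p")
  case False
  then have "p \<le> n" by simp
  then show ?thesis
  proof (induction p rule: inc_induct)
    case (step m)
    then show ?case using assms[of "Suc m"] by (simp add: gap_rec)
  qed (simp add: gap_ge)
qed (simp add: gap_ge)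

lemma matched_no_both:
  "(\<And>q. 0 < q \<Longrightarrow> q \<le> n \<Longrightarrow> \<not> both X q) \<Longrightarrow> \<not> matched n X p"
  by (simp add: matched_def gap_no_both)

lemma matched_hcol: "\<not> matched n (hcol k) p"
  by (rule matched_no_both) (simp add: both_def hcol_bits)

lemma hcol_letters: "k \<le> n \<Longrightarrow> hcol k \<subseteq> letters n"
  by (auto simp: hcol_def letters_def)

lemma adm_hcol: "k \<le> n \<Longrightarrow> adm n (hcol k)"
proof -
  assume k: "k \<le> n"
  have "hgt (hcol k) p \<le> p" for p
    by (induction p) (auto simp: hcol_bits)
  then show ?thesis using hcol_letters[OF k] by (simp add: adm_def)
qed

lemma RA_hcol: "k \<le> n \<Longrightarrow> RA n (hcol k) = ivl k"
  and LA_hcol: "k \<le> n \<Longrightarrow> LA n (hcol k) = ivl k"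
  and LC_hcol: "k \<le> n \<Longrightarrow> LC n (hcol k) = ivl (2 * n - k)"
  unfolding RA_def LA_def LC_def
  by (rule halves_eqI[symmetric]; auto simp: ivl_def hcol_bits matched_hcol)+

lemma ceps_cphi_hcol:
  assumes "i \<in> {1..n}" "k \<le> n"
  shows "ceps n i (hcol k) = 0" "cphi n i (hcol k) = (if k = i then 1 else 0)"
proof -
  have "ceps n i (hcol k) = 0 \<and> cphi n i (hcol k) = (if k = i then 1 else 0)"
  proof (cases "i < n")
    case True
    then show ?thesis using assms by (simp add: ceps_cphi_bits hcol_bits)
  next
    case False
    then have "i = n" "0 < n" "k \<le> n" using assms by auto
    then show ?thesis using column_local_last(1,2)[of n "hcol k"] by (auto simp: hcol_def)
  qed
  then show "ceps n i (hcol k) = 0" "cphi n i (hcol k) = (if k = i then 1 else 0)" by auto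
qed

lemma Ceps_Cphi_hcol:
  assumes "i \<in> {1..n}" "\<forall>k\<in>set ks. k \<le> n"
  shows "Ceps n i (map hcol ks) = 0" "Cphi n i (map hcol ks) = count_list ks i"
  using assms by (induction ks) (auto simp: ceps_cphi_hcol)

lemma adms_hcol: "\<forall>k\<in>set ks. k \<le> n \<Longrightarrow> adms n (map hcol ks)"
  by (auto simp: list_all_iff adm_hcol)

text \<open>The lengths of the intervals to which the columns \<open>hcol k\<close> are sent; see
  \<open>colsA_hcol\<close>.\<close>

definition dbl :: "nat \<Rightarrow> nat list \<Rightarrow> nat list" where
  "dbl n ks = concat (map (\<lambda>k. [k, 2 * n - k]) ks)"

lemma dbl_simps [simp]: "dbl n [] = []" "dbl n (k # ks) = k # (2 * n - k) # dbl n ks"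
  by (simp_all add: dbl_def)

lemma colsA_hcol: "\<forall>k\<in>set ks. k \<le> n \<Longrightarrow> colsA n (map hcol ks) = map ivl (dbl n ks)"
  by (induction ks) (auto simp: RA_hcol LC_hcol)

lemma colsA_sub: "\<forall>U\<in>set (colsA n Xs). U \<subseteq> {1..2 * n}"
  using halves_subset by (induction Xs) (auto simp: RA_def LC_def)

definition highest :: "nat \<Rightarrow> int set list \<Rightarrow> bool" where
  "highest n Xs \<longleftrightarrow> (\<forall>i\<in>{1..n}. Ceps n i Xs = 0)"

text \<open>The folding of the type A indices onto the type C indices.\<close>

lemma index_cases:
  fixes n j :: nat
  assumes "j \<in> {1..<2 * n}"
  obtains i where "i \<in> {1..n}" "i < n" "j = i \<or> j = 2 * n - i" | "j = n" "n \<in> {1..n}"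
proof -
  consider "j < n" | "j = n" | "n < j" by linarith
  then show ?thesis
  proof cases
    case 1
    then show ?thesis using that(1)[of j] assms by auto
  next
    case 2
    then show ?thesis using that(2) assms by auto
  next
    case 3
    then show ?thesis using that(1)[of "2 * n - j"] assms by auto
  qed
qed

lemma highest_colsA:
  assumes "adms n Xs" "highest n Xs" "j \<in> {1..<2 * n}"
  shows "Aeps j (colsA n Xs) = 0"
  using assms(3)
proof (cases rule: index_cases)
  case (1 i)
  then show ?thesis using colsA_aligned[OF assms(1) 1(1)] assms(2)
    by (auto simp: aligned_def highest_def)
next
  case 2
  then show ?thesis using colsA_aligned[OF assms(1) 2(2)] assms(2)
    by (auto simp: aligned_def highest_def)
qed

lemma colsA_Aphi_eq:
  assumes "adms n Xs" "adms n Ys" "\<forall>i\<in>{1..n}. Cphi n i Xs = Cphi n i Ys" "j \<in> {1..<2 * n}"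
  shows "Aphi j (colsA n Xs) = Aphi j (colsA n Ys)"
  using assms(4)
proof (cases rule: index_cases)
  case (1 i)
  then show ?thesis
    using colsA_aligned[OF assms(1) 1(1)] colsA_aligned[OF assms(2) 1(1)] assms(3)
    by (auto simp: aligned_def)
next
  case 2
  then show ?thesis
    using colsA_aligned[OF assms(1) 2(2)] colsA_aligned[OF assms(2) 2(2)] assms(3)
    by (auto simp: aligned_def)
qed

lemma highest_word_iso:
  assumes "0 < n" "adms n Xs" "highest n Xs" "adms n Ys" "highest n Ys"
    and "\<forall>i\<in>{1..n}. Cphi n i Xs = Cphi n i Ys"
  shows "word_iso n (colsw n Xs) (colsw n Ys)"
proof (rule word_iso_colsw[OF assms(2,4)], rule highest_aiso)
  show "\<forall>i\<in>{1..<2 * n}. Aeps i (colsA n Xs) = 0" "\<forall>i\<in>{1..<2 * n}. Aeps i (colsA n Ys) = 0"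
    using highest_colsA assms by blast+
  show "\<forall>i\<in>{1..<2 * n}. Aphi i (colsA n Xs) = Aphi i (colsA n Ys)"
    using colsA_Aphi_eq[OF assms(2,4,6)] by blast
qed (use colsA_sub assms(1) in auto)

lemma ivl_aiso:
  assumes "\<forall>k\<in>set ks. k \<le> N" "\<forall>k\<in>set ls. k \<le> N" "0 < N"
    and "\<forall>i\<in>{1..<N}. count_list ks i = count_list ls i"
  shows "aiso0 N (map ivl ks) (map ivl ls)"
proof (rule highest_aiso)
  show "\<forall>i\<in>{1..<N}. Aphi i (map ivl ks) = Aphi i (map ivl ls)"
    using assms(4) by (auto simp: Aphi_ivl)
  show "\<forall>U\<in>set (map ivl ks). U \<subseteq> {1..N}" "\<forall>U\<in>set (map ivl ls). U \<subseteq> {1..N}"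
    using assms(1,2) by (auto simp: ivl_def)
qed (use assms(3) in \<open>auto simp: Aeps_ivl\<close>)

subsection \<open>Lowering paths\<close>

text \<open>A path is stored as a list of indices so that it can be replayed from another list of
  columns; this is how skew tableaux are compared with \<open>T\<close>.\<close>

fun fpath :: "nat \<Rightarrow> nat list \<Rightarrow> int set list \<Rightarrow> int set list option" where
  "fpath n [] Xs = Some Xs"
| "fpath n (i # p) Xs = (if i \<in> {1..n} \<and> 0 < Cphi n i Xs then fpath n p (Clow n i Xs) else None)"

lemma fpath_append:
  "fpath n (p @ q) Xs = (case fpath n p Xs of None \<Rightarrow> None | Some Ys \<Rightarrow> fpath n q Ys)"
  by (induction p arbitrary: Xs) auto

lemma fpath_adms:
  "adms n Ys \<Longrightarrow> fpath n p Ys = Some Xs \<Longrightarrow> adms n Xs \<and> map card Xs = map card Ys"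
proof (induction p arbitrary: Ys)
  case (Cons i p)
  then have i: "i \<in> {1..n}" "0 < Cphi n i Ys" "fpath n p (Clow n i Ys) = Some Xs"
    by (auto split: if_splits)
  then show ?case
    using Cons.IH[OF Clow_law(1)[OF Cons.prems(1) i(1,2)] i(3)] card_Clow[OF Cons.prems(1) i(1)] by simp
qed simp

text \<open>The termination measure for raising a list of columns to highest weight.\<close>

lemma wrai_ranks:
  assumes "i \<in> {1..n}" "set w \<subseteq> letters n" "0 < weps n i w"
  shows "(\<Sum>x\<leftarrow>wrai n i w. nat (rank n x)) < (\<Sum>x\<leftarrow>w. nat (rank n x))"
  using assms(2,3)
proof (induction w)
  case (Cons x w)
  have x: "nat (rank n (raise_letter n i x)) < nat (rank n x)" if "0 < leps n i x"
    using that assms(1)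
    by (auto simp: leps_def letter_sign_def raise_letter_def rank_def split: if_splits)
  show ?case using Cons x by auto
qed simp

lemma highest_reachable:
  assumes "adms n Xs"
  shows "\<exists>p Ys. adms n Ys \<and> highest n Ys \<and> fpath n p Ys = Some Xs"
  using assms
proof (induction "\<Sum>x\<leftarrow>colsw n Xs. nat (rank n x)" arbitrary: Xs rule: less_induct)
  case less
  show ?case
  proof (cases "highest n Xs")
    case True
    then show ?thesis using less.prems by (intro exI[of _ "[]"] exI[of _ Xs]) simp
  next
    case False
    then obtain i where i: "i \<in> {1..n}" "0 < Ceps n i Xs" by (auto simp: highest_def)
    note l = Crai_law[OF less.prems i]
    have "set (colsw n Xs) \<subseteq> letters n"
      by (auto simp: colsw_def colw_def set_alph)
    then have "(\<Sum>x\<leftarrow>colsw n (Crai n i Xs). nat (rank n x)) < (\<Sum>x\<leftarrow>colsw n Xs. nat (rank n x))"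
      using wrai_ranks[OF i(1), of "colsw n Xs"] colsw_rai[OF less.prems i] colsw_eps_phi[of n i Xs] i(2)
      by simp
    from less.hyps[OF this l(1)] obtain p Ys where
      p: "adms n Ys" "highest n Ys" "fpath n p Ys = Some (Crai n i Xs)" by blast
    then have "fpath n (p @ [i]) Ys = Some Xs" using l i by (simp add: fpath_append)
    then show ?thesis using p by blast
  qed
qed

text \<open>A type C step is a composition of two type A steps, so a type A relation between the
  starting lists survives the whole path, together with every property attached to it.\<close>

lemma fpath_aiso:
  assumes "bisimulation {1..<2 * n} Aeps Aphi Alow Arai R"
    and "adms n Ys" "adms n Zs" "R (colsA n Ys) (colsA n Zs)"
    and "fpath n p Ys = Some Xs" "fpath n p Zs = Some Ws"
  shows "R (colsA n Xs) (colsA n Ws)"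
  using assms(2-6)
proof (induction p arbitrary: Ys Zs)
  case (Cons i p)
  have i: "i \<in> {1..n}" "0 < Cphi n i Ys" "fpath n p (Clow n i Ys) = Some Xs"
    "0 < Cphi n i Zs" "fpath n p (Clow n i Zs) = Some Ws"
    using Cons.prems(4,5) by (auto split: if_splits)
  have "R (colsA n (Clow n i Ys)) (colsA n (Clow n i Zs))"
    using bisimulation_virtual(2)[OF assms(1) Cons.prems(3) i(1) colsA_aligned[OF Cons.prems(1) i(1)] i(2)]
      colsA_low[OF Cons.prems(1) i(1,2)] colsA_low[OF Cons.prems(2) i(1,4)] by simp
  then show ?case
    using Cons.IH[OF Clow_law(1)[OF Cons.prems(1) i(1,2)] Clow_law(1)[OF Cons.prems(2) i(1,4)] _ i(3,5)]
    by blast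
qed simp

lemma word_iso_colsw_D:
  assumes "word_iso n (colsw n Xs) (colsw n Ys)" "i \<in> {1..n}"
  shows "Ceps n i Xs = 0 \<longleftrightarrow> Ceps n i Ys = 0" "Cphi n i Xs = 0 \<longleftrightarrow> Cphi n i Ys = 0"
  using word_iso_eps_phi(1,2)[OF assms] colsw_eps_phi by simp_all

lemma fpath_forward:
  assumes "adms n Ys" "adms n Ws" "word_iso n (colsw n Ys) (colsw n Ws)" "fpath n p Ys = Some Xs"
  shows "\<exists>Zs. fpath n p Ws = Some Zs \<and> word_iso n (colsw n Xs) (colsw n Zs)"
  using assms
proof (induction p arbitrary: Ys Ws)
  case (Cons i p)
  have i: "i \<in> {1..n}" "0 < Cphi n i Ys" "fpath n p (Clow n i Ys) = Some Xs"
    using Cons.prems(4) by (auto split: if_splits)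
  then have w: "0 < Cphi n i Ws" using word_iso_colsw_D(2)[OF Cons.prems(3) i(1)] by simp
  have "word_iso n (colsw n (Clow n i Ys)) (colsw n (Clow n i Ws))"
    using word_iso_low[OF Cons.prems(3) i(1)] colsw_low[OF Cons.prems(1) i(1,2)]
      colsw_low[OF Cons.prems(2) i(1) w] colsw_eps_phi[of n i Ys] i(2) by simp
  from Cons.IH[OF Clow_law(1)[OF Cons.prems(1) i(1,2)] Clow_law(1)[OF Cons.prems(2) i(1) w] this i(3)]
  show ?case using i w by simp
qed auto

text \<open>The path is retraced from an isomorphic endpoint. \<open>P\<close> stands for a property
  stable under raising; with \<open>kn_chain n\<close> the retraced path stays among KN
  tableaux.\<close>

lemma fpath_backward:
  assumes "adms n Ys" "adms n Zs" "word_iso n (colsw n Xs) (colsw n Zs)" "fpath n p Ys = Some Xs"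
    and P: "P Zs" "\<And>i Vs. i \<in> {1..n} \<Longrightarrow> adms n Vs \<Longrightarrow> 0 < Ceps n i Vs \<Longrightarrow> P Vs \<Longrightarrow> P (Crai n i Vs)"
  shows "\<exists>Ws. adms n Ws \<and> P Ws \<and> fpath n p Ws = Some Zs \<and> word_iso n (colsw n Ys) (colsw n Ws)"
  using assms(1,4)
proof (induction p arbitrary: Ys)
  case Nil
  then show ?case using assms(2,3) P(1) by auto
next
  case (Cons i p)
  have i: "i \<in> {1..n}" "0 < Cphi n i Ys" "fpath n p (Clow n i Ys) = Some Xs"
    using Cons.prems(2) by (auto split: if_splits)
  note l = Clow_law[OF Cons.prems(1) i(1,2)]
  obtain Ws where W: "adms n Ws" "P Ws" "fpath n p Ws = Some Zs"
    "word_iso n (colsw n (Clow n i Ys)) (colsw n Ws)"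
    using Cons.IH[OF l(1) i(3)] by blast
  have e: "0 < Ceps n i (Clow n i Ys)" "0 < Ceps n i Ws"
    using l(2) word_iso_colsw_D(1)[OF W(4) i(1)] by auto
  note r = Crai_law[OF W(1) i(1) e(2)]
  have "word_iso n (colsw n (Crai n i (Clow n i Ys))) (colsw n (Crai n i Ws))"
    using word_iso_rai[OF W(4) i(1)] colsw_rai[OF l(1) i(1) e(1)] colsw_rai[OF W(1) i(1) e(2)]
      colsw_eps_phi[of n i "Clow n i Ys"] e(1) by simp
  then show ?case using W r i l(4) P(2)[OF i(1) W(1) e(2) W(2)]
    by (intro exI[of _ "Crai n i Ws"]) simp
qed

subsection \<open>Semistandard pairs of columns\<close>

text \<open>\<open>U\<close> is the right and \<open>V\<close> the left one of two adjacent columns,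
  and \<open>d\<close> is the number of rows by which the left one starts lower. In terms of
  counting functions, the inequality says that their common rows increase weakly.\<close>

definition sst :: "nat \<Rightarrow> nat set \<Rightarrow> nat set \<Rightarrow> bool" where
  "sst d U V \<longleftrightarrow> (\<forall>x. cnt U x \<le> cnt V x + d)"

lemma sst_low1:
  assumes "sst d U V" "0 < i" "i \<in> U" "Suc i \<notin> U"
  shows "sst d (alow i U) V"
  unfolding sst_def
proof
  fix x
  have "cnt U x \<le> cnt V x + d" using assms(1) by (simp add: sst_def)
  then show "cnt (alow i U) x \<le> cnt V x + d" using cnt_alow[OF assms(2-4), of x] by (auto split: if_splits)
qed

text \<open>Only the count of \<open>V\<close> at \<open>i\<close> drops. The unit needed there
  comes from the inequality at \<open>i - 1\<close> if \<open>i \<notin> U\<close>, and from the one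
  at \<open>i + 1\<close> if \<open>Suc i \<in> U\<close>.\<close>

lemma sst_low2:
  assumes "sst d U V" "0 < i" "i \<in> V" "Suc i \<notin> V" "i \<notin> U \<or> Suc i \<in> U"
  shows "sst d U (alow i V)"
  unfolding sst_def
proof
  fix x
  have s: "cnt U y \<le> cnt V y + d" for y using assms(1) by (simp add: sst_def)
  obtain m where m: "i = Suc m" using assms(2) by (cases i) auto
  show "cnt U x \<le> cnt (alow i V) x + d"
    using cnt_alow[OF assms(2-4), of x] s[of x] s[of m] s[of "Suc i"] assms(3-5) m
    by (auto split: if_splits)
qed

lemma sst_rai1:
  assumes "sst d U V" "0 < i" "i \<notin> U" "Suc i \<in> U" "i \<in> V \<or> Suc i \<notin> V"
  shows "sst d (arai i U) V"
  unfolding sst_def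
proof
  fix x
  have s: "cnt U y \<le> cnt V y + d" for y using assms(1) by (simp add: sst_def)
  obtain m where m: "i = Suc m" using assms(2) by (cases i) auto
  show "cnt (arai i U) x \<le> cnt V x + d"
    using cnt_arai[OF assms(2-4), of x] s[of x] s[of m] s[of "Suc i"] assms(3-5) m
    by (auto split: if_splits)
qed

lemma sst_rai2:
  assumes "sst d U V" "0 < i" "i \<notin> V" "Suc i \<in> V"
  shows "sst d U (arai i V)"
  unfolding sst_def
proof
  fix x
  have "cnt U x \<le> cnt V x + d" using assms(1) by (simp add: sst_def)
  then show "cnt U x \<le> cnt (arai i V) x + d" using cnt_arai[OF assms(2-4), of x] by (auto split: if_splits)
qed

text \<open>The outer columns complete the middle ones to virtual pairs; they contribute signs but
  no condition.\<close>

definition middle :: "nat \<Rightarrow> nat set list \<Rightarrow> bool" where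
  "middle d L \<longleftrightarrow> (\<exists>A U V B. L = [A, U, V, B] \<and> sst d U V)"

text \<open>If \<open>V\<close> is the column lowered, then no minus sign survives to the right of
  \<open>U\<close>, so a plus sign of \<open>U\<close> would have been chosen first. Hence
  \<open>U\<close> has none, which is the side condition of \<open>sst_low2\<close>.\<close>

lemma middle_low:
  assumes "middle d L" "0 < i" "0 < Aphi i L"
  shows "middle d (Alow i L)"
proof -
  obtain A U V B where L: "L = [A, U, V, B]" "sst d U V" using assms(1) unfolding middle_def by blast
  have bit: "aphi i Z = 0 \<or> aphi i Z = 1" "aeps i Z = 0 \<or> aeps i Z = 1" for Z
    by (auto simp: aphi_def aeps_def)
  consider "Alow i L = [alow i A, U, V, B]" | "Alow i L = [A, U, V, alow i B]"
    | "Alow i L = [A, alow i U, V, B]" "aphi i U = 1"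
    | "Alow i L = [A, U, alow i V, B]" "aphi i V = 1" "aphi i U = 0"
  proof -
    consider "Aeps i [U, V, B] < aphi i A" | "\<not> Aeps i [U, V, B] < aphi i A" "Aeps i [V, B] < aphi i U"
      | "\<not> Aeps i [U, V, B] < aphi i A" "\<not> Aeps i [V, B] < aphi i U" "aeps i B < aphi i V"
      | "\<not> Aeps i [U, V, B] < aphi i A" "\<not> Aeps i [V, B] < aphi i U" "\<not> aeps i B < aphi i V" "0 < aphi i B"
      | "\<not> Aeps i [U, V, B] < aphi i A" "\<not> Aeps i [V, B] < aphi i U" "\<not> aeps i B < aphi i V" "\<not> 0 < aphi i B"
      by blast
    then show ?thesis
    proof cases
      case 1
      then show ?thesis using that(1) by (simp add: L)
    next
      case 2
      then show ?thesis using that(3) bit(1)[of U] by (simp add: L)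
    next
      case 3
      then have v: "aphi i V = 1" "aeps i B = 0" using bit(1)[of V] by auto
      then have "aeps i V = 0" by (auto simp: aphi_def aeps_def split: if_splits)
      then have "Aeps i [V, B] = 0" using v by simp
      then have "aphi i U = 0" using 3(2) by simp
      then show ?thesis using that(4) v 3 by (simp add: L)
    next
      case 4
      then show ?thesis using that(2) by (simp add: L)
    next
      case 5
      then show ?thesis using assms(3) by (simp add: L)
    qed
  qed
  then show ?thesis
  proof cases
    case 3
    then have "i \<in> U" "Suc i \<notin> U" by (auto simp: aphi_def split: if_splits)
    then show ?thesis using 3(1) sst_low1[OF L(2) assms(2)] unfolding middle_def by blast
  next
    case 4
    then have "i \<in> V" "Suc i \<notin> V" "i \<notin> U \<or> Suc i \<in> U" by (auto simp: aphi_def split: if_splits)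
    then show ?thesis using 4(1) sst_low2[OF L(2) assms(2)] unfolding middle_def by blast
  qed (use L(2) in \<open>auto simp: middle_def\<close>)
qed

lemma middle_rai:
  assumes "middle d L" "0 < i" "0 < Aeps i L"
  shows "middle d (Arai i L)"
proof -
  obtain A U V B where L: "L = [A, U, V, B]" "sst d U V" using assms(1) unfolding middle_def by blast
  have bit: "aphi i Z = 0 \<or> aphi i Z = 1" "aeps i Z = 0 \<or> aeps i Z = 1" for Z
    by (auto simp: aphi_def aeps_def)
  consider "Arai i L = [arai i A, U, V, B]" | "Arai i L = [A, U, V, arai i B]"
    | "Arai i L = [A, arai i U, V, B]" "aeps i U = 1" "aeps i V = 0"
    | "Arai i L = [A, U, arai i V, B]" "aeps i V = 1"
  proof -
    consider "\<not> aphi i A < Aeps i [U, V, B]" | "aphi i A < Aeps i [U, V, B]" "\<not> aphi i U < Aeps i [V, B]"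
      | "aphi i A < Aeps i [U, V, B]" "aphi i U < Aeps i [V, B]" "\<not> aphi i V < aeps i B"
      | "aphi i A < Aeps i [U, V, B]" "aphi i U < Aeps i [V, B]" "aphi i V < aeps i B"
      by blast
    then show ?thesis
    proof cases
      case 1
      then show ?thesis using that(1) by (simp add: L)
    next
      case 2
      then have u: "aeps i U = 1" using bit(2)[of U] by auto
      then have "aphi i U = 0" by (auto simp: aphi_def aeps_def split: if_splits)
      then have "aeps i V = 0" using 2(2) by simp
      then show ?thesis using that(3) u 2 by (simp add: L)
    next
      case 3
      then have "aeps i V = 1" using bit(2)[of V] by auto
      then show ?thesis using that(4) 3 by (simp add: L)
    next
      case 4
      then show ?thesis using that(2) by (simp add: L)
    qed
  qed
  then show ?thesis
  proof cases
    case 3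
    then have "i \<notin> U" "Suc i \<in> U" "i \<in> V \<or> Suc i \<notin> V" by (auto simp: aeps_def split: if_splits)
    then show ?thesis using 3(1) sst_rai1[OF L(2) assms(2)] unfolding middle_def by blast
  next
    case 4
    then have "i \<notin> V" "Suc i \<in> V" by (auto simp: aeps_def split: if_splits)
    then show ?thesis using 4(1) sst_rai2[OF L(2) assms(2)] unfolding middle_def by blast
  qed (use L(2) in \<open>auto simp: middle_def\<close>)
qed

lemma middle_vlow:
  assumes "middle d L" "i \<in> {1..n}" "aligned n i L e p" "0 < p"
  shows "middle d (vlow n i L)"
proof -
  have *: "0 < i" "0 < n" "0 < 2 * n - i" using assms(2) by auto
  show ?thesis
    using vlow_positive[OF assms(2-4)] middle_low[OF _ *(1)] middle_low[OF _ *(2)]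
      middle_low[OF _ *(3)] assms(1) by (auto simp: vlow_def)
qed

lemma middle_vrai:
  assumes "middle d L" "i \<in> {1..n}" "aligned n i L e p" "0 < e"
  shows "middle d (vrai n i L)"
proof -
  have *: "0 < i" "0 < n" "0 < 2 * n - i" using assms(2) by auto
  show ?thesis
    using vrai_positive[OF assms(2-4)] middle_rai[OF _ *(1)] middle_rai[OF _ *(2)]
      middle_rai[OF _ *(3)] assms(1) by (auto simp: vrai_def)
qed

text \<open>In the split form the left column of \<open>X\<close> stands next to the right column of
  its left neighbour \<open>Y\<close>. The truncated difference of lengths is the vertical offset
  used by \<open>place\<close>.\<close>

definition kn_pair :: "nat \<Rightarrow> int set \<Rightarrow> int set \<Rightarrow> bool" where
  "kn_pair n X Y \<longleftrightarrow> sst (card X - card Y) (LA n X) (RA n Y)"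

definition kn_chain :: "nat \<Rightarrow> int set list \<Rightarrow> bool" where
  "kn_chain n = successively (kn_pair n)"

lemma middle_iff: "middle d ([A, U] @ [V, B]) \<longleftrightarrow> sst d U V"
  by (auto simp: middle_def)

text \<open>
  The pair \<open>[RC n X, LA n X]\<close> is a virtualization of \<open>X\<close> as well; followed by \<open>[RA n Y, LC n Y]\<close> it makes
  the left column of \<open>X\<close> and the right column of \<open>Y\<close> adjacent.
\<close>

lemma kn_pair_ops:
  assumes "adm n X" "adm n Y" "kn_pair n X Y" "i \<in> {1..n}"
  shows "ceps n i Y < cphi n i X \<Longrightarrow> kn_pair n (clow n i X) Y"
    "\<not> ceps n i Y < cphi n i X \<Longrightarrow> 0 < cphi n i Y \<Longrightarrow> kn_pair n X (clow n i Y)"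
    "\<not> cphi n i X < ceps n i Y \<Longrightarrow> 0 < ceps n i X \<Longrightarrow> kn_pair n (crai n i X) Y"
    "cphi n i X < ceps n i Y \<Longrightarrow> kn_pair n X (crai n i Y)"
proof -
  let ?L = "[RC n X, LA n X]" and ?K = "[RA n Y, LC n Y]"
  note al = aligned_columns(2)[OF assms(4), of X] aligned_columns(1)[OF assms(4), of Y]
  note alp = aligned_append[OF al]
  have s: "X \<subseteq> letters n" "Y \<subseteq> letters n" using assms(1,2) by (auto simp: adm_def)
  have m: "middle (card X - card Y) (?L @ ?K)"
    using assms(3) unfolding middle_iff kn_pair_def .
  have lowX: "[RC n (clow n i X), LA n (clow n i X)] = vlow n i ?L" if "0 < cphi n i X"
    using virtual_columns(2)[of n] assms(1,4) that unfolding virtual_def by auto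
  have lowY: "[RA n (clow n i Y), LC n (clow n i Y)] = vlow n i ?K" if "0 < cphi n i Y"
    using virtual_columns(1)[of n] assms(2,4) that unfolding virtual_def by auto
  have raiX: "[RC n (crai n i X), LA n (crai n i X)] = vrai n i ?L" if "0 < ceps n i X"
    using virtual_rai[OF virtual_columns(2) assms(1,4) that] by simp
  have raiY: "[RA n (crai n i Y), LC n (crai n i Y)] = vrai n i ?K" if "0 < ceps n i Y"
    using virtual_rai[OF virtual_columns(1) assms(2,4) that] by simp
  { assume a: "ceps n i Y < cphi n i X"
    then have p: "0 < cphi n i Y + (cphi n i X - ceps n i Y)" "0 < cphi n i X" by auto
    have "middle (card X - card Y) ([RC n (clow n i X), LA n (clow n i X)] @ ?K)"
      using middle_vlow[OF m assms(4) alp p(1)] vlow_append[OF assms(4) al p(1)] a lowX[OF p(2)] by simp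
    then show "kn_pair n (clow n i X) Y"
      unfolding middle_iff kn_pair_def card_clow[OF s(1) assms(4) p(2)] . }
  { assume a: "\<not> ceps n i Y < cphi n i X" "0 < cphi n i Y"
    then have p: "0 < cphi n i Y + (cphi n i X - ceps n i Y)" by auto
    have "middle (card X - card Y) (?L @ [RA n (clow n i Y), LC n (clow n i Y)])"
      using middle_vlow[OF m assms(4) alp p(1)] vlow_append[OF assms(4) al p(1)] a lowY[OF a(2)] by simp
    then show "kn_pair n X (clow n i Y)"
      unfolding middle_iff kn_pair_def card_clow[OF s(2) assms(4) a(2)] . }
  { assume a: "\<not> cphi n i X < ceps n i Y" "0 < ceps n i X"
    then have p: "0 < ceps n i X + (ceps n i Y - cphi n i X)" by auto
    have "middle (card X - card Y) ([RC n (crai n i X), LA n (crai n i X)] @ ?K)"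
      using middle_vrai[OF m assms(4) alp p(1)] vrai_append[OF assms(4) al p(1)] a raiX[OF a(2)] by simp
    then show "kn_pair n (crai n i X) Y"
      unfolding middle_iff kn_pair_def card_crai[OF s(1) assms(4) a(2)] . }
  { assume a: "cphi n i X < ceps n i Y"
    then have p: "0 < ceps n i X + (ceps n i Y - cphi n i X)" "0 < ceps n i Y" by auto
    have "middle (card X - card Y) (?L @ [RA n (crai n i Y), LC n (crai n i Y)])"
      using middle_vrai[OF m assms(4) alp p(1)] vrai_append[OF assms(4) al p(1)] a raiY[OF p(2)] by simp
    then show "kn_pair n X (crai n i Y)"
      unfolding middle_iff kn_pair_def card_crai[OF s(2) assms(4) p(2)] . }
qed

text \<open>A changed column belongs to two pairs. In the pair with the preceding column,
  \<open>kn_pair_ops\<close> applies because the signature rule has passed over that column.\<close>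

lemma kn_chain_low:
  assumes "adms n Xs" "kn_chain n Xs" "i \<in> {1..n}" "0 < Cphi n i Xs"
  shows "kn_chain n (Clow n i Xs)"
  using assms(1,2,4)
proof (induction Xs)
  case (Cons X Xs)
  show ?case
  proof (cases Xs)
    case Nil
    then show ?thesis by (simp add: kn_chain_def)
  next
    case (Cons Y Zs)
    have a: "adm n X" "adm n Y" "adms n Xs" "kn_pair n X Y" "kn_chain n Xs"
      using Cons.prems Cons by (auto simp: kn_chain_def)
    note ops = kn_pair_ops[OF a(1,2,4) assms(3)]
    show ?thesis
    proof (cases "Ceps n i Xs < cphi n i X")
      case True
      then have "ceps n i Y < cphi n i X" using Cons by simp
      then show ?thesis using True ops(1) a(5) Cons by (simp add: kn_chain_def)
    next
      case False
      then have p: "0 < Cphi n i Xs" using Cons.prems by simp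
      have IH: "kn_chain n (Clow n i Xs)" using Cons.IH a p by simp
      show ?thesis
      proof (cases "Ceps n i Zs < cphi n i Y")
        case True
        then have "0 < cphi n i Y" "\<not> ceps n i Y < cphi n i X" using False Cons by auto
        then show ?thesis using True False ops(2) IH Cons by (simp add: kn_chain_def)
      next
        case False2: False
        then show ?thesis using False IH a(4) Cons by (simp add: kn_chain_def)
      qed
    qed
  qed
qed simp

lemma kn_chain_rai:
  assumes "adms n Xs" "kn_chain n Xs" "i \<in> {1..n}" "0 < Ceps n i Xs"
  shows "kn_chain n (Crai n i Xs)"
  using assms(1,2,4)
proof (induction Xs)
  case (Cons X Xs)
  show ?case
  proof (cases Xs)
    case Nil
    then show ?thesis by (simp add: kn_chain_def)
  next
    case (Cons Y Zs)
    have a: "adm n X" "adm n Y" "adms n Xs" "kn_pair n X Y" "kn_chain n Xs"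
      using Cons.prems Cons by (auto simp: kn_chain_def)
    note ops = kn_pair_ops[OF a(1,2,4) assms(3)]
    show ?thesis
    proof (cases "cphi n i X < Ceps n i Xs")
      case False
      then have "\<not> cphi n i X < ceps n i Y" "0 < ceps n i X" using Cons Cons.prems by auto
      then show ?thesis using False ops(3) a(5) Cons by (simp add: kn_chain_def)
    next
      case True
      then have p: "0 < Ceps n i Xs" by simp
      have IH: "kn_chain n (Crai n i Xs)" using Cons.IH a p by simp
      show ?thesis
      proof (cases "cphi n i Y < Ceps n i Zs")
        case False
        then have "cphi n i X < ceps n i Y" using True Cons by auto
        then show ?thesis using True False ops(4) IH Cons by (simp add: kn_chain_def)
      next
        case True2: True
        then show ?thesis using True IH a(4) Cons by (simp add: kn_chain_def)
      qed
    qed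
  qed
qed simp

lemma kn_chain_fpath:
  "adms n Ys \<Longrightarrow> kn_chain n Ys \<Longrightarrow> fpath n p Ys = Some Xs \<Longrightarrow> kn_chain n Xs"
proof (induction p arbitrary: Ys)
  case (Cons i p)
  then have i: "i \<in> {1..n}" "0 < Cphi n i Ys" "fpath n p (Clow n i Ys) = Some Xs"
    by (auto split: if_splits)
  from Cons.IH[OF Clow_law(1)[OF Cons.prems(1) i(1,2)] kn_chain_low[OF Cons.prems(1,2) i(1,2)] i(3)]
  show ?case .
qed simp

text \<open>The offset absorbs the difference when the right column is the longer one, so the
  lengths may come in any order. Permuted lengths thus give skew tableaux.\<close>

lemma kn_chain_hcol:
  assumes "\<forall>k\<in>set ks. k \<le> n"
  shows "kn_chain n (map hcol ks)"
proof -
  have "kn_pair n (hcol k) (hcol l)" if "k \<le> n" "l \<le> n" for k l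
    using that by (auto simp: kn_pair_def sst_def RA_hcol LA_hcol cnt_ivl)
  then show ?thesis using assms
    by (induction ks rule: induct_list012) (auto simp: kn_chain_def)
qed

section \<open>KN tableaux of partition shape and highest weight\<close>

lemma hgt_card: "hgt X p = card {x \<in> X. x \<noteq> 0 \<and> \<bar>x\<bar> \<le> int p}"
proof (induction p)
  case (Suc p)
  let ?S = "\<lambda>p. {x \<in> X. x \<noteq> 0 \<and> \<bar>x\<bar> \<le> int p}"
  have fin: "finite (?S p)" for p
    by (rule finite_subset[of _ "{- int p..int p}"]) auto
  have "?S (Suc p) = ?S p \<union> (if pos X (Suc p) then {int (Suc p)} else {}) \<union>
      (if neg X (Suc p) then {- int (Suc p)} else {})"
  proof (rule set_eqI)
    fix x :: int
    have "\<bar>x\<bar> \<le> int (Suc p) \<longleftrightarrow> \<bar>x\<bar> \<le> int p \<or> x = int (Suc p) \<or> x = - int (Suc p)" by auto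
    then show "x \<in> ?S (Suc p) \<longleftrightarrow> x \<in> ?S p \<union> (if pos X (Suc p) then {int (Suc p)} else {}) \<union>
        (if neg X (Suc p) then {- int (Suc p)} else {})"
      unfolding pos_def neg_def by auto
  qed
  moreover have "int (Suc p) \<notin> ?S p" "- int (Suc p) \<notin> ?S p" "int (Suc p) \<noteq> - int (Suc p)" by auto
  ultimately show ?case using Suc fin[of p] by (simp add: card_insert_if del: of_nat_Suc)
qed (auto simp: card_eq_0_iff)

lemma hgt_full: "X \<subseteq> letters n \<Longrightarrow> hgt X n = card X"
proof -
  assume "X \<subseteq> letters n"
  then have "{x \<in> X. x \<noteq> 0 \<and> \<bar>x\<bar> \<le> int n} = X" by (auto simp: letters_def)
  then show ?thesis by (simp add: hgt_card)
qed

lemma adm_card: "adm n X \<Longrightarrow> card X \<le> n"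
  using hgt_full[of X n] by (auto simp: adm_def)

lemma card_both_matched:
  assumes "adm n X"
  shows "card {t. 0 < t \<and> t \<le> n \<and> matched n X t} = card {z. 0 < z \<and> z \<le> n \<and> both X z}"
  using gap_card[of 0 n X] adm_gap_0[OF assms] by simp

lemma RA_subset: "RA n X \<subseteq> {1..2 * n}"
  unfolding RA_def by (rule halves_subset)

lemma RA_mem:
  assumes "0 < p" "p \<le> n"
  shows "p \<in> RA n X \<longleftrightarrow> pos X p" "2 * n + 1 - p \<in> RA n X \<longleftrightarrow> neg X p \<and> \<not> pos X p \<or> matched n X p"
  unfolding RA_def by (rule halves_mem[OF assms])+

lemma RA_no_pairs: "0 < p \<Longrightarrow> p \<le> n \<Longrightarrow> \<not> (p \<in> RA n X \<and> 2 * n + 1 - p \<in> RA n X)"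
  unfolding RA_mem matched_def free_def by blast

text \<open>A barred letter in the right column would bring the opposite letter along, since an
  interval contains all smaller ranks, but right columns contain no opposite letters. So nothing is
  matched, hence nothing is repeated, and no barred letter is left.\<close>

lemma column_if_RA_ivl:
  assumes "adm n Y" "RA n Y = ivl m"
  shows "Y = hcol (card Y)" "card Y = m"
proof -
  have nb: "2 * n + 1 - p \<notin> RA n Y" if p: "0 < p" "p \<le> n" for p
  proof
    assume a: "2 * n + 1 - p \<in> RA n Y"
    then have "p \<in> RA n Y" using p unfolding assms(2) ivl_def by auto
    then show False using a RA_no_pairs[OF p] by blast
  qed
  then have nm: "\<not> matched n Y p" "neg Y p \<Longrightarrow> both Y p" if "0 < p" "p \<le> n" for p
    using nb[OF that] unfolding RA_mem(2)[OF that] both_def by blast+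
  have "{t. 0 < t \<and> t \<le> n \<and> matched n Y t} = {}" using nm(1) by blast
  then have "card {z. 0 < z \<and> z \<le> n \<and> both Y z} = 0"
    by (metis card_both_matched[OF assms(1)] card.empty)
  moreover have "finite {z. 0 < z \<and> z \<le> n \<and> both Y z}" by (rule finite_subset[of _ "{..n}"]) auto
  ultimately have nb2: "\<not> both Y p" if "0 < p" "p \<le> n" for p using that by auto
  have "pos Y p \<longleftrightarrow> p \<le> m" if "0 < p" "p \<le> n" for p
    using that RA_mem(1)[OF that, of Y] unfolding assms(2) ivl_def by simp
  then have "same Y (hcol (min m n)) p" if "0 < p" "p \<le> n" for p
    using that nm(2)[OF that] nb2[OF that] by (auto simp: same_def hcol_bits)
  then have Y: "Y = hcol (min m n)"
    using assms(1) hcol_letters[of "min m n" n] by (intro pos_neg_ext) (auto simp: adm_def)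
  then have c: "card Y = min m n" by simp
  then show "Y = hcol (card Y)" using Y by simp
  have "RA n Y = ivl (min m n)" unfolding Y by (rule RA_hcol) simp
  then show "card Y = m" using c assms(2) by (metis card_ivl)
qed

text \<open>As in type A, the previous lengths put \<open>{1..k}\<close> into \<open>RA n Y\<close>,
  and a gap \<open>c\<close> forces \<open>c\<close> or \<open>2 * n - c\<close> to be a previous
  length. The first contradicts \<open>c\<close> being missing; the second would give two opposite
  letters in a right column.\<close>

lemma kn_highest:
  assumes "adms n Xs" "sorted (map card Xs)" "kn_chain n Xs" "highest n Xs"
  shows "Xs = map hcol (map card Xs)"
  using assms
proof (induction Xs rule: rev_induct)
  case (snoc Y P)
  define ks where "ks = map card P"
  have e: "Ceps n i P = 0 \<and> ceps n i Y \<le> Cphi n i P" if "i \<in> {1..n}" for i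
    using snoc.prems(4) that by (auto simp: highest_def teps_append)
  have a: "adms n P" "adm n Y" using snoc.prems(1) by auto
  have "kn_chain n P" using snoc.prems(3) by (simp add: kn_chain_def successively_append_iff)
  then have P: "P = map hcol ks"
    using snoc.IH a e snoc.prems(2) by (simp add: ks_def sorted_append highest_def)
  have kn: "\<forall>k\<in>set ks. k \<le> n" using a(1) adm_card by (auto simp: ks_def list_all_iff)
  define k where "k = (if ks = [] then 0 else last ks)"
  have le: "j \<le> k" if "j \<in> set ks" for j
  proof -
    have "sorted ks" using snoc.prems(2) by (simp add: ks_def sorted_append)
    moreover from that obtain b where "b < length ks" "j = ks ! b" by (auto simp: in_set_conv_nth)
    ultimately show ?thesis
      using sorted_nth_mono[of ks b "length ks - 1"] by (auto simp: k_def last_conv_nth)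
  qed
  have k: "k \<le> n" using kn by (auto simp: k_def)
  have sub: "j \<in> RA n Y" if "0 < j" "j \<le> k" for j
  proof -
    have ne: "ks \<noteq> []" using that by (auto simp: k_def)
    then have "P \<noteq> []" "last P = hcol k" using P by (auto simp: k_def last_map)
    then have "kn_pair n (hcol k) Y" using snoc.prems(3) by (simp add: kn_chain_def successively_append_iff)
    \<comment> \<open>The lengths increase, so the offset in \<open>kn_pair\<close> is 0.\<close>
    moreover have "k \<le> card Y"
      using snoc.prems(2) ne last_in_set[OF ne] by (auto simp: sorted_append ks_def k_def)
    ultimately have "cnt (ivl k) k \<le> cnt (RA n Y) k"
      using k by (simp add: kn_pair_def sst_def LA_hcol)
    moreover have "cnt (RA n Y) k \<le> k" by (induction k) auto
    ultimately show ?thesis using that cnt_subset_eq[of "RA n Y" k j] by (simp add: cnt_ivl)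
  qed
  have mem: "j \<in> set ks \<or> 2 * n - j \<in> set ks" if j: "j \<in> {1..<2 * n}" "aeps j (RA n Y) = 1" for j
  proof -
    have "0 < Aeps j [RA n Y, LC n Y]" using j(2) by simp
    have "\<exists>i\<in>{1..n}. (i = j \<or> i = 2 * n - j) \<and> 0 < ceps n i Y"
      using j(1)
    proof (cases rule: index_cases)
      case (1 i)
      then have "0 < ceps n i Y" using aligned_columns(1)[OF 1(1), of Y] \<open>0 < Aeps j _\<close>
        by (auto simp: aligned_def simp del: teps.simps tphi.simps)
      then show ?thesis using 1 by auto
    next
      case 2
      then have "0 < ceps n n Y" using aligned_columns(1)[OF 2(2), of Y] \<open>0 < Aeps j _\<close>
        by (auto simp: aligned_def simp del: teps.simps tphi.simps)
      then show ?thesis using 2 by auto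
    qed
    then obtain i where i: "i \<in> {1..n}" "i = j \<or> i = 2 * n - j" "0 < ceps n i Y" by blast
    then have "0 < count_list ks i" using e[OF i(1)] Ceps_Cphi_hcol(2)[OF i(1) kn] P by simp
    then have "i \<in> set ks" by (metis count_notin less_irrefl)
    then show ?thesis using i(2) by auto
  qed
  have "c \<in> RA n Y" if c: "0 < c" "Suc c \<in> RA n Y" for c
  proof (rule ccontr)
    assume nc: "c \<notin> RA n Y"
    have "Suc c \<le> 2 * n" using c(2) RA_subset[of n Y] by auto
    then have "c \<in> {1..<2 * n}" using c(1) by auto
    from mem[OF this] have "c \<in> set ks \<or> 2 * n - c \<in> set ks" using nc c by (simp add: aeps_def)
    then show False
    proof
      assume "c \<in> set ks"
      then show False using le sub[of c] c(1) nc by blast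
    next
      assume p: "2 * n - c \<in> set ks"
      \<comment> \<open>\<open>Suc c\<close> is the rank of the barred letter of \<open>p\<close>,
        while \<open>p\<close> itself lies in \<open>{1..k}\<close>.\<close>
      define p where "p = 2 * n - c"
      have p': "0 < p" "p \<le> k" "p \<le> n" "Suc c = 2 * n + 1 - p"
        using p le kn \<open>Suc c \<le> 2 * n\<close> by (auto simp: p_def)
      then show False using RA_no_pairs[of p n Y] sub[of p] c(2) by simp
    qed
  qed
  then obtain m where "RA n Y = ivl m"
    using ivl_if_contiguous[of "RA n Y" "2 * n"] RA_subset[of n Y] by blast
  from column_if_RA_ivl(1)[OF a(2) this] show ?case using P by (simp add: ks_def)
qed simp

subsection \<open>Weights\<close>

text \<open>The sum of the first \<open>p\<close> entries of the weight of a column; among the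
  admissible columns of a given length, \<open>hcol\<close> makes it largest.\<close>

fun csum :: "int set \<Rightarrow> nat \<Rightarrow> int" where
  "csum X 0 = 0"
| "csum X (Suc p) = csum X p + (if pos X (Suc p) then 1 else 0) - (if neg X (Suc p) then 1 else 0)"

lemma csum_le: "csum X p \<le> int (hgt X p)" "csum X p \<le> int p"
  by (induction p) auto

lemma csum_hcol: "csum (hcol k) p = int (min k p)"
  by (induction p) (auto simp: hcol_bits)

lemma hgt_mono: "p \<le> q \<Longrightarrow> hgt X p \<le> hgt X q"
  by (induction q rule: dec_induct) auto

text \<open>The bound \<open>csum X p \<le> int p\<close> is attained at \<open>card X\<close> only
  if every step up to there adds an unbarred letter and no barred one.\<close>

lemma column_if_csum:
  assumes "adm n X" "csum X (card X) = int (card X)"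
  shows "X = hcol (card X)"
proof -
  have *: "pos X q" if "csum X p = int p" "0 < q" "q \<le> p" for p q
    using that
  proof (induction p)
    case (Suc p)
    have "csum X p \<le> int p" by (rule csum_le)
    then have "csum X p = int p" "pos X (Suc p)" using Suc.prems(1) by (auto split: if_splits)
    then show ?case using Suc by (auto simp: le_Suc_eq)
  qed simp
  have "hcol (card X) \<subseteq> X"
  proof
    fix x assume "x \<in> hcol (card X)"
    then have "0 < nat x" "nat x \<le> card X" "x = int (nat x)" by (auto simp: hcol_def)
    then show "x \<in> X" using *[OF assms(2), of "nat x"] by (simp add: pos_def)
  qed
  moreover have "finite X" using assms(1) adm_def set_alph by (metis List.finite_set finite_subset)
  ultimately show ?thesis by (metis card_hcol card_subset_eq)
qed

lemma weight_append: "weight (u @ v) i = weight u i + weight v i"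
  by (simp add: weight_def)

lemma count_list_distinct: "distinct xs \<Longrightarrow> count_list xs x = (if x \<in> set xs then 1 else 0)"
  by (induction xs) auto

lemma weight_colw:
  "X \<subseteq> letters n \<Longrightarrow> 0 < i \<Longrightarrow>
    weight (colw n X) i = (if pos X i then 1 else 0) - (if neg X i then 1 else 0)"
  using set_colw[of X n] distinct_filter[OF distinct_alph[of n], of "\<lambda>x. x \<in> X"]
  by (simp add: weight_def count_list_distinct pos_def neg_def colw_def[symmetric])

lemma sum_weight_colsw:
  "adms n Xs \<Longrightarrow> (\<Sum>i\<in>{1..j}. weight (colsw n Xs) i) = (\<Sum>X\<leftarrow>Xs. csum X j)"
proof (induction Xs)
  case Nil
  show ?case by (simp add: weight_def)
next
  case (Cons X Xs)
  have X: "X \<subseteq> letters n" using Cons.prems by (simp add: adm_def)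
  have "(\<Sum>i\<in>{1..j}. weight (colw n X) i) = csum X j"
    by (induction j) (auto simp: weight_colw[OF X])
  then show ?case using Cons by (simp add: weight_append sum.distrib)
qed

lemma sum_list_eq_pointwise:
  fixes f g :: "'a \<Rightarrow> int"
  assumes "(\<Sum>x\<leftarrow>xs. f x) = (\<Sum>x\<leftarrow>xs. g x)" "\<And>x. x \<in> set xs \<Longrightarrow> f x \<le> g x" "x \<in> set xs"
  shows "f x = g x"
  using assms
proof (induction xs)
  case (Cons y ys)
  have "(\<Sum>x\<leftarrow>ys. f x) \<le> (\<Sum>x\<leftarrow>ys. g x)" using Cons.prems(2) by (intro sum_list_mono) auto
  moreover have "f y \<le> g y" using Cons.prems(2) by simp
  ultimately have "f y = g y" "(\<Sum>x\<leftarrow>ys. f x) = (\<Sum>x\<leftarrow>ys. g x)" using Cons.prems(1) by auto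
  then show ?case using Cons by auto
qed simp

text \<open>Each partial sum of the weight is bounded column by column by
  \<open>min (card X) j\<close>, and the columns \<open>hcol k\<close> attain the total bound. So
  every column attains its own bound, and \<open>j = card X\<close> identifies it. This determines
  the source of a path from the column lengths and the weight.\<close>

lemma maximal_weight:
  assumes "adms n Ys" "\<forall>k\<in>set ks. k \<le> n" "\<And>k. count_list ks k = count_list (map card Ys) k"
    and "\<forall>i\<in>{1..n}. weight (colsw n Ys) i = weight (colsw n (map hcol ks)) i"
  shows "Ys = map hcol (map card Ys)"
proof -
  have st: "set ks = set (map card Ys)"
    using assms(3) by (metis count_list_0_iff subsetI subset_antisym)
  have perm: "(\<Sum>k\<leftarrow>ks. int (f k)) = (\<Sum>k\<leftarrow>map card Ys. int (f k))" for f :: "nat \<Rightarrow> nat"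
  proof -
    have "(\<Sum>k\<leftarrow>ks. f k) = (\<Sum>k\<leftarrow>map card Ys. f k)"
      unfolding sum_list_map_eq_sum_count st using assms(3) by simp
    moreover have "int (\<Sum>k\<leftarrow>ls. f k) = (\<Sum>k\<leftarrow>ls. int (f k))" for ls
      by (induction ls) auto
    ultimately show ?thesis by metis
  qed
  have s: "(\<Sum>X\<leftarrow>Ys. csum X j) = (\<Sum>X\<leftarrow>Ys. int (min (card X) j))" if "j \<le> n" for j
  proof -
    have "(\<Sum>X\<leftarrow>Ys. csum X j) = (\<Sum>i\<in>{1..j}. weight (colsw n Ys) i)"
      using sum_weight_colsw[OF assms(1)] by simp
    also have "\<dots> = (\<Sum>i\<in>{1..j}. weight (colsw n (map hcol ks)) i)"
      using assms(4) that by (intro sum.cong) auto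
    also have "\<dots> = (\<Sum>X\<leftarrow>map hcol ks. csum X j)"
      using sum_weight_colsw[OF adms_hcol[OF assms(2)]] by simp
    also have "\<dots> = (\<Sum>k\<leftarrow>ks. int (min k j))" by (simp add: comp_def csum_hcol)
    also have "\<dots> = (\<Sum>X\<leftarrow>Ys. int (min (card X) j))" using perm[of "\<lambda>k. min k j"] by (simp add: comp_def)
    finally show ?thesis .
  qed
  have "X = hcol (card X)" if X: "X \<in> set Ys" for X
  proof -
    have a: "adm n X" using assms(1) X by (auto simp: list_all_iff)
    have c: "card X \<le> n" by (rule adm_card[OF a])
    have "csum Z (card X) \<le> int (min (card Z) (card X))" if "Z \<in> set Ys" for Z
    proof -
      have az: "adm n Z" using assms(1) that by (auto simp: list_all_iff)
      have "hgt Z (card X) \<le> hgt Z n" by (rule hgt_mono[OF c])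
      then show ?thesis using csum_le[of Z "card X"] hgt_full[of Z n] az by (auto simp: adm_def)
    qed
    from sum_list_eq_pointwise[OF s[OF c] this X] have "csum X (card X) = int (card X)" by simp
    then show ?thesis by (rule column_if_csum[OF a])
  qed
  then show ?thesis by (simp add: map_idI)
qed

section \<open>First columns\<close>

lemma aiso_rel: "aiso N Q L L' \<Longrightarrow> Q L L'"
  unfolding aiso_def by blast

lemma count_dbl:
  assumes "\<forall>k\<in>set ks. k \<le> n" "i \<le> 2 * n"
  shows "count_list (dbl n ks) i = count_list ks i + count_list ks (2 * n - i)"
  using assms by (induction ks) auto

lemma set_dbl: "\<forall>k\<in>set ks. k \<le> n \<Longrightarrow> j \<in> set (dbl n ks) \<Longrightarrow> j \<le> 2 * n"
  by (induction ks) auto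

lemma count_remove1: "k \<in> set xs \<Longrightarrow> count_list (k # remove1 k xs) i = count_list xs i"
  by (induction xs) auto

text \<open>Normalization preserves \<open>Aphi\<close> and sorts the lengths, so on two intervals
  it can only be the exchange; \<open>shrinks\<close> adds the control over the head.\<close>

lemma swap_two_ivl:
  assumes "0 < k" "k < l" "l < N"
  shows "aiso N shrinks (map ivl [l, k]) (map ivl [k, l])"
proof -
  have s: "\<forall>U\<in>set (map ivl [l, k]). U \<subseteq> {1..N}" using assms by (auto simp: ivl_def)
  have "\<forall>i\<in>{1..<N}. Aeps i (map ivl [l, k]) = 0" by (intro ballI Aeps_ivl) auto
  from highest_aiso_ivl[OF s this] obtain ks where
    ks: "aiso N shrinks (map ivl [l, k]) (map ivl ks)" "sorted ks" by blast
  have "length ks = 2" using aiso_rel[OF ks(1)] by (simp add: shrinks_def)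
  then obtain a b where ab: "ks = [a, b]" by (auto simp: length_Suc_conv numeral_2_eq_2)
  have "count_list ks i = count_list [l, k] i" if "i \<in> {1..<N}" for i
    using aiso_eps_phi(2)[OF ks(1) that] that Aphi_ivl[of i ks] Aphi_ivl[of i "[l, k]"] by simp
  from this[of k] this[of l] have "ks = [k, l]"
    using assms ks(2) by (auto simp: ab split: if_splits)
  then show ?thesis using ks(1) by simp
qed

text \<open>A rearrangement of the tail brings an interval of length \<open>k\<close> next to the
  head, it is exchanged with the head, and the new tail is rearranged. Only the exchange touches the
  head, which thereby loses letters.\<close>

lemma aiso_first_ivl:
  assumes "\<forall>j\<in>set (k # ks). j \<le> N" "\<forall>j\<in>set (l # ls). j \<le> N"
    and "\<forall>i\<in>{1..<N}. count_list (k # ks) i = count_list (l # ls) i"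
    and "0 < k" "k \<le> l" "l < N"
  shows "aiso N (\<lambda>Y Y'. Y \<noteq> [] \<and> Y' \<noteq> [] \<and> hd Y' \<subseteq> hd Y) (map ivl (l # ls)) (map ivl (k # ks))"
proof (cases "k = l")
  case True
  have "count_list ls i = count_list ks i" if "i \<in> {1..<N}" for i
    using assms(3)[rule_format, OF that] True by (simp split: if_splits)
  then have "aiso0 N (map ivl ls) (map ivl ks)"
    by (intro ivl_aiso) (use assms in auto)
  from aiso_mono[OF aiso_Cons[OF this, of "ivl k"]] show ?thesis using True by fastforce
next
  case False
  then have kl: "k < l" using assms by simp
  have "k \<in> {1..<N}" using assms kl by simp
  from assms(3)[rule_format, OF this] have "count_list (l # ls) k = count_list (k # ks) k" by simp
  then have "count_list ls k \<noteq> 0" using kl by simp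
  then have k: "k \<in> set ls" by (metis count_notin)
  define B where "B = remove1 k ls"
  have B: "count_list (k # B) i = count_list ls i" for i
    unfolding B_def by (rule count_remove1[OF k])
  have Bs: "\<forall>j\<in>set B. j \<le> N" using assms(2) set_remove1_subset[of k ls] by (auto simp: B_def)
  have "aiso0 N (map ivl ls) (map ivl (k # B))"
    by (rule ivl_aiso) (use assms B Bs in auto)
  then have 1: "aiso N (\<lambda>Y Y'. Y \<noteq> [] \<and> Y' \<noteq> [] \<and> hd Y = hd Y') (map ivl (l # ls)) (map ivl (l # k # B))"
    using aiso_Cons[of N "map ivl ls" "map ivl (k # B)" "ivl l"] by simp
  have 2: "aiso N shrinks (map ivl (l # k # B)) (map ivl (k # l # B))"
    using aiso_shrinks_append[OF swap_two_ivl[OF assms(4) kl assms(6)], of "[]" "map ivl B"] by simp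
  have "count_list (l # B) i = count_list ks i" if "i \<in> {1..<N}" for i
  proof -
    have "count_list (k # ks) i = count_list (l # ls) i" using assms(3) that by blast
    then show ?thesis using B[of i] by (auto split: if_splits)
  qed
  then have "aiso0 N (map ivl (l # B)) (map ivl ks)"
    by (intro ivl_aiso) (use assms Bs in auto)
  then have 3: "aiso N (\<lambda>Y Y'. Y \<noteq> [] \<and> Y' \<noteq> [] \<and> hd Y = hd Y') (map ivl (k # l # B)) (map ivl (k # ks))"
    using aiso_Cons[of N "map ivl (l # B)" "map ivl ks" "ivl k"] by simp
  have "aiso N (\<lambda>Y Y'. Y \<noteq> [] \<and> Y' \<noteq> [] \<and> hd Y' \<subseteq> hd Y) (map ivl (l # ls)) (map ivl (k # l # B))"
    using 1 2 by (rule aiso_trans) (auto simp: shrinks_def)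
  then show ?thesis using 3 by (rule aiso_trans) auto
qed

text \<open>For \<open>k = l\<close> it can be applied in both directions and shows that the order
  of the other lengths does not affect the first right column.\<close>

lemma first_column_mono:
  assumes "0 < n" "\<forall>j\<in>set (k # ks). j \<le> n" "\<forall>j\<in>set (l # ls). j \<le> n"
    and "\<And>i. count_list (k # ks) i = count_list (l # ls) i" "0 < k" "k \<le> l"
    and "fpath n p (map hcol (k # ks)) = Some Xs" "fpath n p (map hcol (l # ls)) = Some Zs"
  shows "RA n (hd Xs) \<subseteq> RA n (hd Zs)"
proof -
  note ck = colsA_hcol[OF assms(2)] and cl = colsA_hcol[OF assms(3)]
  have d: "dbl n (k # ks) = k # (2 * n - k) # dbl n ks" "dbl n (l # ls) = l # (2 * n - l) # dbl n ls"
    by simp_all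
  have "aiso (2 * n) (\<lambda>Y Y'. Y \<noteq> [] \<and> Y' \<noteq> [] \<and> hd Y' \<subseteq> hd Y)
      (map ivl (l # (2 * n - l) # dbl n ls)) (map ivl (k # (2 * n - k) # dbl n ks))"
  proof (rule aiso_first_ivl)
    show "\<forall>j\<in>set (k # (2 * n - k) # dbl n ks). j \<le> 2 * n"
      "\<forall>j\<in>set (l # (2 * n - l) # dbl n ls). j \<le> 2 * n"
      using set_dbl[OF assms(2)] set_dbl[OF assms(3)] unfolding d by blast+
    show "\<forall>i\<in>{1..<2 * n}. count_list (k # (2 * n - k) # dbl n ks) i =
        count_list (l # (2 * n - l) # dbl n ls) i"
      using count_dbl[OF assms(2)] count_dbl[OF assms(3)] assms(4) unfolding d[symmetric] by simp
  qed (use assms in auto)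
  then obtain R where R: "bisimulation {1..<2 * n} Aeps Aphi Alow Arai R"
    "R (colsA n (map hcol (l # ls))) (colsA n (map hcol (k # ks)))"
    "\<And>Y Y'. R Y Y' \<Longrightarrow> Y \<noteq> [] \<and> Y' \<noteq> [] \<and> hd Y' \<subseteq> hd Y"
    unfolding aiso_def ck cl d by blast
  note a = adms_hcol[OF assms(2)] adms_hcol[OF assms(3)]
  have "R (colsA n Zs) (colsA n Xs)"
    by (rule fpath_aiso[OF R(1) a(2) a(1) R(2) assms(8,7)])
  then have "colsA n Zs \<noteq> []" "colsA n Xs \<noteq> []" "hd (colsA n Xs) \<subseteq> hd (colsA n Zs)"
    using R(3) by auto
  then show ?thesis by (cases Xs; cases Zs) auto
qed

section \<open>Left and right columns\<close>

text \<open>The way back from sets of ranks to sets of letters.\<close>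

definition rset :: "nat \<Rightarrow> nat set \<Rightarrow> int set" where
  "rset n U = {x \<in> letters n. nat (rank n x) \<in> U}"

lemma rset_letters: "rset n U \<subseteq> letters n"
  by (auto simp: rset_def)

lemma rset_bits:
  assumes "0 < p" "p \<le> n"
  shows "pos (rset n U) p \<longleftrightarrow> p \<in> U" "neg (rset n U) p \<longleftrightarrow> 2 * n + 1 - p \<in> U"
proof -
  have "rank n (int p) = int p" "rank n (- int p) = int (2 * n + 1 - p)"
    using assms by (auto simp: rank_def)
  then have "nat (rank n (int p)) = p" "nat (rank n (- int p)) = 2 * n + 1 - p" by (simp_all only: nat_int)
  moreover have "int p \<in> letters n" "- int p \<in> letters n" using assms by (auto simp: letters_def)
  ultimately show "pos (rset n U) p \<longleftrightarrow> p \<in> U" "neg (rset n U) p \<longleftrightarrow> 2 * n + 1 - p \<in> U"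
    unfolding pos_def neg_def rset_def by simp_all
qed

lemma rset_mono: "U \<subseteq> V \<Longrightarrow> rset n U \<subseteq> rset n V"
  by (auto simp: rset_def)

lemma rset_mk_bits:
  assumes "0 < p" "p \<le> n"
  shows "pos (rset n (halves n A B)) p \<longleftrightarrow> A p" "neg (rset n (halves n A B)) p \<longleftrightarrow> B p"
  unfolding rset_bits[OF assms] halves_mem[OF assms] by (rule refl)+

abbreviation "rcol n X \<equiv> rset n (RA n X)"
abbreviation "lcol n X \<equiv> rset n (LA n X)"

lemma rcol_bits:
  assumes "0 < p" "p \<le> n"
  shows "pos (rcol n X) p \<longleftrightarrow> pos X p" "neg (rcol n X) p \<longleftrightarrow> neg X p \<and> \<not> pos X p \<or> matched n X p"
    "pos (lcol n X) p \<longleftrightarrow> pos X p \<and> \<not> neg X p \<or> matched n X p" "neg (lcol n X) p \<longleftrightarrow> neg X p"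
  unfolding RA_def LA_def rset_mk_bits[OF assms] by (rule refl)+

lemma hgt_split:
  "hgt X p = card {q. 0 < q \<and> q \<le> p \<and> pos X q} + card {q. 0 < q \<and> q \<le> p \<and> neg X q}"
proof (induction p)
  case 0
  have "{q. 0 < q \<and> q \<le> 0 \<and> P q} = {}" for P :: "nat \<Rightarrow> bool" by auto
  from this[of "pos X"] this[of "neg X"] show ?case by (simp only: hgt.simps card.empty)
next
  case (Suc p)
  have *: "{q. 0 < q \<and> q \<le> Suc p \<and> P q} = (if P (Suc p) then {Suc p} else {}) \<union> {q. 0 < q \<and> q \<le> p \<and> P q}"
    for P by (auto simp: le_Suc_eq)
  have fin: "finite {q. 0 < q \<and> q \<le> p \<and> P q}" for P by (rule finite_subset[of _ "{..p}"]) auto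
  have "card {q. 0 < q \<and> q \<le> Suc p \<and> P q} = (if P (Suc p) then 1 else 0) + card {q. 0 < q \<and> q \<le> p \<and> P q}"
    for P unfolding * using fin[of P] by simp
  from this[of "pos X"] this[of "neg X"] Suc show ?case by simp
qed

text \<open>For an admissible column there are as many matched letters as repeated ones, so the
  replacement does not change the number of letters.\<close>

lemma card_rcol_lcol:
  assumes "adm n X"
  shows "card (rcol n X) = card X" "card (lcol n X) = card X"
proof -
  let ?N = "\<lambda>P. {q. 0 < q \<and> q \<le> n \<and> P q}"
  have fin: "finite (?N P)" for P by (rule finite_subset[of _ "{..n}"]) auto
  have m: "card (?N (matched n X)) = card (?N (both X))" by (rule card_both_matched[OF assms])
  have un: "card (?N (\<lambda>q. P q \<or> Q q)) = card (?N P) + card (?N Q)" if "\<And>q. \<not> (P q \<and> Q q)" for P Q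
  proof -
    have "?N (\<lambda>q. P q \<or> Q q) = ?N P \<union> ?N Q" by auto
    moreover have "?N P \<inter> ?N Q = {}" using that by auto
    ultimately show ?thesis using fin by (simp add: card_Un_disjoint)
  qed
  have c: "card Z = card (?N (pos Z)) + card (?N (neg Z))" if "Z \<subseteq> letters n" for Z
    using hgt_full[OF that] hgt_split[of Z n] by simp
  have b: "?N (pos (rcol n X)) = ?N (pos X)"
    "?N (neg (rcol n X)) = ?N (\<lambda>q. (neg X q \<and> \<not> pos X q) \<or> matched n X q)"
    "?N (pos (lcol n X)) = ?N (\<lambda>q. (pos X q \<and> \<not> neg X q) \<or> matched n X q)"
    "?N (neg (lcol n X)) = ?N (neg X)"
    by (rule Collect_cong, metis rcol_bits)+
  have "?N (pos X) = ?N (\<lambda>q. (pos X q \<and> \<not> neg X q) \<or> both X q)"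
    "?N (neg X) = ?N (\<lambda>q. (neg X q \<and> \<not> pos X q) \<or> both X q)" by (auto simp: both_def)
  then have s: "card (?N (pos X)) = card (?N (\<lambda>q. pos X q \<and> \<not> neg X q)) + card (?N (both X))"
    "card (?N (neg X)) = card (?N (\<lambda>q. neg X q \<and> \<not> pos X q)) + card (?N (both X))"
    using un[of "\<lambda>q. pos X q \<and> \<not> neg X q" "both X"] un[of "\<lambda>q. neg X q \<and> \<not> pos X q" "both X"]
    by (simp_all add: both_def)
  have d: "card (?N (\<lambda>q. (neg X q \<and> \<not> pos X q) \<or> matched n X q)) =
      card (?N (\<lambda>q. neg X q \<and> \<not> pos X q)) + card (?N (matched n X))"
    "card (?N (\<lambda>q. (pos X q \<and> \<not> neg X q) \<or> matched n X q)) =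
      card (?N (\<lambda>q. pos X q \<and> \<not> neg X q)) + card (?N (matched n X))"
    by (rule un; auto simp: matched_def free_def)+
  have "X \<subseteq> letters n" using assms by (simp add: adm_def)
  then have "card X = card (?N (pos X)) + card (?N (neg X))" by (rule c)
  then show "card (rcol n X) = card X" "card (lcol n X) = card X"
    unfolding c[OF rset_letters] b d m s by simp_all
qed

lemma no_both_adm:
  assumes "X \<subseteq> letters n" "\<And>p. 0 < p \<Longrightarrow> p \<le> n \<Longrightarrow> \<not> both X p"
  shows "adm n X"
proof -
  have "hgt X p \<le> p" if "p \<le> n" for p
    using that assms(2) by (induction p) (auto simp: both_def)
  then show ?thesis using assms(1) by (simp add: adm_def)
qed

lemma rcol_no_both: "0 < p \<Longrightarrow> p \<le> n \<Longrightarrow> \<not> both (rcol n X) p"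
  unfolding both_def rcol_bits matched_def free_def by blast

lemma no_both_RA_LA:
  assumes "\<And>p. 0 < p \<Longrightarrow> p \<le> n \<Longrightarrow> \<not> both X p"
  shows "RA n X = halves n (pos X) (neg X)" "LA n X = halves n (pos X) (neg X)"
  unfolding RA_def LA_def using assms matched_no_both[OF assms]
  by (auto intro!: halves_cong simp: both_def)

subsection \<open>The partners of the repeated letters\<close>

lemma length_t_list_from: "length (t_list_from C b zs) = length zs"
  by (induction C b zs rule: t_list_from.induct) (simp_all add: Let_def)

lemma card_split:
  assumes "finite A"
  shows "card A = card {x \<in> A. P x} + card {x \<in> A. \<not> P x}"
proof -
  have "A = {x \<in> A. P x} \<union> {x \<in> A. \<not> P x}" by auto
  then show ?thesis using assms
    by (metis (no_types, lifting) card_Un_disjoint disjoint_iff finite_Un mem_Collect_eq)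
qed

definition partners :: "nat \<Rightarrow> int set \<Rightarrow> nat set" where
  "partners n X = {t. 0 < t \<and> t \<le> n \<and> matched n X t}"

definition repeats :: "nat \<Rightarrow> int set \<Rightarrow> nat set" where
  "repeats n X = {z. 0 < z \<and> z \<le> n \<and> both X z}"

lemma finite_partners: "finite (partners n X)" "finite (repeats n X)"
  unfolding partners_def repeats_def by (rule finite_subset[of _ "{..n}"]; auto)+

lemma gap_partners:
  assumes "t \<le> n"
  shows "gap n X t + card {s \<in> partners n X. t < s} = card {z \<in> repeats n X. t < z}"
proof -
  have "{s \<in> partners n X. t < s} = {s. t < s \<and> s \<le> n \<and> matched n X s}"
    "{z \<in> repeats n X. t < z} = {z. t < z \<and> z \<le> n \<and> both X z}"
    by (auto simp: partners_def repeats_def)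
  then show ?thesis using gap_card[OF assms, of X] by simp
qed

lemma card_partners: "adm n X \<Longrightarrow> card (partners n X) = card (repeats n X)"
  using card_both_matched unfolding partners_def repeats_def .

lemma z_list_props:
  "set (z_list n C) = int ` repeats n (set C)" "distinct (z_list n C)" "sorted_wrt (>) (z_list n C)"
proof -
  have "z \<in> set (z_list n C) \<longleftrightarrow> z \<in> int ` repeats n (set C)" for z
  proof
    assume "z \<in> set (z_list n C)"
    then have "z = int (nat z)" "nat z \<in> repeats n (set C)"
      by (auto simp: z_list_def repeats_def both_def pos_def neg_def)
    then show "z \<in> int ` repeats n (set C)" by blast
  qed (auto simp: z_list_def repeats_def both_def pos_def neg_def)
  then show "set (z_list n C) = int ` repeats n (set C)" by blast
  show "distinct (z_list n C)" by (simp add: z_list_def)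
  have "sorted_wrt (<) [1..int n]" by (simp add: strict_sorted_iff)
  then show "sorted_wrt (>) (z_list n C)"
    by (simp add: z_list_def sorted_wrt_rev sorted_wrt_filter)
qed

lemma length_z_list: "length (z_list n C) = card (repeats n (set C))"
  using distinct_card[OF z_list_props(2), of n C] z_list_props(1)[of n C]
  by (simp add: card_image)

text \<open>Invariant of the greedy choice: \<open>zs0\<close> are the repeated letters already
  served, and as many matched letters are at least \<open>b\<close>. The next choice then has more
  repeated than matched letters above it, so its \<open>gap\<close> is positive and it is matched as
  well.\<close>

lemma t_list_from_partners:
  assumes X: "adm n (set C)"
  defines "M \<equiv> partners n (set C)"
  assumes "z_list n C = zs0 @ zs" "card {t \<in> M. b \<le> int t} = length zs0"
  shows "set (t_list_from C b zs) = int ` {t \<in> M. int t < b}"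
  using assms(3-4)
proof (induction zs arbitrary: zs0 b)
  case (Nil zs0 b)
  have fin: "finite M" unfolding M_def by (rule finite_partners)
  have "card M = length zs0"
    using Nil(1) length_z_list[of n C] card_partners[OF X] by (simp add: M_def)
  then have "card {t \<in> M. \<not> b \<le> int t} = 0"
    using Nil(2) card_split[OF fin, of "\<lambda>t. b \<le> int t"] by simp
  then have "{t \<in> M. \<not> b \<le> int t} = {}" using fin by simp
  then show ?case by auto
next
  case (Cons z zs zs0 b)
  define Z where "Z = repeats n (set C)"
  define B where "B = {t \<in> M. b \<le> int t}"
  have fin: "finite M" "finite Z" unfolding M_def Z_def by (rule finite_partners)+
  have gap: "gap n (set C) t + card {s \<in> M. t < s} = card {z \<in> Z. t < z}" if "t \<le> n" for t
    unfolding M_def Z_def by (rule gap_partners[OF that])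
  have zl: "set (zs0 @ z # zs) = int ` Z" "sorted_wrt (>) (zs0 @ z # zs)" "distinct (zs0 @ z # zs)"
    using z_list_props[of n C] unfolding Cons.prems(1) Z_def by auto
  then obtain zn where zn: "z = int zn" "zn \<in> Z" by (auto simp: image_iff)
  have znn: "0 < zn" "zn \<le> n" using zn(2) by (auto simp: Z_def repeats_def)
  have few: "card {z \<in> Z. s < z} \<le> length zs0" if "zn \<le> s" for s
  proof -
    have "int ` {z \<in> Z. s < z} \<subseteq> set zs0"
    proof
      fix y assume "y \<in> int ` {z \<in> Z. s < z}"
      then have "y \<in> set (zs0 @ z # zs)" "z < y" unfolding zl(1) using that zn(1) by auto
      then show "y \<in> set zs0" using zl(2) by (auto simp: sorted_wrt_append)
    qed
    then have "card (int ` {z \<in> Z. s < z}) \<le> card (set zs0)" by (rule card_mono[OF finite_set])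
    then show ?thesis using card_length[of zs0] by (simp add: card_image)
  qed
  have many: "length zs0 + 1 \<le> card {z \<in> Z. s < z}" if "s < zn" for s
  proof -
    have "set (zs0 @ [z]) \<subseteq> int ` {z \<in> Z. s < z}"
    proof
      fix y assume y: "y \<in> set (zs0 @ [z])"
      then have "y \<in> int ` Z" "z \<le> y" using zl(1,2) by (auto simp: sorted_wrt_append)
      then show "y \<in> int ` {z \<in> Z. s < z}" using that zn(1) by auto
    qed
    then have "card (set (zs0 @ [z])) \<le> card (int ` {z \<in> Z. s < z})"
      by (rule card_mono[rotated]) (simp add: fin)
    moreover have "card (set (zs0 @ [z])) = length zs0 + 1"
      using zl(3) distinct_card[of "zs0 @ [z]"] by simp
    ultimately show ?thesis by (simp add: card_image)
  qed
  have below: "s < zn" if s: "s \<in> M" "int s < b" for s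
  proof (rule ccontr)
    assume "\<not> s < zn"
    moreover have "B \<subseteq> {t \<in> M. s < t}" using s(2) by (auto simp: B_def)
    then have "card B \<le> card {t \<in> M. s < t}" by (rule card_mono[rotated]) (simp add: fin)
    moreover have "s \<le> n" "0 < gap n (set C) s" using s(1) by (auto simp: M_def partners_def matched_def)
    ultimately show False using few[of s] gap[of s] Cons.prems(2) by (simp add: B_def)
  qed
  define F where "F = {t. 1 \<le> t \<and> t < min b z \<and> t \<notin> set C \<and> - t \<notin> set C}"
  have inF: "int s \<in> F" if "s \<in> M" "int s < b" for s
    using that below[OF that] zn(1)
    by (auto simp: F_def M_def partners_def matched_def free_def pos_def neg_def)
  have finF: "finite F" by (rule finite_subset[of _ "{1..z}"]) (auto simp: F_def)
  have "card M = length (zs0 @ z # zs)"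
    using length_z_list[of n C] card_partners[OF X] unfolding Cons.prems(1) M_def by simp
  then have "card {t \<in> M. \<not> b \<le> int t} \<noteq> 0"
    using Cons.prems(2) card_split[OF fin(1), of "\<lambda>t. b \<le> int t"] by simp
  then have "{t \<in> M. \<not> b \<le> int t} \<noteq> {}" by (metis card.empty)
  then have neF: "F \<noteq> {}" using inF by fastforce
  define t where "t = Max F"
  have t: "t \<in> F" "\<And>s. s \<in> F \<Longrightarrow> s \<le> t" unfolding t_def using finF neF by auto
  define tn where "tn = nat t"
  have tn: "int tn = t" "tn < zn" "0 < tn" "free (set C) tn" "t < b"
    using t(1) zn(1) by (auto simp: F_def tn_def free_def pos_def neg_def)
  \<comment> \<open>Matched letters below \<open>b\<close> are candidates in \<open>F\<close>, so
    none of them lies strictly between \<open>tn\<close> and \<open>b\<close>.\<close>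
  have above: "{s \<in> M. tn < s} = B"
    using inF t(2) tn(1,5) by (fastforce simp: B_def)
  have "0 < gap n (set C) tn"
    using gap[of tn] many[OF tn(2)] tn(2) znn(2) Cons.prems(2) unfolding above by (simp add: B_def)
  then have tM: "tn \<in> M" using tn znn by (simp add: M_def partners_def matched_def)
  have ins: "{s \<in> M. t \<le> int s} = insert tn B" using above tM tn(1) by auto
  have "tn \<notin> B" using tn(1,5) by (auto simp: B_def)
  then have "card {s \<in> M. t \<le> int s} = length (zs0 @ [z])"
    unfolding ins using fin(1) Cons.prems(2) by (simp add: B_def)
  then have IH: "set (t_list_from C t zs) = int ` {s \<in> M. int s < t}"
    using Cons.IH[of "zs0 @ [z]" t] Cons.prems(1) by simp
  have "s = tn \<or> int s < t" if "s \<in> M" "int s < b" for s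
  proof (rule ccontr)
    assume "\<not> (s = tn \<or> int s < t)"
    then have "s \<in> {s \<in> M. tn < s}" using that(1) tn(1) by auto
    then show False using that(2) unfolding above B_def by simp
  qed
  then have "{s \<in> M. int s < b} = insert tn {s \<in> M. int s < t}"
    using tM tn(1,5) by auto
  then show ?case using IH tn(1) unfolding t_list_from.simps F_def[symmetric] t_def[symmetric]
    by (simp add: Let_def)
qed

lemma set_t_list:
  assumes "adm n (set C)"
  shows "set (t_list n C) = int ` partners n (set C)" "length (t_list n C) = length (z_list n C)"
proof -
  have "{t \<in> partners n (set C). int n + 1 \<le> int t} = {}" by (auto simp: partners_def)
  then have "card {t \<in> partners n (set C). int n + 1 \<le> int t} = length []"
    by (simp only: card.empty list.size)
  from t_list_from_partners[OF assms _ this] show "set (t_list n C) = int ` partners n (set C)"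
    unfolding t_list_def by (auto simp: partners_def)
qed (simp add: t_list_def length_t_list_from)

lemma map_of_zip_image:
  assumes "distinct ks" "length ks = length vs"
  shows "map_of (zip ks vs) ` set ks = Some ` set vs"
  using assms(2,1)
proof (induction ks vs rule: list_induct2)
  case (Cons k ks v vs)
  have "(map_of (zip (k # ks) (v # vs))) ` set ks = map_of (zip ks vs) ` set ks"
    using Cons.prems by (intro image_cong) auto
  then show ?case using Cons by simp
qed simp

section \<open>Columns as sorted lists; identification of the right and left columns\<close>

lemma rank_inj: "inj_on (rank n) (letters n)"
  by (auto simp: inj_on_def rank_def letters_def split: if_splits)

lemma sorted_alph: "sorted_wrt (\<lambda>x y. rank n x < rank n y) (alph n)"
proof -
  have "sorted_wrt (<) [1..int n]" "sorted_wrt (<) [- int n..- 1]" by (simp_all add: strict_sorted_iff)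
  note s = this
  have "sorted_wrt (\<lambda>x y. rank n x < rank n y) [1..int n]"
    by (rule sorted_wrt_mono_rel[OF _ s(1)]) (auto simp: rank_def)
  moreover have "sorted_wrt (\<lambda>x y. rank n x < rank n y) [- int n..- 1]"
    by (rule sorted_wrt_mono_rel[OF _ s(2)]) (auto simp: rank_def)
  ultimately show ?thesis by (auto simp: alph_def sorted_wrt_append rank_def)
qed

lemma sorted_colw: "sorted_wrt (\<lambda>x y. rank n x < rank n y) (colw n X)"
  unfolding colw_def by (rule sorted_wrt_filter[OF sorted_alph])

lemma colw_unique:
  assumes "sorted_wrt (\<lambda>x y. rank n x < rank n y) C" "set C \<subseteq> letters n"
  shows "C = colw n (set C)"
proof -
  have s: "sorted_wrt (<) (map (rank n) C)" "sorted_wrt (<) (map (rank n) (colw n (set C)))"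
    using assms(1) sorted_colw by (simp_all add: sorted_wrt_map)
  have e: "set (colw n (set C)) = set C" by (rule set_colw[OF assms(2)])
  then have "map (rank n) C = map (rank n) (colw n (set C))"
    using s by (intro strict_sorted_equal) auto
  then show ?thesis using inj_on_map_eq_map[of "rank n" C "colw n (set C)"] rank_inj[of n] assms(2) e
    by (metis inj_on_subset sup.idem)
qed

lemma is_column_colw: "is_column n (colw n X)"
  using sorted_colw by (auto simp: is_column_def colw_def set_alph)

lemma is_column_eq: "is_column n C \<Longrightarrow> C = colw n (set C)"
  using colw_unique by (auto simp: is_column_def)

lemma sort_key_colw:
  assumes "set l = X" "X \<subseteq> letters n" "length l = card X"
  shows "sort_key (rank n) l = colw n X"
proof -
  have d: "distinct l" using assms(1,3) by (metis card_distinct)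
  then have "distinct (map (rank n) (sort_key (rank n) l))"
    using rank_inj[of n] assms(1,2) by (auto simp: distinct_map intro: inj_on_subset)
  moreover have "sorted (map (rank n) (sort_key (rank n) l))" by simp
  ultimately have "sorted_wrt (<) (map (rank n) (sort_key (rank n) l))"
    by (simp add: strict_sorted_iff)
  then show ?thesis using colw_unique[of n "sort_key (rank n) l"] assms(1,2)
    by (simp add: sorted_wrt_map)
qed

text \<open>The column is sorted after the replacement, so it is determined by the set of its
  letters. This set is computed from the image of the finite map of partners on the repeated
  letters.\<close>

lemma right_column_colw:
  assumes X: "adm n X"
  shows "right_column n (colw n X) = colw n (rcol n X)" "left_column n (colw n X) = colw n (lcol n X)"
proof -
  have sub: "X \<subseteq> letters n" using X by (simp add: adm_def)
  define C where "C = colw n X"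
  have C: "set C = X" unfolding C_def by (rule set_colw[OF sub])
  have len: "length C = card X" unfolding C_def by (rule length_colw[OF sub])
  define m where "m = map_of (zip (z_list n C) (t_list n C))"
  have tl: "set (t_list n C) = int ` partners n X" "length (t_list n C) = length (z_list n C)"
    using set_t_list[of n C] X C by auto
  note zl = z_list_props[of n C, unfolded C]
  have img: "m ` int ` repeats n X = Some ` int ` partners n X"
    using map_of_zip_image[OF zl(2) tl(2)[symmetric]] unfolding zl(1) tl(1) m_def by simp
  have dom: "m x = None \<longleftrightarrow> x \<notin> int ` repeats n X" for x
    using map_of_zip_is_None[OF tl(2)[symmetric], of x] zl(1) by (simp add: m_def)
  define f where "f x = (case m (- x) of Some t \<Rightarrow> - t | None \<Rightarrow> x)" for x
  define g where "g x = (case m x of Some t \<Rightarrow> t | None \<Rightarrow> x)" for x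
  have "f ` X = {x \<in> X. - x \<notin> int ` repeats n X} \<union> uminus ` int ` partners n X"
  proof (intro equalityI subsetI)
    fix y assume "y \<in> f ` X"
    then obtain x where x: "x \<in> X" "y = f x" by blast
    show "y \<in> {x \<in> X. - x \<notin> int ` repeats n X} \<union> uminus ` int ` partners n X"
    proof (cases "m (- x)")
      case None
      then show ?thesis using x dom[of "- x"] by (simp add: f_def)
    next
      case (Some t)
      then have "- x \<in> int ` repeats n X" using dom[of "- x"] by auto
      then have "Some t \<in> m ` int ` repeats n X" using Some by force
      then have "t \<in> int ` partners n X" unfolding img by blast
      then show ?thesis using Some x by (simp add: f_def)
    qed
  next
    fix y assume "y \<in> {x \<in> X. - x \<notin> int ` repeats n X} \<union> uminus ` int ` partners n X"
    then show "y \<in> f ` X"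
    proof
      assume "y \<in> {x \<in> X. - x \<notin> int ` repeats n X}"
      then have "y = f y" "y \<in> X" using dom[of "- y"] by (auto simp: f_def)
      then show ?thesis by blast
    next
      assume "y \<in> uminus ` int ` partners n X"
      then obtain t where t: "y = - t" "t \<in> int ` partners n X" by blast
      then have "Some t \<in> m ` int ` repeats n X" unfolding img by blast
      then obtain z where z: "z \<in> repeats n X" "m (int z) = Some t" by force
      then have "- int z \<in> X" "f (- int z) = y"
        using t(1) by (auto simp: f_def repeats_def both_def neg_def)
      then show ?thesis by (metis imageI)
    qed
  qed
  moreover have "g ` X = {x \<in> X. x \<notin> int ` repeats n X} \<union> int ` partners n X"
  proof (intro equalityI subsetI)
    fix y assume "y \<in> g ` X"
    then obtain x where x: "x \<in> X" "y = g x" by blast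
    show "y \<in> {x \<in> X. x \<notin> int ` repeats n X} \<union> int ` partners n X"
    proof (cases "m x")
      case None
      then show ?thesis using x dom[of x] by (simp add: g_def)
    next
      case (Some t)
      then have "x \<in> int ` repeats n X" using dom[of x] by auto
      then have "Some t \<in> m ` int ` repeats n X" using Some by force
      then have "t \<in> int ` partners n X" unfolding img by blast
      then show ?thesis using Some x by (simp add: g_def)
    qed
  next
    fix y assume "y \<in> {x \<in> X. x \<notin> int ` repeats n X} \<union> int ` partners n X"
    then show "y \<in> g ` X"
    proof
      assume "y \<in> {x \<in> X. x \<notin> int ` repeats n X}"
      then have "y = g y" "y \<in> X" using dom[of y] by (auto simp: g_def)
      then show ?thesis by blast
    next
      assume "y \<in> int ` partners n X"
      then have "Some y \<in> m ` int ` repeats n X" unfolding img by blast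
      then obtain z where z: "z \<in> repeats n X" "m (int z) = Some y" by force
      then have "int z \<in> X" "g (int z) = y"
        by (auto simp: g_def repeats_def both_def pos_def)
      then show ?thesis by (metis imageI)
    qed
  qed
  moreover have "{x \<in> X. - x \<notin> int ` repeats n X} \<union> uminus ` int ` partners n X = rcol n X"
  proof (rule pos_neg_ext)
    show "{x \<in> X. - x \<notin> int ` repeats n X} \<union> uminus ` int ` partners n X \<subseteq> letters n"
      using sub by (auto simp: partners_def letters_def)
    fix p assume p: "0 < p" "p \<le> n"
    show "same ({x \<in> X. - x \<notin> int ` repeats n X} \<union> uminus ` int ` partners n X) (rcol n X) p"
      unfolding same_def rcol_bits[OF p]
      using p by (auto simp: pos_def neg_def partners_def repeats_def both_def)
  qed (rule rset_letters)
  moreover have "{x \<in> X. x \<notin> int ` repeats n X} \<union> int ` partners n X = lcol n X"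
  proof (rule pos_neg_ext)
    show "{x \<in> X. x \<notin> int ` repeats n X} \<union> int ` partners n X \<subseteq> letters n"
      using sub by (auto simp: partners_def letters_def)
    fix p assume p: "0 < p" "p \<le> n"
    show "same ({x \<in> X. x \<notin> int ` repeats n X} \<union> int ` partners n X) (lcol n X) p"
      unfolding same_def rcol_bits[OF p]
      using p by (auto simp: pos_def neg_def partners_def repeats_def both_def)
  qed (rule rset_letters)
  ultimately have s: "set (map f C) = rcol n X" "set (map g C) = lcol n X" using C by simp_all
  have "right_column n C = sort_key (rank n) (map f C)" "left_column n C = sort_key (rank n) (map g C)"
    unfolding right_column_def left_column_def f_def[abs_def] g_def[abs_def] m_def by simp_all
  then show "right_column n (colw n X) = colw n (rcol n X)" "left_column n (colw n X) = colw n (lcol n X)"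
    unfolding C_def[symmetric]
    using sort_key_colw[OF s(1) rset_letters] sort_key_colw[OF s(2) rset_letters]
      card_rcol_lcol[OF X] len by simp_all
qed

section \<open>Tableaux as lists of columns\<close>

definition XA :: "nat \<Rightarrow> int set \<Rightarrow> nat set" where
  "XA n X = halves n (pos X) (neg X)"

lemma XA_rcol: "XA n (rcol n X) = RA n X" "XA n (lcol n X) = LA n X"
  unfolding XA_def RA_def LA_def by (rule halves_cong; simp add: rset_mk_bits)+

lemma rank_range: "x \<in> letters n \<Longrightarrow> 0 < rank n x \<and> rank n x \<le> 2 * int n"
  by (auto simp: letters_def rank_def)

lemma XA_ranks:
  assumes "X \<subseteq> letters n"
  shows "XA n X = (\<lambda>x. nat (rank n x)) ` X"
  unfolding XA_def
proof (rule halves_eqI[symmetric])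
  show "(\<lambda>x. nat (rank n x)) ` X \<subseteq> {1..2 * n}"
  proof
    fix y assume "y \<in> (\<lambda>x. nat (rank n x)) ` X"
    then obtain x where "x \<in> letters n" "y = nat (rank n x)" using assms by blast
    then show "y \<in> {1..2 * n}" using rank_range[of x n] by auto
  qed
  fix p assume p: "0 < p" "p \<le> n"
  have "x = int p" if "x \<in> X" "p = nat (rank n x)" for x
    using assms that p by (auto simp: letters_def rank_def split: if_splits)
  moreover have "p = nat (rank n (int p))" using p by (simp add: rank_def)
  ultimately have 1: "p \<in> (\<lambda>x. nat (rank n x)) ` X \<longleftrightarrow> pos X p"
    unfolding pos_def by (metis (no_types, lifting) imageE imageI)
  have "x = - int p" if "x \<in> X" "2 * n + 1 - p = nat (rank n x)" for x
    using assms that p by (auto simp: letters_def rank_def split: if_splits)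
  moreover have "2 * n + 1 - p = nat (rank n (- int p))" using p by (simp add: rank_def)
  ultimately have "2 * n + 1 - p \<in> (\<lambda>x. nat (rank n x)) ` X \<longleftrightarrow> neg X p"
    unfolding neg_def by (metis (no_types, lifting) imageE imageI)
  with 1 show "(p \<in> (\<lambda>x. nat (rank n x)) ` X \<longleftrightarrow> pos X p) \<and>
      (2 * n + 1 - p \<in> (\<lambda>x. nat (rank n x)) ` X \<longleftrightarrow> neg X p)" by blast
qed

section \<open>Entries of a column and counting functions of ranks\<close>

lemma cnt_XA:
  assumes "X \<subseteq> letters n"
  shows "cnt (XA n X) y = length (filter (\<lambda>x. rank n x \<le> int y) (colw n X))"
proof -
  have r: "0 < rank n x" if "x \<in> X" for x using that assms by (auto simp: letters_def rank_def)
  have "XA n X \<inter> {1..y} = (\<lambda>x. nat (rank n x)) ` {x \<in> X. rank n x \<le> int y}"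
    unfolding XA_ranks[OF assms] using r by (force simp: nat_le_iff)
  moreover have "inj_on (\<lambda>x. nat (rank n x)) {x \<in> X. rank n x \<le> int y}"
    using r rank_inj[of n] assms by (auto simp: inj_on_def) (metis eq_nat_nat_iff less_imp_le subsetD)
  ultimately have "cnt (XA n X) y = card {x \<in> X. rank n x \<le> int y}"
    by (simp add: cnt_eq_card card_image)
  also have "\<dots> = length (filter (\<lambda>x. rank n x \<le> int y) (colw n X))"
  proof -
    have "set (filter (\<lambda>x. rank n x \<le> int y) (colw n X)) = {x \<in> X. rank n x \<le> int y}"
      using set_colw[OF assms] by auto
    moreover have "distinct (filter (\<lambda>x. rank n x \<le> int y) (colw n X))"
      by (simp add: colw_def distinct_alph)
    ultimately show ?thesis by (metis distinct_card)
  qed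
  finally show ?thesis .
qed

lemma cnt_XA_full: "X \<subseteq> letters n \<Longrightarrow> cnt (XA n X) (2 * n) = card X"
proof -
  assume X: "X \<subseteq> letters n"
  have "filter (\<lambda>x. rank n x \<le> int (2 * n)) (colw n X) = colw n X"
    using X set_colw[OF X] by (intro filter_True) (auto simp: letters_def rank_def)
  then show ?thesis using cnt_XA[OF X, of "2 * n"] length_colw[OF X] by simp
qed

lemma nth_le_iff_filter:
  fixes f :: "'a \<Rightarrow> int"
  assumes "sorted_wrt (\<lambda>x y. f x < f y) u" "q < length u"
  shows "f (u ! q) \<le> y \<longleftrightarrow> q < length (filter (\<lambda>x. f x \<le> y) u)"
  using assms
proof (induction u arbitrary: q)
  case (Cons x u)
  show ?case
  proof (cases "f x \<le> y")
    case True
    then show ?thesis using Cons by (cases q) auto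
  next
    case False
    then have "\<forall>z\<in>set u. \<not> f z \<le> y" using Cons.prems(1) by auto
    moreover have "(x # u) ! q \<in> set (x # u)" using Cons.prems(2) by (rule nth_mem)
    ultimately show ?thesis using False by auto
  qed
qed simp

text \<open>Translates conditions on rows into inequalities between counting functions, the form in
  which the crystal operators preserve them.\<close>

lemma colw_nth_le:
  assumes "X \<subseteq> letters n" "q < card X"
  shows "rank n (colw n X ! q) \<le> int y \<longleftrightarrow> q < cnt (XA n X) y"
  unfolding cnt_XA[OF assms(1)]
  by (rule nth_le_iff_filter[OF sorted_colw]) (simp add: length_colw assms)

lemma rank_nonneg: "x \<in> letters n \<Longrightarrow> rank n x = int (nat (rank n x))"
  by (auto simp: letters_def rank_def)

text \<open>The letters of absolute value at most \<open>i\<close> are those of rank at most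
  \<open>i\<close> or greater than \<open>2 * n - i\<close>.\<close>

lemma hgt_cnt:
  "i \<le> n \<Longrightarrow> hgt X i + cnt (XA n X) (2 * n - i) = cnt (XA n X) i + cnt (XA n X) (2 * n)"
proof (induction i)
  case (Suc i)
  then have e: "2 * n - i = Suc (2 * n - Suc i)" "2 * n - i = 2 * n + 1 - Suc i" by auto
  have "2 * n - i \<in> XA n X \<longleftrightarrow> neg X (Suc i)" "Suc i \<in> XA n X \<longleftrightarrow> pos X (Suc i)"
    using Suc.prems halves_mem[of "Suc i" n "pos X" "neg X"] unfolding e(2) XA_def by auto
  then have "cnt (XA n X) (2 * n - i) = cnt (XA n X) (2 * n - Suc i) + (if neg X (Suc i) then 1 else 0)"
    "cnt (XA n X) (Suc i) = cnt (XA n X) i + (if pos X (Suc i) then 1 else 0)"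
    using e(1) by auto
  then show ?case using Suc by simp
qed simp

lemma colw_index:
  assumes "X \<subseteq> letters n" "q < card X" "rank n (colw n X ! q) = int y" "0 < y"
  shows "cnt (XA n X) y = Suc q"
proof -
  obtain m where m: "y = Suc m" using assms(4) by (cases y) auto
  have "q < cnt (XA n X) y" "\<not> q < cnt (XA n X) m"
    using colw_nth_le[OF assms(1,2), of y] colw_nth_le[OF assms(1,2), of m] assms(3) m by auto
  then show ?thesis by (auto simp: m split: if_splits)
qed

text \<open>If \<open>i\<close> and \<open>- i\<close> both occur, their row numbers from the top
  and from the bottom count the unbarred and the barred letters of absolute value at most
  \<open>i\<close>, with sum \<open>hgt X i\<close>. At other positions the bound is inherited from
  the previous one.\<close>

lemma admissible_colw:
  assumes X: "X \<subseteq> letters n"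
  shows "admissible n (colw n X) \<longleftrightarrow> adm n X"
proof -
  let ?C = "colw n X"
  have len: "length ?C = card X" by (rule length_colw[OF X])
  have sum: "(a + 1) + (b + 1) = hgt X i"
    if i: "i \<in> {1..n}" "a < length ?C" "b < length ?C" "?C ! a = int i" "rev ?C ! b = - int i" for i a b
  proof -
    have "rank n (?C ! a) = int i" using i by (simp add: rank_def)
    then have 1: "cnt (XA n X) i = Suc a" using colw_index[OF X _ _] i len by simp
    define a' where "a' = length ?C - Suc b"
    have a': "a' < card X" "?C ! a' = - int i" using i(3,5) len by (auto simp: a'_def rev_nth)
    then have "rank n (?C ! a') = int (2 * n + 1 - i)" using i(1) by (simp add: rank_def)
    from colw_index[OF X a'(1) this] i(1) have 2: "cnt (XA n X) (2 * n + 1 - i) = Suc a'" by simp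
    have "2 * n + 1 - i \<in> XA n X"
    proof -
      have "- int i \<in> X" using a' set_colw[OF X] len nth_mem by metis
      then show ?thesis using i(1) halves_mem(2)[of i n "pos X" "neg X"] by (simp add: XA_def neg_def)
    qed
    moreover have "2 * n + 1 - i = Suc (2 * n - i)" using i(1) by auto
    ultimately have "cnt (XA n X) (2 * n - i) = a'" using 2 by simp
    then show ?thesis using hgt_cnt[of i n X] 1 cnt_XA_full[OF X] i(1,3) len by (simp add: a'_def)
  qed
  have "(\<forall>i\<in>{1..n}. \<forall>a<length ?C. \<forall>b<length ?C.
        ?C ! a = int i \<and> rev ?C ! b = - int i \<longrightarrow> (a + 1) + (b + 1) \<le> i) \<longleftrightarrow>
      (\<forall>p\<le>n. hgt X p \<le> p)"
  proof
    assume r: "\<forall>p\<le>n. hgt X p \<le> p"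
    show "\<forall>i\<in>{1..n}. \<forall>a<length ?C. \<forall>b<length ?C.
        ?C ! a = int i \<and> rev ?C ! b = - int i \<longrightarrow> (a + 1) + (b + 1) \<le> i"
      using sum r by (metis atLeastAtMost_iff)
  next
    assume l: "\<forall>i\<in>{1..n}. \<forall>a<length ?C. \<forall>b<length ?C.
        ?C ! a = int i \<and> rev ?C ! b = - int i \<longrightarrow> (a + 1) + (b + 1) \<le> i"
    have bo: "hgt X i \<le> i" if i: "i \<in> {1..n}" "both X i" for i
    proof -
      have "int i \<in> set ?C" "- int i \<in> set (rev ?C)"
        using i(2) set_colw[OF X] by (auto simp: both_def pos_def neg_def)
      then obtain a b where "a < length ?C" "?C ! a = int i" "b < length ?C" "rev ?C ! b = - int i"
        by (metis in_set_conv_nth length_rev)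
      then show ?thesis using sum[of i a b] l i(1) by metis
    qed
    have "hgt X p \<le> p" if "p \<le> n" for p
      using that
    proof (induction p)
      case (Suc p)
      then show ?case using bo[of "Suc p"] by (cases "both X (Suc p)") (auto simp: both_def)
    qed simp
    then show "\<forall>p\<le>n. hgt X p \<le> p" by blast
  qed
  then show ?thesis using X is_column_colw[of n X] by (simp add: admissible_def adm_def)
qed

subsection \<open>Comparison of a column with its left and right columns\<close>

text \<open>For \<open>x \<le> n\<close> the difference is \<open>gap n X x\<close>: the repeated
  letters above \<open>x\<close> that are replaced by partners not above \<open>x\<close>. For
  larger ranks nothing changes.\<close>

lemma cnt_XA_LA:
  assumes "adm n X"
  shows "cnt (XA n X) x \<le> cnt (LA n X) x"
proof -
  have low: "cnt (LA n X) x = cnt (XA n X) x + gap n X x" if "x \<le> n" for x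
    using that
  proof (induction x)
    case 0
    then show ?case using adm_gap_0[OF assms] by simp
  next
    case (Suc x)
    have "Suc x \<in> XA n X \<longleftrightarrow> pos X (Suc x)"
      "Suc x \<in> LA n X \<longleftrightarrow> pos X (Suc x) \<and> \<not> neg X (Suc x) \<or> matched n X (Suc x)"
      unfolding XA_def LA_def by (rule halves_mem(1); use Suc.prems in simp)+
    then show ?case using Suc gap_rec[of x n X]
      by (auto simp: matched_def both_def free_def split: if_splits)
  qed
  show ?thesis
  proof (cases "x \<le> n")
    case True
    then show ?thesis using low by simp
  next
    case False
    then have "n \<le> x" by simp
    then have "cnt (LA n X) x = cnt (XA n X) x"
    proof (induction x rule: dec_induct)
      case base
      then show ?case using low[of n] by (simp add: gap_ge)
    next
      case (step m)
      then have "Suc m \<in> LA n X \<longleftrightarrow> Suc m \<in> XA n X" by (auto simp: LA_def XA_def halves_def)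
      then show ?case using step by simp
    qed
    then show ?thesis by simp
  qed
qed

text \<open>The mirror image of \<open>cnt_XA_LA\<close>: the two columns agree up to rank
  \<open>n\<close>, and at rank \<open>2 * n - p\<close> the difference is
  \<open>gap n X p\<close>.\<close>

lemma cnt_RA_XA:
  assumes "adm n X"
  shows "cnt (RA n X) x \<le> cnt (XA n X) x"
proof -
  have low: "cnt (RA n X) x = cnt (XA n X) x" if "x \<le> n" for x
    using that
  proof (induction x)
    case (Suc x)
    have "Suc x \<in> XA n X \<longleftrightarrow> pos X (Suc x)" "Suc x \<in> RA n X \<longleftrightarrow> pos X (Suc x)"
      unfolding XA_def RA_def by (rule halves_mem(1); use Suc.prems in simp)+
    then show ?case using Suc by auto
  qed simp
  have up: "cnt (XA n X) (2 * n - p) = cnt (RA n X) (2 * n - p) + gap n X p" if "p \<le> n" for p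
    using that
  proof (induction p rule: inc_induct)
    case base
    then show ?case using low[of n] by (simp add: gap_ge mult_2)
  next
    case (step p)
    have e: "2 * n - p = Suc (2 * n - Suc p)" "2 * n - p = 2 * n + 1 - Suc p" using step by auto
    have "2 * n - p \<in> XA n X \<longleftrightarrow> neg X (Suc p)"
      "2 * n - p \<in> RA n X \<longleftrightarrow> neg X (Suc p) \<and> \<not> pos X (Suc p) \<or> matched n X (Suc p)"
      unfolding e(2) XA_def RA_def by (rule halves_mem(2); use step in simp)+
    moreover have "cnt U (2 * n - p) = cnt U (2 * n - Suc p) + (if 2 * n - p \<in> U then 1 else 0)" for U
      using e(1) by simp
    ultimately show ?case using step gap_rec[of p n X]
      by (auto simp: matched_def both_def free_def split: if_splits)
  qed
  consider "x \<le> n" | "n < x" "x \<le> 2 * n" | "2 * n < x" by linarith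
  then show ?thesis
  proof cases
    case 1
    then show ?thesis using low by simp
  next
    case 2
    then show ?thesis using up[of "2 * n - x"] by simp
  next
    case 3
    then have "2 * n \<le> x" by simp
    then show ?thesis
    proof (induction x rule: dec_induct)
      case base
      then show ?case using up[of 0] by simp
    next
      case (step m)
      then have "Suc m \<notin> XA n X" "Suc m \<notin> RA n X" by (auto simp: RA_def XA_def halves_def)
      then show ?case using step by simp
    qed
  qed
qed

subsection \<open>Semistandard fillings\<close>

text \<open>The first argument is the left column; a column is given with the number of rows above it.\<close>

definition beside :: "nat \<Rightarrow> nat \<times> int list \<Rightarrow> nat \<times> int list \<Rightarrow> bool" where
  "beside n c c' \<longleftrightarrow> fst c' \<le> fst c \<and> fst c' + length (snd c') \<le> fst c + length (snd c) \<and>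
     (\<forall>i. fst c \<le> i \<and> i < fst c' + length (snd c') \<longrightarrow>
        rank n (snd c ! (i - fst c)) \<le> rank n (snd c' ! (i - fst c')))"

text \<open>Tops and bottoms rise weakly from left to right, so a row common to the outer columns
  meets the middle one. Hence semistandardness can be checked on adjacent columns.\<close>

lemma transp_beside: "transp (beside n)"
proof (rule transpI)
  fix a b c assume ab: "beside n a b" and bc: "beside n b c"
  have "rank n (snd a ! (i - fst a)) \<le> rank n (snd c ! (i - fst c))"
    if "fst a \<le> i" "i < fst c + length (snd c)" for i
  proof -
    have "fst b \<le> i" "i < fst b + length (snd b)" using that ab bc by (auto simp: beside_def)
    then show ?thesis using that ab bc unfolding beside_def by (metis order_trans)
  qed
  then show "beside n a c" using ab bc by (auto simp: beside_def)
qed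

lemma semistandardI:
  assumes "successively (beside n) S" "\<forall>c\<in>set S. is_column n (snd c)"
  shows "semistandard n S"
proof -
  have sw: "sorted_wrt (beside n) S"
    using assms(1) transp_beside successively_conv_sorted_wrt by blast
  have col: "is_column n (snd (S ! j))" if "(i, j) \<in> cells S" for i j
    using that assms(2) by (auto simp: cells_def)
  have 1: "entry S i j \<in> letters n" if "(i, j) \<in> cells S" for i j
    using col[OF that] that by (auto simp: cells_def entry_def is_column_def dest!: subsetD)
  have 2: "rank n (entry S i j) < rank n (entry S i' j)"
    if "(i, j) \<in> cells S" "(i', j) \<in> cells S" "i < i'" for i i' j
    using col[OF that(1)] that
      sorted_wrt_nth_less[of "\<lambda>x y. rank n x < rank n y" "snd (S ! j)" "i - fst (S ! j)" "i' - fst (S ! j)"]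
    by (auto simp: is_column_def cells_def entry_def)
  have 3: "rank n (entry S i j) \<le> rank n (entry S i j')"
    if "(i, j) \<in> cells S" "(i, j') \<in> cells S" "j < j'" for i j j'
    using sorted_wrt_nth_less[OF sw that(3)] that by (auto simp: cells_def entry_def beside_def)
  show ?thesis unfolding semistandard_def using 1 2 3 by blast
qed

lemma beside_if_sst:
  assumes "X \<subseteq> letters n" "Y \<subseteq> letters n" "sst d (XA n X) (XA n Y)" "p = q + d"
    and "q + card X \<le> p + card Y"
  shows "beside n (p, colw n Y) (q, colw n X)"
  unfolding beside_def fst_conv snd_conv length_colw[OF assms(1)] length_colw[OF assms(2)]
proof (intro conjI allI impI)
  fix i assume i: "p \<le> i \<and> i < q + card X"
  have x: "i - q < card X" and y: "i - p < card Y" using i assms(4,5) by auto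
  have "colw n X ! (i - q) \<in> letters n"
    using x set_colw[OF assms(1)] length_colw[OF assms(1)] assms(1) nth_mem by (metis subsetD)
  then obtain r where r: "rank n (colw n X ! (i - q)) = int r" using rank_nonneg by metis
  then have "i - q < cnt (XA n X) r" using colw_nth_le[OF assms(1) x, of r] by simp
  also have "\<dots> \<le> cnt (XA n Y) r + d" using assms(3) by (simp add: sst_def)
  finally have "i - p < cnt (XA n Y) r" using i assms(4) by linarith
  then show "rank n (colw n Y ! (i - p)) \<le> rank n (colw n X ! (i - q))"
    using colw_nth_le[OF assms(2) y, of r] r by simp
qed (use assms in auto)

lemma sst_if_entries:
  assumes "X \<subseteq> letters n" "Y \<subseteq> letters n" "card X \<le> card Y"
    and "\<And>i. i < card X \<Longrightarrow> rank n (colw n Y ! i) \<le> rank n (colw n X ! i)"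
  shows "sst 0 (XA n X) (XA n Y)"
  unfolding sst_def
proof
  fix x
  show "cnt (XA n X) x \<le> cnt (XA n Y) x + 0"
  proof (cases "cnt (XA n X) x")
    case (Suc q)
    have "cnt (XA n X) x \<le> card X"
      unfolding cnt_XA[OF assms(1)] length_colw[OF assms(1), symmetric] by (rule length_filter_le)
    then have q: "q < card X" using Suc by simp
    then have "rank n (colw n X ! q) \<le> int x" using colw_nth_le[OF assms(1) q, of x] Suc by simp
    then have "rank n (colw n Y ! q) \<le> int x" using assms(4)[OF q] by simp
    moreover have "q < card Y" using q assms(3) by simp
    ultimately show ?thesis using colw_nth_le[OF assms(2), of q x] Suc by simp
  qed simp
qed

subsection \<open>Shapes\<close>

text \<open>For a nonincreasing list of column heights this is the list of row lengths; the first
  height is the number of rows.\<close>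

definition conjugate :: "nat list \<Rightarrow> nat list" where
  "conjugate bs = map (\<lambda>i. length (filter (\<lambda>b. i < b) bs)) [0..<(if bs = [] then 0 else hd bs)]"

lemma filter_mono_length:
  "(\<And>x. x \<in> set xs \<Longrightarrow> P x \<Longrightarrow> Q x) \<Longrightarrow> length (filter P xs) \<le> length (filter Q xs)"
  by (induction xs) (auto simp: le_SucI)

lemma conjugate_partition: "is_partition (conjugate bs)"
  unfolding is_partition_def
proof
  show "sorted_wrt (\<ge>) (conjugate bs)"
    unfolding conjugate_def sorted_wrt_map
    by (rule sorted_wrt_mono_rel[OF _ sorted_wrt_upt]) (auto intro: filter_mono_length)
  show "0 \<notin> set (conjugate bs)"
    by (cases bs) (auto simp: conjugate_def)
qed

lemma nth_less_iff_filter: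
  assumes "sorted_wrt (\<ge>) bs" "j < length bs"
  shows "j < length (filter (\<lambda>b. i < b) bs) \<longleftrightarrow> i < (bs ! j :: nat)"
  using assms
proof (induction bs arbitrary: j)
  case (Cons b bs)
  show ?case
  proof (cases "i < b")
    case True
    then show ?thesis using Cons by (cases j) auto
  next
    case False
    then have "\<forall>c\<in>set bs. \<not> i < c" using Cons.prems(1) by auto
    moreover have "(b # bs) ! j \<in> set (b # bs)" using Cons.prems(2) by (rule nth_mem)
    ultimately show ?thesis using False by auto
  qed
qed simp

lemma col_height_conjugate:
  assumes "sorted_wrt (\<ge>) bs" "j < length bs"
  shows "col_height (conjugate bs) j = bs ! j"
proof -
  have "bs \<noteq> []" using assms(2) by auto
  have le: "bs ! j \<le> hd bs"
    using assms by (cases bs; cases j) auto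
  have "col_height (conjugate bs) j = length (filter (\<lambda>i. i < bs ! j) [0..<hd bs])"
    using nth_less_iff_filter[OF assms] \<open>bs \<noteq> []\<close>
    by (simp add: col_height_def conjugate_def filter_map comp_def)
  also have "filter (\<lambda>i. i < bs ! j) [0..<hd bs] = [0..<bs ! j]"
  proof -
    have "[0..<hd bs] = [0..<bs ! j] @ [bs ! j..<hd bs]"
      using le by (metis le0 upt_add_eq_append le_add_diff_inverse)
    then show ?thesis by (simp add: filter_empty_conv)
  qed
  finally show ?thesis by simp
qed

lemma has_shape_conjugate:
  assumes "sorted_wrt (\<ge>) (map fst S)" "sorted_wrt (\<ge>) (map (\<lambda>c. fst c + length (snd c)) S)"
    and "\<forall>c\<in>set S. snd c \<noteq> []"
  shows "has_shape (conjugate (map (\<lambda>c. fst c + length (snd c)) S)) (conjugate (map fst S)) S"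
proof -
  let ?b = "map (\<lambda>c. fst c + length (snd c)) S" and ?t = "map fst S"
  have "length (conjugate ?t) \<le> length (conjugate ?b)" by (cases S) (auto simp: conjugate_def)
  moreover have "conjugate ?t ! i \<le> conjugate ?b ! i" if "i < length (conjugate ?t)" for i
  proof -
    have "i < length (conjugate ?b)" using that calculation by simp
    then show ?thesis using that
      by (auto simp: conjugate_def filter_map comp_def intro!: filter_mono_length)
  qed
  moreover have "length S = width (conjugate ?b)"
  proof (cases S)
    case (Cons c S')
    have "0 < length (snd x)" if "x \<in> set S" for x using assms(3) that by simp
    then have "filter (\<lambda>b. 0 < b) ?b = ?b" by (intro filter_True) auto
    moreover have "0 < hd ?b" using Cons assms(3) by simp
    ultimately show ?thesis using Cons by (simp add: width_def conjugate_def hd_map upt_conv_Cons)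
  qed (simp add: conjugate_def width_def)
  moreover have "fst (S ! j) = col_height (conjugate ?t) j \<and>
      fst (S ! j) + length (snd (S ! j)) = col_height (conjugate ?b) j" if "j < length S" for j
    using col_height_conjugate[OF assms(1), of j] col_height_conjugate[OF assms(2), of j] that by simp
  ultimately show ?thesis unfolding has_shape_def using conjugate_partition by blast
qed

subsection \<open>Skew tableaux with prescribed columns\<close>

text \<open>
  Adjacent columns are aligned at the top if the left one is longer, and at the bottom otherwise.
\<close>

fun place :: "nat \<Rightarrow> int set list \<Rightarrow> (nat \<times> int set) list" where
  "place q [] = []"
| "place q [X] = [(q, X)]"
| "place q (X # Y # Xs) = (q, X) # place (q + (card X - card Y)) (Y # Xs)"

definition tab :: "nat \<Rightarrow> int set list \<Rightarrow> tableau" where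
  "tab n Xs = map (\<lambda>c. (fst c, colw n (snd c))) (rev (place 0 Xs))"

lemma map_snd_place: "map snd (place q Xs) = Xs"
  by (induction q Xs rule: place.induct) auto

lemma place_Cons: "\<exists>L. place q (X # Xs) = (q, X) # L"
  by (cases Xs) auto

lemma place_sorted: "sorted (map card Xs) \<Longrightarrow> c \<in> set (place q Xs) \<Longrightarrow> fst c = q"
  by (induction q Xs rule: place.induct) auto

text \<open>The second claim follows from the first, because entrywise a column lies between its
  left and its right column.\<close>

lemma beside_columns:
  assumes "adm n X" "adm n Y" "kn_pair n X Y"
  shows "beside n (q + (card X - card Y), colw n (rcol n Y)) (q, colw n (lcol n X))"
    "beside n (q + (card X - card Y), colw n Y) (q, colw n X)"
proof -
  have s: "X \<subseteq> letters n" "Y \<subseteq> letters n" using assms(1,2) by (auto simp: adm_def)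
  have k: "sst (card X - card Y) (LA n X) (RA n Y)" using assms(3) by (simp add: kn_pair_def)
  show "beside n (q + (card X - card Y), colw n (rcol n Y)) (q, colw n (lcol n X))"
    using k by (intro beside_if_sst[OF rset_letters rset_letters])
      (simp_all add: XA_rcol card_rcol_lcol assms)
  have "sst (card X - card Y) (XA n X) (XA n Y)"
    unfolding sst_def
  proof
    fix x
    show "cnt (XA n X) x \<le> cnt (XA n Y) x + (card X - card Y)"
      using k cnt_XA_LA[OF assms(1), of x] cnt_RA_XA[OF assms(2), of x]
      unfolding sst_def by (metis add_le_mono1 order_trans)
  qed
  then show "beside n (q + (card X - card Y), colw n Y) (q, colw n X)"
    by (intro beside_if_sst[OF s]) simp_all
qed

lemma beside_left_right:
  assumes "adm n X"
  shows "beside n (q, colw n (lcol n X)) (q, colw n (rcol n X))"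
proof (rule beside_if_sst[OF rset_letters rset_letters])
  show "sst 0 (XA n (rcol n X)) (XA n (lcol n X))"
    unfolding sst_def XA_rcol
    using cnt_XA_LA[OF assms] cnt_RA_XA[OF assms] by (metis add_0_right order_trans)
qed (simp_all add: card_rcol_lcol[OF assms])

lemma place_beside:
  assumes "adms n Xs" "kn_chain n Xs"
  shows "successively (\<lambda>a b. beside n (fst b, colw n (rcol n (snd b))) (fst a, colw n (lcol n (snd a))) \<and>
    beside n (fst b, colw n (snd b)) (fst a, colw n (snd a))) (place q Xs)"
  using assms
proof (induction q Xs rule: place.induct)
  case (3 q X Y Xs)
  obtain L where L: "place (q + (card X - card Y)) (Y # Xs) = (q + (card X - card Y), Y) # L"
    using place_Cons by blast
  have "adm n X" "adm n Y" "kn_pair n X Y" "adms n (Y # Xs)" "kn_chain n (Y # Xs)"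
    using 3(2,3) by (auto simp: kn_chain_def)
  then show ?case using beside_columns[of n X Y q] 3(1) by (simp add: L)
qed simp_all

lemma successively_pairs:
  assumes "successively (\<lambda>a b. P (r a) (l b)) L" "\<forall>a\<in>set L. P (l a) (r a)"
  shows "successively P (concat (map (\<lambda>a. [l a, r a]) L))"
  using assms by (induction L rule: induct_list012) auto

lemma nth_pairs:
  "j < length L \<Longrightarrow> concat (map (\<lambda>a. [l a, r a]) L) ! (2 * j) = l (L ! j) \<and>
    concat (map (\<lambda>a. [l a, r a]) L) ! Suc (2 * j) = r (L ! j)"
proof (induction L arbitrary: j)
  case (Cons a L)
  then show ?case by (cases j) auto
qed simp

lemma length_pairs: "length (concat (map (\<lambda>a. [l a, r a]) L)) = 2 * length L"
  by (induction L) auto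

lemma split_form_eq:
  "split_form n S = concat (map (\<lambda>c. [(fst c, left_column n (snd c)), (fst c, right_column n (snd c))]) S)"
  by (simp add: split_form_def case_prod_unfold)

text \<open>The shape is read off from the tops and bottoms of the placed columns; both are monotone
  because adjacent columns satisfy \<open>beside\<close>.\<close>

lemma tab_KN_skew:
  assumes "adms n Xs" "\<forall>X\<in>set Xs. X \<noteq> {}" "kn_chain n Xs"
  shows "tab n Xs \<in> KN_skew (conjugate (map (\<lambda>c. fst c + length (snd c)) (tab n Xs)))
    (conjugate (map fst (tab n Xs))) n"
proof -
  let ?S = "tab n Xs" and ?p = "place 0 Xs"
  have mem: "adm n (snd c) \<and> snd c \<noteq> {}" if "c \<in> set ?p" for c
  proof -
    have "snd c \<in> set (map snd ?p)" using that by simp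
    then show ?thesis using assms(1,2) unfolding map_snd_place by (simp add: list_all_iff)
  qed
  have sub: "X \<subseteq> letters n" if "adm n X" for X using that by (simp add: adm_def)
  have pb: "successively (\<lambda>a b. beside n (fst b, colw n (rcol n (snd b))) (fst a, colw n (lcol n (snd a))) \<and>
      beside n (fst b, colw n (snd b)) (fst a, colw n (snd a))) ?p"
    by (rule place_beside[OF assms(1,3)])
  have "successively (beside n) ?S"
    unfolding tab_def successively_map successively_rev by (rule successively_mono[OF pb]) auto
  moreover have "\<forall>c\<in>set ?S. is_column n (snd c)" by (auto simp: tab_def is_column_colw)
  ultimately have ss: "semistandard n ?S" "sorted_wrt (beside n) ?S"
    using semistandardI transp_beside successively_conv_sorted_wrt by blast+
  have sp: "split_form n ?S = concat (map (\<lambda>c. [(fst c, colw n (lcol n (snd c))),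
      (fst c, colw n (rcol n (snd c)))]) (rev ?p))"
    unfolding split_form_eq tab_def using mem
    by (auto simp: right_column_colw intro!: arg_cong[of _ _ concat])
  have "successively (beside n) (split_form n ?S)"
    unfolding sp
  proof (rule successively_pairs)
    show "successively (\<lambda>a b. beside n (fst a, colw n (rcol n (snd a))) (fst b, colw n (lcol n (snd b)))) (rev ?p)"
      unfolding successively_rev by (rule successively_mono[OF pb]) auto
  qed (use mem beside_left_right in auto)
  moreover have "\<forall>c\<in>set (split_form n ?S). is_column n (snd c)"
    unfolding sp by (auto simp: is_column_colw)
  ultimately have "semistandard n (split_form n ?S)" by (rule semistandardI)
  moreover have "has_shape (conjugate (map (\<lambda>c. fst c + length (snd c)) ?S)) (conjugate (map fst ?S)) ?S"
  proof (rule has_shape_conjugate)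
    show "sorted_wrt (\<ge>) (map fst ?S)" "sorted_wrt (\<ge>) (map (\<lambda>c. fst c + length (snd c)) ?S)"
      unfolding sorted_wrt_map
      by (rule sorted_wrt_mono_rel[OF _ ss(2)], simp add: beside_def)+
    show "\<forall>c\<in>set ?S. snd c \<noteq> []"
    proof
      fix c assume "c \<in> set ?S"
      then obtain d where d: "d \<in> set ?p" "snd c = colw n (snd d)" by (auto simp: tab_def)
      then have "set (snd c) = snd d" using set_colw[OF sub] mem by simp
      then show "snd c \<noteq> []" using mem[OF d(1)] by auto
    qed
  qed
  moreover have "\<forall>(t, C)\<in>set ?S. admissible n C"
    using mem sub by (auto simp: tab_def admissible_colw)
  ultimately show ?thesis using ss(1) unfolding KN_skew_def by blast
qed

lemma column_reading_tab: "column_reading (tab n Xs) = colsw n Xs"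
proof -
  have "rev (map snd (tab n Xs)) = map (colw n) (map snd (place 0 Xs))"
    by (simp add: tab_def rev_map comp_def)
  then show ?thesis unfolding column_reading_def colsw_def map_snd_place by simp
qed

lemma tab_sorted:
  assumes "sorted (map card Xs)"
  shows "tab n Xs = map (\<lambda>X. (0, colw n X)) (rev Xs)"
proof -
  have "tab n Xs = map (\<lambda>c. (0, colw n (snd c))) (rev (place 0 Xs))"
    unfolding tab_def using place_sorted[OF assms] by (intro map_cong) auto
  also have "\<dots> = map (\<lambda>X. (0, colw n X)) (rev (map snd (place 0 Xs)))" by (simp add: rev_map)
  finally show ?thesis unfolding map_snd_place .
qed

lemma tab_KN:
  assumes "adms n Xs" "\<forall>X\<in>set Xs. X \<noteq> {}" "kn_chain n Xs" "sorted (map card Xs)"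
  shows "\<exists>lam. length lam \<le> n \<and> tab n Xs \<in> KN lam n"
proof -
  define lam where "lam = conjugate (map (\<lambda>c. fst c + length (snd c)) (tab n Xs))"
  have "conjugate (map fst (tab n Xs)) = []"
    unfolding tab_sorted[OF assms(4)] by (cases "rev Xs") (auto simp: conjugate_def)
  then have "tab n Xs \<in> KN lam n"
    using tab_KN_skew[OF assms(1-3)] by (simp add: KN_def lam_def)
  moreover have "length lam \<le> n"
  proof (cases "rev Xs")
    case Nil
    then show ?thesis by (simp add: lam_def tab_def conjugate_def)
  next
    case (Cons X Ys)
    then have "X \<in> set Xs" by (metis list.set_intros(1) set_rev)
    then have X: "adm n X" using assms(1) by (auto simp: list_all_iff)
    then have "length (colw n X) \<le> n" using adm_card[OF X] length_colw by (auto simp: adm_def)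
    then show ?thesis by (simp add: lam_def tab_sorted[OF assms(4)] conjugate_def Cons)
  qed
  ultimately show ?thesis by blast
qed

text \<open>In the split form, column \<open>j\<close> occupies the positions \<open>2 * j\<close>
  and \<open>2 * j + 1\<close>. The positions \<open>2 * j + 1\<close> and \<open>2 * j + 2\<close>
  therefore give the \<open>kn_pair\<close> condition, with offset 0 as all tops are in the first
  row.\<close>

lemma KN_columns:
  assumes "T \<in> KN lam n"
  obtains Xs where "T = tab n Xs" "adms n Xs" "\<forall>X\<in>set Xs. X \<noteq> {}" "sorted (map card Xs)"
    "kn_chain n Xs"
proof -
  have sh: "has_shape lam [] T" and sp: "semistandard n (split_form n T)"
    and ad: "\<And>t C. (t, C) \<in> set T \<Longrightarrow> admissible n C"
    using assms unfolding KN_def KN_skew_def by auto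
  have fst0: "fst (T ! j) = 0" "length (snd (T ! j)) = col_height lam j" if "j < length T" for j
    using sh that unfolding has_shape_def col_height_def by fastforce+
  have pos: "0 < col_height lam j" if "j < length T" for j
  proof -
    have "lam \<noteq> []" "j < hd lam" using sh that by (auto simp: has_shape_def width_def split: if_splits)
    then have "hd lam \<in> set (filter (\<lambda>p. j < p) lam)" by simp
    then show ?thesis unfolding col_height_def by (metis length_pos_if_in_set)
  qed
  define Zs where "Zs = map (\<lambda>c. set (snd c)) T"
  define Xs where "Xs = rev Zs"
  have col: "snd c = colw n (set (snd c)) \<and> adm n (set (snd c)) \<and> set (snd c) \<subseteq> letters n" if "c \<in> set T" for c
  proof -
    have a: "admissible n (snd c)" using ad[of "fst c" "snd c"] that by simp
    then have "is_column n (snd c)" by (simp add: admissible_def)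
    then have "snd c = colw n (set (snd c))" "set (snd c) \<subseteq> letters n"
      using is_column_eq by (auto simp: is_column_def)
    then show ?thesis using a admissible_colw by metis
  qed
  have nz: "Zs ! j = set (snd (T ! j))" "card (Zs ! j) = col_height lam j" if "j < length T" for j
  proof -
    show 1: "Zs ! j = set (snd (T ! j))" using that by (simp add: Zs_def)
    have "T ! j \<in> set T" using that by simp
    then show "card (Zs ! j) = col_height lam j"
      using col[of "T ! j"] fst0(2)[OF that] length_colw unfolding 1 by metis
  qed
  have anti: "col_height lam j' \<le> col_height lam j" if "j \<le> j'" for j j'
    unfolding col_height_def using that by (intro filter_mono_length) auto
  have adX: "adms n Xs" using col by (auto simp: Xs_def Zs_def list_all_iff)
  have sorted: "sorted (map card Xs)"
  proof -
    have "sorted_wrt (\<lambda>x y. y \<le> x) (map card Zs)"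
      unfolding sorted_wrt_iff_nth_less using nz(2) anti by (auto simp: Zs_def)
    then show ?thesis by (simp add: Xs_def rev_map[symmetric] sorted_wrt_rev)
  qed
  have ne: "\<forall>X\<in>set Xs. X \<noteq> {}"
  proof
    fix X assume "X \<in> set Xs"
    then obtain j where "j < length T" "X = Zs ! j" by (auto simp: Xs_def Zs_def in_set_conv_nth)
    then show "X \<noteq> {}" using nz(2)[of j] pos[of j] by auto
  qed
  have "kn_pair n (Zs ! Suc j) (Zs ! j)" if j: "Suc j < length T" for j
  proof -
    let ?X = "Zs ! Suc j" and ?Y = "Zs ! j"
    have jj: "j < length T" using j by simp
    have cX: "snd (T ! Suc j) = colw n ?X" "adm n ?X" using col[of "T ! Suc j"] nz(1)[OF j] j by auto
    have cY: "snd (T ! j) = colw n ?Y" "adm n ?Y" using col[of "T ! j"] nz(1)[OF jj] jj by auto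
    have le: "card ?X \<le> card ?Y" using nz(2)[OF j] nz(2)[OF jj] anti by simp
    let ?P = "split_form n T"
    have len: "length ?P = 2 * length T" unfolding split_form_eq by (rule length_pairs)
    have pX: "?P ! (2 * Suc j) = (0, colw n (lcol n ?X))"
      using nth_pairs[OF j, where l = "\<lambda>c. (fst c, left_column n (snd c))"
          and r = "\<lambda>c. (fst c, right_column n (snd c))"] fst0(1)[OF j] cX right_column_colw(2)[OF cX(2)] unfolding split_form_eq by simp
    have pY: "?P ! Suc (2 * j) = (0, colw n (rcol n ?Y))"
      using nth_pairs[OF jj, where l = "\<lambda>c. (fst c, left_column n (snd c))"
          and r = "\<lambda>c. (fst c, right_column n (snd c))"] fst0(1)[OF jj] cY right_column_colw(1)[OF cY(2)] unfolding split_form_eq by simp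
    have "rank n (colw n (rcol n ?Y) ! i) \<le> rank n (colw n (lcol n ?X) ! i)" if "i < card ?X" for i
    proof -
      have "(i, Suc (2 * j)) \<in> cells ?P" "(i, 2 * Suc j) \<in> cells ?P"
        unfolding cells_def using that le j len pX pY
        by (auto simp: length_colw[OF rset_letters] card_rcol_lcol cX(2) cY(2))
      moreover have "Suc (2 * j) < 2 * Suc j" by simp
      ultimately have "rank n (entry ?P i (Suc (2 * j))) \<le> rank n (entry ?P i (2 * Suc j))"
        using sp unfolding semistandard_def by blast
      then show ?thesis unfolding entry_def pX pY by simp
    qed
    then have "sst 0 (XA n (lcol n ?X)) (XA n (rcol n ?Y))"
      by (intro sst_if_entries rset_letters) (simp_all add: card_rcol_lcol cX(2) cY(2) le)
    then show ?thesis using le by (simp add: kn_pair_def XA_rcol)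
  qed
  then have "kn_chain n Xs"
    unfolding kn_chain_def Xs_def successively_rev unfolding successively_conv_nth
    by (simp add: Zs_def)
  moreover have "T = tab n Xs"
  proof -
    have "map (\<lambda>X. (0, colw n X)) Zs = map (\<lambda>c. c) T"
      unfolding Zs_def map_map comp_def
    proof (rule map_cong[OF refl])
      fix c assume "c \<in> set T"
      moreover from this obtain j where "j < length T" "c = T ! j" by (auto simp: in_set_conv_nth)
      ultimately have "snd c = colw n (set (snd c))" "fst c = 0" using col fst0(1) by auto
      then show "(0, colw n (set (snd c))) = c" by (metis prod.collapse)
    qed
    then show ?thesis using tab_sorted[OF sorted, of n] by (simp add: Xs_def)
  qed
  ultimately show ?thesis using that adX ne sorted by blast
qed

text \<open>Empty columns of the shape are dropped, in agreement with \<open>last_column\<close> and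
  with counting only lengths \<open>k \<ge> 1\<close>.\<close>

lemma skew_columns:
  assumes "S \<in> KN_skew \<mu> \<nu> n"
  obtains Xs where "adms n Xs" "column_reading S = colsw n Xs"
    "\<And>k. 1 \<le> k \<Longrightarrow> num_columns S k = count_list (map card Xs) k" "0 \<notin> set (map card Xs)"
    "Xs \<noteq> [] \<Longrightarrow> last_column S = colw n (hd Xs)"
proof -
  define Cs where "Cs = rev (filter (\<lambda>C. C \<noteq> []) (map snd S))"
  define Xs where "Xs = map set Cs"
  have col: "C = colw n (set C) \<and> adm n (set C) \<and> length C = card (set C)" if "C \<in> set (map snd S)" for C
  proof -
    have a: "admissible n C" using assms that unfolding KN_skew_def by auto
    then have "is_column n C" by (simp add: admissible_def)
    then have c: "C = colw n (set C)" "set C \<subseteq> letters n"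
      using is_column_eq by (auto simp: is_column_def)
    then have "adm n (set C)" using a admissible_colw by metis
    moreover have "length C = card (set C)" using c length_colw by metis
    ultimately show ?thesis using c by blast
  qed
  have colC: "C = colw n (set C) \<and> adm n (set C) \<and> length C = card (set C) \<and> C \<noteq> []" if "C \<in> set Cs" for C
    using that col by (auto simp: Cs_def)
  have map: "map (colw n) Xs = Cs"
    unfolding Xs_def using colC by (simp add: map_idI comp_def)
  show ?thesis
  proof
    show "adms n Xs" using colC by (auto simp: Xs_def list_all_iff)
    have cf: "concat (filter (\<lambda>C. C \<noteq> []) L) = concat L" for L :: "int list list"
      by (induction L) auto
    have "column_reading S = concat (rev (map snd S))" by (simp add: column_reading_def)
    also have "\<dots> = concat Cs" unfolding Cs_def rev_filter by (rule cf[symmetric])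
    finally show "column_reading S = colsw n Xs" unfolding colsw_def map .
    show "0 \<notin> set (map card Xs)" using colC by (force simp: Xs_def)
    show "last_column S = colw n (hd Xs)" if "Xs \<noteq> []"
    proof -
      have "colw n (hd Xs) = hd Cs" using that map by (metis hd_map)
      then show ?thesis by (simp add: last_column_def Cs_def hd_rev)
    qed
    fix k :: nat assume k: "1 \<le> k"
    have "num_columns S k = length (filter (\<lambda>C. length C = k) (map snd S))"
      by (simp add: num_columns_def filter_map comp_def case_prod_unfold)
    also have "filter (\<lambda>C. length C = k) (map snd S) =
        filter (\<lambda>C. length C = k) (filter (\<lambda>C. C \<noteq> []) (map snd S))"
      using k by (auto simp: filter_filter intro!: filter_cong)
    also have "length \<dots> = length (filter (\<lambda>C. length C = k) Cs)"
      by (simp add: Cs_def rev_filter[symmetric])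
    also have "\<dots> = count_list (map length Cs) k"
      by (induction Cs) auto
    also have "map length Cs = map card Xs"
      using colC by (simp add: Xs_def)
    finally show "num_columns S k = count_list (map card Xs) k" .
  qed
qed

section \<open>Rectification\<close>

lemma word_iso_sym:
  assumes "word_iso n w w'"
  shows "word_iso n w' w"
proof -
  obtain \<phi> where c: "crystal_iso n w w' \<phi>" and w: "\<phi> w = w'"
    using assms unfolding word_iso_def by blast
  then have b: "bij_betw \<phi> (component n w) (component n w')" by (simp add: crystal_iso_def)
  define \<psi> where "\<psi> = inv_into (component n w) \<phi>"
  have \<psi>: "\<psi> (\<phi> u) = u" if "u \<in> component n w" for u
    unfolding \<psi>_def using b that by (simp add: bij_betw_inv_into_left)
  have step: "v \<in> component n w"
    if "u \<in> component n w" "i \<in> {1..n}" "f_op n i u = Some v \<or> e_op n i u = Some v" for u v i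
  proof -
    have "0 < wphi n i u \<and> v = wlow n i u \<or> 0 < weps n i u \<and> v = wrai n i u"
      using that(3) by (auto simp: f_op_eq e_op_eq split: if_splits)
    then have "(u, v) \<in> crystal_edges n \<or> (v, u) \<in> crystal_edges n"
      using that(2) crystal_edges_iff crystal_edges_converse_iff by blast
    then show ?thesis using that(1) unfolding component_def by (auto intro: rtrancl_into_rtrancl)
  qed
  have "f_op n i (\<psi> u') = map_option \<psi> (f_op n i u') \<and>
      e_op n i (\<psi> u') = map_option \<psi> (e_op n i u') \<and> weight (\<psi> u') i = weight u' i"
    if u': "u' \<in> component n w'" and i: "i \<in> {1..n}" for u' i
  proof -
    obtain u where u: "u \<in> component n w" "u' = \<phi> u" using b u' by (auto simp: bij_betw_def)
    have e: "f_op n i u' = map_option \<phi> (f_op n i u)" "e_op n i u' = map_option \<phi> (e_op n i u)"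
      "weight u' i = weight u i"
      using c u i unfolding crystal_iso_def by blast+
    have "f_op n i u = map_option \<psi> (f_op n i u')" "e_op n i u = map_option \<psi> (e_op n i u')"
      unfolding e using step[OF u(1) i] \<psi> by (auto simp: option.map_comp intro!: option.map_ident_strong[symmetric])
    then show ?thesis using u \<psi> e(3) by simp
  qed
  moreover have "bij_betw \<psi> (component n w') (component n w)"
    unfolding \<psi>_def by (rule bij_betw_inv_into[OF b])
  ultimately have "crystal_iso n w' w \<psi>" unfolding crystal_iso_def by blast
  moreover have "\<psi> w' = w" using \<psi>[OF component_self] w by simp
  ultimately show ?thesis unfolding word_iso_def by blast
qed

lemma word_iso_refl: "word_iso n w w"
  by (rule word_iso_if_bisimulation[where R = "(=)"]) (auto simp: bisimulation_def bi_unique_def)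

text \<open>The column lengths of the highest weight tableau whose weight contains the fundamental
  weight of index \<open>k\<close> exactly \<open>f k\<close> times.\<close>

definition lens :: "nat \<Rightarrow> (nat \<Rightarrow> nat) \<Rightarrow> nat list" where
  "lens n f = concat (map (\<lambda>k. replicate (f k) k) [1..<Suc n])"

lemma lens_Suc: "lens (Suc n) f = lens n f @ replicate (f (Suc n)) (Suc n)"
  by (simp add: lens_def)

lemma lens_props:
  "sorted (lens n f)" "k \<in> set (lens n f) \<Longrightarrow> k \<in> {1..n}"
  "count_list (lens n f) k = (if k \<in> {1..n} then f k else 0)"
proof -
  have s: "k \<in> set (lens n f) \<Longrightarrow> k \<in> {1..n}" for k n
    by (auto simp: lens_def)
  then show "k \<in> set (lens n f) \<Longrightarrow> k \<in> {1..n}" .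
  show "sorted (lens n f)"
  proof (induction n)
    case (Suc n)
    have "\<forall>x\<in>set (lens n f). x \<le> Suc n" using s[of _ n] by fastforce
    then show ?case using Suc by (auto simp: lens_Suc sorted_append)
  qed (simp add: lens_def)
  have r: "count_list (replicate m x) k = (if x = k then m else 0)" for m and x k :: nat
    by (induction m) auto
  show "count_list (lens n f) k = (if k \<in> {1..n} then f k else 0)"
  proof (induction n)
    case (Suc n)
    then show ?case by (auto simp: lens_Suc r)
  qed (simp add: lens_def)
qed

lemma highest_transfer:
  assumes "word_iso n (colsw n Xs) (colsw n Ys)" "highest n Xs"
  shows "highest n Ys"
  using word_iso_colsw_D(1)[OF assms(1)] assms(2) by (simp add: highest_def)

text \<open>At highest weight \<open>Ceps\<close> vanishes, so \<open>Cphi\<close> is a difference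
  of weight entries, or the last entry for \<open>i = n\<close>; these are preserved by
  isomorphisms.\<close>

lemma Cphi_transfer:
  assumes "word_iso n (colsw n Xs) (colsw n Ys)" "highest n Xs" "i \<in> {1..n}"
  shows "Cphi n i Xs = Cphi n i Ys"
proof -
  have w: "weight (colsw n Xs) j = weight (colsw n Ys) j" if "j \<in> {1..n}" for j
    by (rule word_iso_eps_phi(3)[OF assms(1) that])
  have "Ceps n i Xs = 0" "Ceps n i Ys = 0"
    using highest_transfer[OF assms(1,2)] assms(2,3) by (auto simp: highest_def)
  then show ?thesis
    using wphi_minus_weps[OF assms(3), of "colsw n Xs"] wphi_minus_weps[OF assms(3), of "colsw n Ys"]
      colsw_eps_phi[of n i Xs] colsw_eps_phi[of n i Ys] w[OF assms(3)] w[of "Suc i"]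
    by (auto split: if_splits)
qed

lemma highest_hcol: "\<forall>k\<in>set ks. k \<le> n \<Longrightarrow> highest n (map hcol ks)"
  by (simp add: highest_def Ceps_Cphi_hcol)

lemma adms_card:
  assumes "adms n Xs"
  shows "\<forall>k\<in>set (map card Xs). k \<le> n"
  using assms adm_card by (auto simp: list_all_iff)

lemma count_outside:
  fixes ks :: "nat list"
  assumes "\<forall>k\<in>set ks. k \<le> n" "0 \<notin> set ks" "i \<notin> {1..n}"
  shows "count_list ks i = 0"
proof (rule count_notin)
  show "i \<notin> set ks" using assms by (cases i) auto
qed

text \<open>Retracing the path among KN chains ends at a highest weight tableau with the same
  increasing lengths, and \<open>kn_highest\<close> leaves one possibility for it.\<close>

lemma KN_iso_highest:
  assumes "adms n Zs" "sorted (map card Zs)" "kn_chain n Zs" "adms n Ys" "highest n Ys"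
    and "fpath n p Ys = Some Xs" "word_iso n (colsw n Xs) (colsw n Zs)"
  shows "fpath n p (map hcol (map card Zs)) = Some Zs"
    and "word_iso n (colsw n Ys) (colsw n (map hcol (map card Zs)))"
proof -
  obtain Ws where W: "adms n Ws" "kn_chain n Ws" "fpath n p Ws = Some Zs"
    "word_iso n (colsw n Ys) (colsw n Ws)"
    using fpath_backward[OF assms(4,1,7,6), where P = "kn_chain n"] assms(3) kn_chain_rai by blast
  have "map card Zs = map card Ws" using fpath_adms[OF W(1,3)] by simp
  moreover from this have "Ws = map hcol (map card Ws)"
    using kn_highest[OF W(1) _ W(2) highest_transfer[OF W(4) assms(5)]] assms(2) by simp
  ultimately have "Ws = map hcol (map card Zs)" by simp
  then show "fpath n p (map hcol (map card Zs)) = Some Zs"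
    "word_iso n (colsw n Ys) (colsw n (map hcol (map card Zs)))"
    using W by simp_all
qed

text \<open>For existence, the path to \<open>Xs\<close> is replayed from the sorted columns with
  lengths \<open>lens\<close>. For uniqueness, the lengths of a tableau are recovered from
  \<open>Cphi\<close> at highest weight, and then the path determines the tableau.\<close>

lemma rectification_ex1:
  assumes "0 < n" "adms n Xs"
  shows "\<exists>!T. (\<exists>lam. length lam \<le> n \<and> T \<in> KN lam n) \<and> word_iso n (colsw n Xs) (column_reading T)"
proof (rule ex_ex1I)
  obtain p Ys where Y: "adms n Ys" "highest n Ys" "fpath n p Ys = Some Xs"
    using highest_reachable[OF assms(2)] by blast
  define ks where "ks = lens n (\<lambda>k. Cphi n k Ys)"
  have ks: "\<forall>k\<in>set ks. k \<le> n" "0 \<notin> set ks" "sorted ks"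
    using lens_props(1)[of n "\<lambda>k. Cphi n k Ys"] lens_props(2)[of _ n "\<lambda>k. Cphi n k Ys"]
    unfolding ks_def by fastforce+
  have "\<forall>i\<in>{1..n}. Cphi n i Ys = Cphi n i (map hcol ks)"
    using Ceps_Cphi_hcol(2)[OF _ ks(1)] by (simp add: ks_def lens_props(3))
  then have "word_iso n (colsw n Ys) (colsw n (map hcol ks))"
    by (intro highest_word_iso assms(1) Y adms_hcol ks highest_hcol)
  from fpath_forward[OF Y(1) adms_hcol[OF ks(1)] this Y(3)] obtain Zs where
    Z: "fpath n p (map hcol ks) = Some Zs" "word_iso n (colsw n Xs) (colsw n Zs)" by blast
  have aZ: "adms n Zs" "map card Zs = ks"
    using fpath_adms[OF adms_hcol[OF ks(1)] Z(1)] by (simp_all add: comp_def)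
  have "\<forall>X\<in>set Zs. X \<noteq> {}" using aZ(2) ks(2) by force
  from tab_KN[OF aZ(1) this kn_chain_fpath[OF adms_hcol[OF ks(1)] kn_chain_hcol[OF ks(1)] Z(1)]]
  show "\<exists>T. (\<exists>lam. length lam \<le> n \<and> T \<in> KN lam n) \<and> word_iso n (colsw n Xs) (column_reading T)"
    using Z(2) aZ(2) ks(3) column_reading_tab by metis
  fix T T'
  assume T: "(\<exists>lam. length lam \<le> n \<and> T \<in> KN lam n) \<and> word_iso n (colsw n Xs) (column_reading T)"
    and T': "(\<exists>lam. length lam \<le> n \<and> T' \<in> KN lam n) \<and> word_iso n (colsw n Xs) (column_reading T')"
  have dec: "\<exists>Zs ks. T = tab n Zs \<and> fpath n p (map hcol ks) = Some Zs \<and>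
      (\<forall>i\<in>{1..n}. Cphi n i Ys = count_list ks i) \<and> (\<forall>k\<in>set ks. k \<le> n) \<and> 0 \<notin> set ks \<and> sorted ks"
    if T: "T \<in> KN lam n" "word_iso n (colsw n Xs) (column_reading T)" for T lam
  proof -
    obtain Zs where Z: "T = tab n Zs" "adms n Zs" "\<forall>X\<in>set Zs. X \<noteq> {}" "sorted (map card Zs)"
      "kn_chain n Zs"
      using KN_columns[OF T(1)] by blast
    have iso: "word_iso n (colsw n Xs) (colsw n Zs)" using T(2) Z(1) column_reading_tab by simp
    note h = KN_iso_highest[OF Z(2,4,5) Y iso]
    have "0 \<notin> set (map card Zs)"
    proof
      assume "0 \<in> set (map card Zs)"
      then obtain X where X: "X \<in> set Zs" "card X = 0" by auto
      then have "X \<subseteq> set (alph n)" using Z(2) set_alph by (auto simp: list_all_iff adm_def)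
      then have "finite X" using finite_subset by blast
      then show False using X Z(3) by simp
    qed
    moreover have "Cphi n i Ys = count_list (map card Zs) i" if "i \<in> {1..n}" for i
      using Cphi_transfer[OF h(2) Y(2) that] Ceps_Cphi_hcol(2)[OF that adms_card[OF Z(2)]] by simp
    ultimately show ?thesis using h(1) Z(1,4) adms_card[OF Z(2)] by blast
  qed
  obtain Zs ks where
    Z: "T = tab n Zs" "fpath n p (map hcol ks) = Some Zs" "\<forall>i\<in>{1..n}. Cphi n i Ys = count_list ks i"
      "\<forall>k\<in>set ks. k \<le> n" "0 \<notin> set ks" "sorted ks"
    using T dec by blast
  obtain Zs' ks' where
    Z': "T' = tab n Zs'" "fpath n p (map hcol ks') = Some Zs'" "\<forall>i\<in>{1..n}. Cphi n i Ys = count_list ks' i"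
      "\<forall>k\<in>set ks'. k \<le> n" "0 \<notin> set ks'" "sorted ks'"
    using T' dec by blast
  have "count_list ks i = count_list ks' i" for i
    using Z(3) Z'(3) count_outside[OF Z(4,5), of i] count_outside[OF Z'(4,5), of i]
    by (cases "i \<in> {1..n}") auto
  then have "ks = ks'" using sorted_eq_if_count Z(6) Z'(6) by blast
  then show "T = T'" using Z(1,2) Z'(1,2) by simp
qed

lemma P_tableau_iff:
  assumes "0 < n" "adms n Xs" "length lam \<le> n" "T \<in> KN lam n"
  shows "P_tableau n (colsw n Xs) = T \<longleftrightarrow> word_iso n (colsw n Xs) (column_reading T)"
proof -
  let ?Q = "\<lambda>T. (\<exists>lam. length lam \<le> n \<and> T \<in> KN lam n) \<and> word_iso n (colsw n Xs) (column_reading T)"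
  have e: "\<exists>!T. ?Q T" by (rule rectification_ex1[OF assms(1,2)])
  have P: "P_tableau n (colsw n Xs) = (THE T. ?Q T)"
    unfolding P_tableau_def word_iso_def by simp
  show ?thesis
  proof
    assume "P_tableau n (colsw n Xs) = T"
    then show "word_iso n (colsw n Xs) (column_reading T)" using theI'[OF e] P by simp
  next
    assume "word_iso n (colsw n Xs) (column_reading T)"
    then have "?Q T" using assms(3,4) by blast
    then show "P_tableau n (colsw n Xs) = T" unfolding P by (rule the1_equality[OF e])
  qed
qed

section \<open>The right key\<close>

lemma finite_letters: "finite (letters n)"
  by (metis List.finite_set set_alph)

lemma nonempty_if_card:
  assumes "0 \<notin> set (map card Xs)"
  shows "\<forall>X\<in>set Xs. X \<noteq> {}"
  using assms by force

text \<open>Skew tableaux are exchanged for rearrangements of the lengths. A skew tableau is pulled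
  back along the path of \<open>T\<close>, and by \<open>maximal_weight\<close> its source consists
  of columns \<open>hcol\<close>; conversely, \<open>tab\<close> realizes the endpoint of a path as
  a skew tableau.\<close>

lemma right_key_columns_iff:
  assumes "0 < n" "length lam \<le> n" "T \<in> KN lam n" "T = tab n Xs" "adms n Xs" "Xs \<noteq> []"
    and "0 \<notin> set (map card Xs)" and p: "fpath n p (map hcol (map card Xs)) = Some Xs"
  shows "D \<in> right_key_columns n T \<longleftrightarrow>
    (\<exists>k ls Zs. (\<forall>i. count_list (k # ls) i = count_list (map card Xs) i) \<and>
       fpath n p (map hcol (k # ls)) = Some Zs \<and> D = colw n (rcol n (hd Zs)))"
    (is "_ \<longleftrightarrow> ?R")
proof -
  let ?ks = "map card Xs"
  have kn: "\<forall>k\<in>set ?ks. k \<le> n" by (rule adms_card[OF assms(5)])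
  have numT: "num_columns T k = count_list ?ks k" for k
  proof -
    have "num_columns T k = length (filter (\<lambda>c. length (snd c) = k) T)"
      by (simp add: num_columns_def case_prod_unfold)
    also have "\<dots> = length (filter (\<lambda>C. length C = k) (map snd T))"
      by (simp add: filter_map comp_def)
    also have "map snd T = rev (map (colw n) Xs)"
    proof -
      have "map snd T = map (colw n) (rev (map snd (place 0 Xs)))"
        by (simp add: assms(4) tab_def rev_map comp_def)
      then show ?thesis unfolding map_snd_place by (simp add: rev_map)
    qed
    also have "length (filter (\<lambda>C. length C = k) (rev (map (colw n) Xs))) = count_list ?ks k"
      using assms(5) by (induction Xs) (auto simp: length_colw adm_def)
    finally show ?thesis .
  qed
  have crT: "column_reading T = colsw n Xs" by (simp add: assms(4) column_reading_tab)
  have high: "adms n (map hcol ?ks)" "highest n (map hcol ?ks)"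
    using adms_hcol[OF kn] highest_hcol[OF kn] by auto
  show ?thesis
  proof
    assume "D \<in> right_key_columns n T"
    then obtain S \<mu> \<nu> where S: "D = right_column n (last_column S)" "S \<in> KN_skew \<mu> \<nu> n"
      "\<forall>k\<ge>1. num_columns S k = num_columns T k" "rectification n S = T"
      unfolding right_key_columns_def by blast
    obtain Zs where Z: "adms n Zs" "column_reading S = colsw n Zs"
      "\<And>k. 1 \<le> k \<Longrightarrow> num_columns S k = count_list (map card Zs) k" "0 \<notin> set (map card Zs)"
      "Zs \<noteq> [] \<Longrightarrow> last_column S = colw n (hd Zs)"
      using skew_columns[OF S(2)] by blast
    \<comment> \<open>The hypothesis compares lengths from 1 on; length 0 occurs on neither side, as
      all listed columns are nonempty.\<close>
    have cnt: "count_list ?ks i = count_list (map card Zs) i" for i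
    proof (cases "1 \<le> i")
      case True
      then show ?thesis using S(3) Z(3) numT by simp
    next
      case False
      then show ?thesis using assms(7) Z(4) count_notin by (metis less_one not_le)
    qed
    have ne: "Zs \<noteq> []"
    proof
      assume "Zs = []"
      then have "count_list ?ks (card (hd Xs)) = 0" using cnt by simp
      moreover have "card (hd Xs) \<in> set ?ks" using assms(6) by simp
      ultimately show False by (metis count_list_0_iff)
    qed
    have "word_iso n (colsw n Zs) (colsw n Xs)"
      using P_tableau_iff[OF assms(1) Z(1) assms(2,3)] S(4) Z(2) crT by (simp add: rectification_def)
    from fpath_backward[OF high(1) Z(1) word_iso_sym[OF this] p, where P = "\<lambda>_. True"]
    obtain Ws where W: "adms n Ws" "fpath n p Ws = Some Zs"
      "word_iso n (colsw n (map hcol ?ks)) (colsw n Ws)" by blast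
    have cW: "map card Ws = map card Zs" using fpath_adms[OF W(1,2)] by simp
    have "Ws = map hcol (map card Ws)"
      using maximal_weight[OF W(1) kn] cnt word_iso_eps_phi(3)[OF W(3)] unfolding cW by metis
    then have W': "Ws = map hcol (map card Zs)" using cW by simp
    obtain Z0 Zs' where Zs: "Zs = Z0 # Zs'" using ne by (cases Zs) auto
    have "adm n (hd Zs)" using Z(1) ne by (cases Zs) auto
    then have "D = colw n (rcol n (hd Zs))" using S(1) Z(5)[OF ne] right_column_colw(1) by simp
    moreover have "fpath n p (map hcol (card Z0 # map card Zs')) = Some Zs" using W(2) W' Zs by simp
    moreover have "\<forall>i. count_list (card Z0 # map card Zs') i = count_list ?ks i" using cnt Zs by simp
    ultimately show ?R by blast
  next
    assume ?R
    then obtain k ls Zs where r: "\<And>i. count_list (k # ls) i = count_list ?ks i"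
      "fpath n p (map hcol (k # ls)) = Some Zs" "D = colw n (rcol n (hd Zs))" by blast
    have st: "set (k # ls) = set ?ks" using r(1) by (metis count_list_0_iff subsetI subset_antisym)
    then have kl: "\<forall>j\<in>set (k # ls). j \<le> n" "0 \<notin> set (k # ls)" using kn assms(7) by auto
    note f = fpath_adms[OF adms_hcol[OF kl(1)] r(2)]
    have cZ: "adms n Zs" "map card Zs = k # ls" using f by (simp_all add: comp_def)
    have ne: "\<forall>X\<in>set Zs. X \<noteq> {}" using nonempty_if_card cZ(2) kl(2) by metis
    have ch: "kn_chain n Zs"
      by (rule kn_chain_fpath[OF adms_hcol[OF kl(1)] kn_chain_hcol[OF kl(1)] r(2)])
    define S where "S = tab n Zs"
    have S: "S \<in> KN_skew (conjugate (map (\<lambda>c. fst c + length (snd c)) S)) (conjugate (map fst S)) n"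
      unfolding S_def by (rule tab_KN_skew[OF cZ(1) ne ch])
    have crS: "column_reading S = colsw n Zs" unfolding S_def by (rule column_reading_tab)
    have mapS: "map snd S = rev (map (colw n) Zs)"
    proof -
      have "map snd S = map (colw n) (rev (map snd (place 0 Zs)))"
        by (simp add: S_def tab_def rev_map comp_def)
      then show ?thesis unfolding map_snd_place by (simp add: rev_map)
    qed
    have "num_columns S j = count_list (map card Zs) j" for j
    proof -
      have "num_columns S j = length (filter (\<lambda>C. length C = j) (map snd S))"
        by (simp add: num_columns_def case_prod_unfold filter_map comp_def)
      also have "\<dots> = count_list (map card Zs) j"
        unfolding mapS using cZ(1) by (induction Zs) (auto simp: length_colw adm_def)
      finally show ?thesis .
    qed
    then have num: "\<forall>j\<ge>1. num_columns S j = num_columns T j" using r(1) cZ(2) numT by simp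
    have "word_iso n (colsw n (map hcol (k # ls))) (colsw n (map hcol ?ks))"
      by (rule highest_word_iso[OF assms(1) adms_hcol[OF kl(1)] highest_hcol[OF kl(1)] high])
        (use Ceps_Cphi_hcol(2)[OF _ kl(1)] Ceps_Cphi_hcol(2)[OF _ kn] r(1) in simp)
    from fpath_forward[OF adms_hcol[OF kl(1)] high(1) this r(2)]
    have "word_iso n (colsw n Zs) (colsw n Xs)" using p by simp
    then have rec: "rectification n S = T"
      using P_tableau_iff[OF assms(1) cZ(1) assms(2,3)] crS crT by (simp add: rectification_def)
    have nZ: "Zs \<noteq> []" using cZ(2) by auto
    have nC: "colw n X \<noteq> []" if "X \<in> set Zs" for X
    proof -
      have "adm n X" "X \<noteq> {}" using that cZ(1) ne by (auto simp: list_all_iff)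
      then show ?thesis using set_colw[of X n] by (auto simp: adm_def)
    qed
    have "filter (\<lambda>C. C \<noteq> []) (map snd S) = map snd S"
      unfolding mapS using nC by (intro filter_True) auto
    then have "last_column S = colw n (hd Zs)"
      unfolding last_column_def mapS using nZ by (simp add: last_rev hd_map)
    moreover have "adm n (hd Zs)" using cZ(1) nZ by (cases Zs) auto
    ultimately have "D = right_column n (last_column S)" using r(3) right_column_colw(1) by simp
    then show "D \<in> right_key_columns n T" unfolding right_key_columns_def using S num rec by blast
  qed
qed

theorem theorem11:
  fixes n :: nat and lam :: "nat list" and T :: tableau
  assumes "n \<ge> 1"
    and "is_partition lam"
    and "length lam \<le> n"
    and "T \<in> KN lam n"
  shows "key_tableau n (right_key n T)"
proof -
  have n: "0 < n" using assms(1) by simp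
  obtain Xs where X: "T = tab n Xs" "adms n Xs" "\<forall>X\<in>set Xs. X \<noteq> {}" "sorted (map card Xs)"
    "kn_chain n Xs"
    using KN_columns[OF assms(4)] by blast
  let ?ks = "map card Xs"
  have kn: "\<forall>k\<in>set ?ks. k \<le> n" by (rule adms_card[OF X(2)])
  have nz: "0 \<notin> set ?ks"
  proof
    assume "0 \<in> set ?ks"
    then obtain Y where Y: "Y \<in> set Xs" "card Y = 0" by auto
    then have "finite Y" using X(2) finite_subset[OF _ finite_letters] by (auto simp: list_all_iff adm_def)
    then show False using Y X(3) by simp
  qed
  obtain p Ys where Y: "adms n Ys" "highest n Ys" "fpath n p Ys = Some Xs"
    using highest_reachable[OF X(2)] by blast
  have p: "fpath n p (map hcol ?ks) = Some Xs"
    by (rule KN_iso_highest(1)[OF X(2,4,5) Y word_iso_refl])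
  \<comment> \<open>Putting \<open>k\<close> in front of the other lengths makes the last column
    have length \<open>k\<close>.\<close>
  have ex: "\<exists>Zs. fpath n p (map hcol (k # remove1 k ?ks)) = Some Zs" if k: "k \<in> set ?ks" for k
  proof -
    let ?ls = "k # remove1 k ?ks"
    have kl: "\<forall>j\<in>set ?ls. j \<le> n" using kn k set_remove1_subset[of k ?ks] by auto
    have "word_iso n (colsw n (map hcol ?ks)) (colsw n (map hcol ?ls))"
      by (rule highest_word_iso[OF n adms_hcol[OF kn] highest_hcol[OF kn] adms_hcol[OF kl] highest_hcol[OF kl]])
        (use Ceps_Cphi_hcol(2)[OF _ kl] Ceps_Cphi_hcol(2)[OF _ kn] count_remove1[OF k] in simp)
    from fpath_forward[OF adms_hcol[OF kn] adms_hcol[OF kl] this p] show ?thesis by blast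
  qed
  define Z where "Z k = the (fpath n p (map hcol (k # remove1 k ?ks)))" for k
  have Z: "fpath n p (map hcol (k # remove1 k ?ks)) = Some (Z k)" if "k \<in> set ?ks" for k
    using ex[OF that] by (auto simp: Z_def)
  define K where "K k = rcol n (hd (Z k))" for k
  have mono: "RA n (hd Ws) \<subseteq> RA n (hd Ws')"
    if "\<And>i. count_list (k # ls) i = count_list ?ks i" "\<And>i. count_list (k' # ls') i = count_list ?ks i"
      "k \<le> k'" "fpath n p (map hcol (k # ls)) = Some Ws" "fpath n p (map hcol (k' # ls')) = Some Ws'"
    for k ls k' ls' Ws Ws'
  proof -
    have st: "set (k # ls) = set ?ks" "set (k' # ls') = set ?ks"
      using that(1,2) by (metis count_list_0_iff subsetI subset_antisym)+
    then have "\<forall>j\<in>set (k # ls). j \<le> n" "\<forall>j\<in>set (k' # ls'). j \<le> n" using kn by auto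
    moreover have "0 < k" using st(1) nz by (metis gr0I list.set_intros(1))
    ultimately show ?thesis using first_column_mono[OF n] that by metis
  qed
  have cr: "count_list (k # remove1 k ?ks) i = count_list ?ks i" if "k \<in> set ?ks" for k i
    by (rule count_remove1[OF that])
  have nested: "K k \<subseteq> K l" if "k \<in> set ?ks" "l \<in> set ?ks" "k \<le> l" for k l
    unfolding K_def
    by (rule rset_mono[OF mono[OF cr[OF that(1)] cr[OF that(2)] that(3) Z[OF that(1)] Z[OF that(2)]]])
  have Zk: "adm n (hd (Z k)) \<and> card (hd (Z k)) = k" if k: "k \<in> set ?ks" for k
  proof -
    have kl: "\<forall>j\<in>set (k # remove1 k ?ks). j \<le> n" using kn k set_remove1_subset[of k ?ks] by auto
    have "adms n (Z k)" "map card (Z k) = k # remove1 k ?ks"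
      using fpath_adms[OF adms_hcol[OF kl] Z[OF k]] by (simp_all add: comp_def)
    then show ?thesis by (cases "Z k") auto
  qed
  have cardK: "card (K k) = k" if "k \<in> set ?ks" for k
    using Zk[OF that] card_rcol_lcol(1) by (simp add: K_def)
  have K: "K k \<subseteq> letters n" "0 < i \<Longrightarrow> i \<le> n \<Longrightarrow> \<not> both (K k) i" for k i
    unfolding K_def by (rule rset_letters, rule rcol_no_both)
  \<comment> \<open>Two right columns of the same length contain each other, by \<open>mono\<close>
    in both directions, so the description has a unique solution.\<close>
  have the: "(THE D. D \<in> right_key_columns n T \<and> length D = k) = colw n (K k)" if k: "k \<in> set ?ks" for k
  proof (rule the_equality)
    have ne: "Xs \<noteq> []" using k by auto
    note iff = right_key_columns_iff[OF n assms(3,4) X(1,2) ne nz p]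
    have len: "length (colw n (K k)) = k" using length_colw[OF K(1)] cardK[OF k] by simp
    show "colw n (K k) \<in> right_key_columns n T \<and> length (colw n (K k)) = k"
      unfolding iff using cr[OF k] Z[OF k] len unfolding K_def by blast
    fix D assume D: "D \<in> right_key_columns n T \<and> length D = k"
    then obtain l ls Zs where r: "\<And>i. count_list (l # ls) i = count_list ?ks i"
      "fpath n p (map hcol (l # ls)) = Some Zs" "D = colw n (rcol n (hd Zs))"
      unfolding iff by blast
    have st: "set (l # ls) = set ?ks" using r(1) by (metis count_list_0_iff subsetI subset_antisym)
    then have kl: "\<forall>j\<in>set (l # ls). j \<le> n" using kn by simp
    have "adms n Zs" "map card Zs = l # ls"
      using fpath_adms[OF adms_hcol[OF kl] r(2)] by (simp_all add: comp_def)
    then have "adm n (hd Zs)" "card (hd Zs) = l" by (cases Zs; auto)+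
    then have "length D = l" using r(3) length_colw[OF rset_letters] card_rcol_lcol(1) by simp
    then have lk: "l = k" using D by simp
    have "RA n (hd Zs) = RA n (hd (Z k))"
      using mono[OF r(1) cr[OF k] _ r(2) Z[OF k]] mono[OF cr[OF k] r(1) _ Z[OF k] r(2)] lk by auto
    then show "D = colw n (K k)" using r(3) by (simp add: K_def)
  qed
  define Ks where "Ks = map K ?ks"
  have cardKs: "map card Ks = ?ks"
    unfolding Ks_def map_map comp_def by (rule map_cong[OF refl]) (use cardK in auto)
  have admKs: "adms n Ks"
    unfolding Ks_def list_all_iff using no_both_adm[OF K] by auto
  have sorted: "sorted (map card Ks)" using X(4) cardKs by simp
  have "right_key n T = map (\<lambda>X. (0, THE D. D \<in> right_key_columns n T \<and> length D = length (colw n X))) (rev Xs)"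
    unfolding right_key_def X(1)[THEN trans, OF tab_sorted[OF X(4)]] by (simp add: comp_def)
  also have "\<dots> = map (\<lambda>X. (0, colw n (K (card X)))) (rev Xs)"
  proof (rule map_cong[OF refl])
    fix X assume "X \<in> set (rev Xs)"
    then have "adm n X" "card X \<in> set ?ks" using X(2) by (auto simp: list_all_iff)
    then show "(0::nat, THE D. D \<in> right_key_columns n T \<and> length D = length (colw n X)) =
        (0, colw n (K (card X)))"
      using the length_colw[of X n] by (simp add: adm_def)
  qed
  also have "\<dots> = map (\<lambda>X. (0, colw n X)) (rev Ks)" by (simp add: Ks_def rev_map comp_def)
  finally have rk: "right_key n T = map (\<lambda>X. (0, colw n X)) (rev Ks)" .
  then have rk': "right_key n T = tab n Ks" using tab_sorted[OF sorted] by simp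
  have nestedKs: "Ks ! i \<subseteq> Ks ! j" if "i \<le> j" "j < length Ks" for i j
  proof -
    have "?ks ! i \<le> ?ks ! j" using X(4) that by (intro sorted_nth_mono) (auto simp: Ks_def)
    then show ?thesis using nested[of "?ks ! i" "?ks ! j"] that by (simp add: Ks_def)
  qed
  \<comment> \<open>Columns without opposite letters are their own left and right columns, so
    nesting gives the counting inequality.\<close>
  have "kn_pair n (Ks ! i) (Ks ! Suc i)" if "Suc i < length Ks" for i
  proof -
    have s: "Ks ! i \<subseteq> Ks ! Suc i" using nestedKs that by simp
    have b: "\<not> both (Ks ! j) q" if "j < length Ks" "0 < q" "q \<le> n" for j q
      using K(2) that by (simp add: Ks_def)
    have lt: "Ks ! j \<subseteq> letters n" if "j < length Ks" for j using K(1) that by (simp add: Ks_def)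
    have "XA n (Ks ! i) \<subseteq> XA n (Ks ! Suc i)"
      using s lt that by (simp add: XA_ranks image_mono)
    moreover have "LA n (Ks ! i) = XA n (Ks ! i)" "RA n (Ks ! Suc i) = XA n (Ks ! Suc i)"
      unfolding XA_def using no_both_RA_LA b that by simp_all
    moreover have "cnt U x \<le> cnt V x" if "U \<subseteq> V" for U V x
      using that by (induction x) auto
    ultimately show ?thesis by (simp add: kn_pair_def sst_def trans_le_add1)
  qed
  then have chain: "kn_chain n Ks" unfolding kn_chain_def successively_conv_nth by blast
  have "\<forall>X\<in>set Ks. X \<noteq> {}" by (rule nonempty_if_card) (simp add: cardKs nz del: set_map)
  then have kn_key: "\<exists>lam. right_key n T \<in> KN lam n"
    unfolding rk' using tab_KN[OF admKs _ chain sorted] by blast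
  moreover have "set (snd (right_key n T ! Suc j)) \<subseteq> set (snd (right_key n T ! j))"
    if "Suc j < length (right_key n T)" for j
  proof -
    have j: "Suc j < length Ks" using that by (simp add: rk)
    have "Ks ! (length Ks - Suc (Suc j)) \<subseteq> Ks ! (length Ks - Suc j)" using nestedKs j by simp
    then show ?thesis using j by (auto simp: rk rev_nth colw_def)
  qed
  moreover have "\<not> (int i \<in> set (column_reading (right_key n T)) \<and>
      - int i \<in> set (column_reading (right_key n T)))" if i: "i \<in> {1..n}" for i
  proof
    assume a: "int i \<in> set (column_reading (right_key n T)) \<and>
      - int i \<in> set (column_reading (right_key n T))"
    have "set (column_reading (right_key n T)) \<subseteq> \<Union> (set Ks)"
      unfolding rk' column_reading_tab by (auto simp: colsw_def colw_def)
    then obtain X Y where "X \<in> set Ks" "int i \<in> X" "Y \<in> set Ks" "- int i \<in> Y" using a by blast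
    then obtain j j' where "j < length Ks" "int i \<in> Ks ! j" "j' < length Ks" "- int i \<in> Ks ! j'"
      unfolding in_set_conv_nth by blast
    \<comment> \<open>By nesting, both letters lie in the larger of the two columns, and a right
      column contains no opposite letters.\<close>
    then have "int i \<in> Ks ! max j j'" "- int i \<in> Ks ! max j j'" "max j j' < length Ks"
      using nestedKs[of j "max j j'"] nestedKs[of j' "max j j'"] by auto
    then have "both (Ks ! max j j') i" by (simp add: both_def pos_def neg_def)
    then show False using K(2)[of i] i \<open>max j j' < length Ks\<close> by (simp add: Ks_def)
  qed
  ultimately show ?thesis unfolding key_tableau_def by blast
qed

end
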